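(* Let $p>2$ and let $A$ satisfy the symmetry (S). Then $$\lim_{\ell\to\infty}\beta_2(\Omega_\ell)=\lim_{\ell\to\infty}\lambda_M^1(\Omega_\ell).$$
   Context: Let $n\ge2$ and let $\omega\subset\mathbb{R}^{n-1}$ be a bounded open set. Points of $\mathbb{R}^n$ are written $x=(x_1,X_2)$ with $x_1\in\mathbb{R}$, $X_2\in\mathbb{R}^{n-1}$. For $\ell>0$, $\Omega_\ell=(-\ell,\ell)\times\omega$ and $\gamma_\ell=(-\ell,\ell)\times\partial\omega$. $A=A(X_2)$, $X_2\in\omega$, is a symmetric $n\times n$ matrix with bounded measurable entries. There are constants $C,\lambda>0$ such that $\|A(X_2)\|\le C$ and $A(X_2)\xi\cdot\xi\ge\lambda|\xi|^2$ for a.e. $X_2\in\omega$ and all $\xi\in\mathbb{R}^n$. Symmetry (S): $A$ satisfies (S) if $\omega=-\omega$ and $A(-X_2)=A(X_2)$. $V(\Omega_\ell)=\{v\in W^{1,p}(\Omega_\ell): v=0\text{ on }\gamma_\ell\}$ (in the sense of traces) and $\lambda_M^1(\Omega_\ell)=\inf_{0\ne u\in V(\Omega_\ell)}\frac{\int_{\Omega_\ell}|A\nabla u\cdot\nabla u|^{p/2}}{\int_{\Omega_\ell}|u|^p}$. Krasnoselskii genus: for a Banach space $V$ and a closed symmetric set $B=-B\subset V$, $\gamma(B)$ is the least $m$ such that there is a continuous odd map $h:B\to\mathbb{R}^m\setminus\{0\}$; $\gamma(B)=\infty$ if there is no such $m$ (in particular if $0\in B$); and $\gamma(\emptyset)=0$.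 Krasnoselskii eigenvalues: let $M_\ell=\{u\in V(\Omega_\ell):\int_{\Omega_\ell}|u|^p=1\}$ and $E_\ell(u)=\int_{\Omega_\ell}|A\nabla u\cdot\nabla u|^{p/2}$. For $k\in\mathbb{N}$, $k\ge1$, let $\mathcal{F}_k$ be the family of closed symmetric subsets $B$ of $V(\Omega_\ell)$ with $B\subset M_\ell$ and $\gamma(B)\ge k$, and set $\beta_k(\Omega_\ell)=\inf_{B\in\mathcal{F}_k}\sup_{u\in B}E_\ell(u)$. *)

theory Defs
  imports "HOL-Analysis.Analysis"
begin

subsection \<open>Test functions, weak gradients, Sobolev spaces\<close>

primrec Ck :: "nat \<Rightarrow> ('a::euclidean_space \<Rightarrow> real) \<Rightarrow> bool" where
  "Ck 0 f \<longleftrightarrow> continuous_on UNIV f"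
| "Ck (Suc k) f \<longleftrightarrow> f differentiable_on UNIV \<and>
     (\<forall>b\<in>Basis. Ck k (\<lambda>x. frechet_derivative f (at x) b))"

definition test_functions :: "'a::euclidean_space set \<Rightarrow> ('a \<Rightarrow> real) set" where
  "test_functions \<Omega> =
     {\<phi>. (\<forall>k. Ck k \<phi>) \<and> compact (closure {x. \<phi> x \<noteq> 0}) \<and> closure {x. \<phi> x \<noteq> 0} \<subseteq> \<Omega>}"

definition locally_integrable ::
  "'a::euclidean_space set \<Rightarrow> ('a \<Rightarrow> 'b::euclidean_space) \<Rightarrow> bool" where
  "locally_integrable \<Omega> f \<longleftrightarrow>
     (\<forall>K. compact K \<and> K \<subseteq> \<Omega> \<longrightarrow> set_integrable lebesgue K f)"

definition has_weak_gradient ::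
  "'a::euclidean_space set \<Rightarrow> ('a \<Rightarrow> real) \<Rightarrow> ('a \<Rightarrow> 'a) \<Rightarrow> bool" where
  "has_weak_gradient \<Omega> u G \<longleftrightarrow>
     locally_integrable \<Omega> u \<and> locally_integrable \<Omega> G \<and>
     (\<forall>\<phi>\<in>test_functions \<Omega>. \<forall>b\<in>Basis.
        integral\<^sup>L (lebesgue_on \<Omega>) (\<lambda>x. u x * frechet_derivative \<phi> (at x) b) =
        - integral\<^sup>L (lebesgue_on \<Omega>) (\<lambda>x. (G x \<bullet> b) * \<phi> x))"

text \<open>A weak gradient on an open set is unique up to null sets; the choice below picks a
  representative, and it is used only under integrals over \<open>\<Omega>\<close>.\<close>

definition weak_gradient ::
  "'a::euclidean_space set \<Rightarrow> ('a \<Rightarrow> real) \<Rightarrow> 'a \<Rightarrow> 'a" where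
  "weak_gradient \<Omega> u = (SOME G. has_weak_gradient \<Omega> u G)"

definition Lp ::
  "'a::euclidean_space set \<Rightarrow> real \<Rightarrow> ('a \<Rightarrow> 'b::euclidean_space) set" where
  "Lp \<Omega> p = {f. f \<in> borel_measurable (lebesgue_on \<Omega>) \<and>
                integrable (lebesgue_on \<Omega>) (\<lambda>x. norm (f x) powr p)}"

text \<open>Elements of the Sobolev space are represented by functions on the whole Euclidean space,
  of which only the restriction to \<open>\<Omega>\<close>, up to null sets, matters. Thus \<open>W1p_norm\<close> is only a
  seminorm on functions, and the Banach space is the quotient by its kernel.\<close>

definition W1p :: "'a::euclidean_space set \<Rightarrow> real \<Rightarrow> ('a \<Rightarrow> real) set" where
  "W1p \<Omega> p = {u \<in> Lp \<Omega> p. \<exists>G\<in>Lp \<Omega> p. has_weak_gradient \<Omega> u G}"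

definition W1p_norm :: "'a::euclidean_space set \<Rightarrow> real \<Rightarrow> ('a \<Rightarrow> real) \<Rightarrow> real" where
  "W1p_norm \<Omega> p u =
     (integral\<^sup>L (lebesgue_on \<Omega>) (\<lambda>x. \<bar>u x\<bar> powr p) +
      integral\<^sup>L (lebesgue_on \<Omega>) (\<lambda>x. norm (weak_gradient \<Omega> u x) powr p)) powr (1 / p)"

text \<open>The topology induced on \<open>V\<close> by a seminorm \<open>N\<close>. Its open and closed sets are exactly the
  preimages of those of the quotient normed space, and continuous maps from a subset of \<open>V\<close> into
  a Hausdorff space are exactly those that factor through a continuous map on the quotient.
  Hence closedness and the genus below have the same meaning as in the quotient.\<close>

definition seminorm_topology :: "'a::minus set \<Rightarrow> ('a \<Rightarrow> real) \<Rightarrow> 'a topology" where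
  "seminorm_topology V N =
     topology (\<lambda>U. U \<subseteq> V \<and> (\<forall>u\<in>U. \<exists>r>0. \<forall>v\<in>V. N (v - u) < r \<longrightarrow> v \<in> U))"

lemma openin_seminorm_topology:
  "openin (seminorm_topology V N) U \<longleftrightarrow>
     U \<subseteq> V \<and> (\<forall>u\<in>U. \<exists>r>0. \<forall>v\<in>V. N (v - u) < r \<longrightarrow> v \<in> U)"
proof -
  have "istopology (\<lambda>U. U \<subseteq> V \<and> (\<forall>u\<in>U. \<exists>r>0. \<forall>v\<in>V. N (v - u) < r \<longrightarrow> v \<in> U))"
    (is "istopology ?P")
    unfolding istopology_def
  proof (rule conjI; intro allI impI)
    fix S T assume S: "?P S" and T: "?P T"
    have "\<exists>r>0. \<forall>v\<in>V. N (v - u) < r \<longrightarrow> v \<in> S \<inter> T" if u: "u \<in> S \<inter> T" for u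
    proof -
      obtain r s where "r > 0" "\<forall>v\<in>V. N (v - u) < r \<longrightarrow> v \<in> S"
        and "s > 0" "\<forall>v\<in>V. N (v - u) < s \<longrightarrow> v \<in> T"
        using S T u by blast
      then show ?thesis by (intro exI[of _ "min r s"]) auto
    qed
    then show "?P (S \<inter> T)" using S by blast
  next
    fix K assume "\<forall>S\<in>K. ?P S"
    then show "?P (\<Union>K)" by (fastforce simp: Union_iff)
  qed
  then show ?thesis by (simp add: seminorm_topology_def topology_inverse')
qed

subsection \<open>Krasnoselskii genus\<close>

definition genus :: "'a::uminus topology \<Rightarrow> 'a set \<Rightarrow> enat" where
  "genus X B = Inf {enat m | m. \<exists>h.
     continuous_map (subtopology X B) (subtopology (Euclidean_space m) (- {\<lambda>i. 0})) h \<and>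
     (\<forall>u\<in>B. h (- u) = (\<lambda>i. - h u i))}"

subsection \<open>Cylinders and eigenvalues\<close>

text \<open>The space of dimension \<open>n = CARD('m) + 1 \<ge> 2\<close> is \<open>real ^ 'm option\<close>: the coordinate \<open>None\<close>
  is the axial one, and the coordinates \<open>Some j\<close> form the cross-sectional part \<open>X2 x\<close>.\<close>

definition X2 :: "real ^ 'm option \<Rightarrow> real ^ 'm" where
  "X2 x = (\<chi> j. x $ Some j)"

definition cylinder :: "(real ^ 'm) set \<Rightarrow> real \<Rightarrow> (real ^ 'm option) set" where
  "cylinder \<omega> l = {x. x $ None \<in> {-l<..<l} \<and> X2 x \<in> \<omega>}"

text \<open>No regularity of \<open>\<omega>\<close> is assumed, so vanishing on the lateral boundary in the sense of traces
  means being a limit in \<open>W1p\<close> of smooth functions that vanish near it (and whose values on the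
  two ends of the cylinder are unrestricted). Where a trace operator exists, for instance if \<open>\<omega>\<close>
  is Lipschitz, this is the kernel of the trace on the lateral boundary.\<close>

definition Vspace :: "(real ^ 'm) set \<Rightarrow> real \<Rightarrow> real \<Rightarrow> (real ^ 'm option \<Rightarrow> real) set" where
  "Vspace \<omega> p l = {u \<in> W1p (cylinder \<omega> l) p.
     \<forall>e>0. \<exists>\<phi>\<in>test_functions {x. X2 x \<in> \<omega>}. W1p_norm (cylinder \<omega> l) p (u - \<phi>) < e}"

definition Vtop :: "(real ^ 'm) set \<Rightarrow> real \<Rightarrow> real \<Rightarrow> (real ^ 'm option \<Rightarrow> real) topology" where
  "Vtop \<omega> p l = seminorm_topology (Vspace \<omega> p l) (W1p_norm (cylinder \<omega> l) p)"

definition energy ::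
  "(real ^ 'm \<Rightarrow> real ^ 'm option ^ 'm option) \<Rightarrow> (real ^ 'm) set \<Rightarrow> real \<Rightarrow> real \<Rightarrow>
   (real ^ 'm option \<Rightarrow> real) \<Rightarrow> real" where
  "energy A \<omega> p l u = integral\<^sup>L (lebesgue_on (cylinder \<omega> l))
     (\<lambda>x. \<bar>(A (X2 x) *v weak_gradient (cylinder \<omega> l) u x) \<bullet>
            weak_gradient (cylinder \<omega> l) u x\<bar> powr (p / 2))"

definition mass ::
  "(real ^ 'm) set \<Rightarrow> real \<Rightarrow> real \<Rightarrow> (real ^ 'm option \<Rightarrow> real) \<Rightarrow> real" where
  "mass \<omega> p l u = integral\<^sup>L (lebesgue_on (cylinder \<omega> l)) (\<lambda>x. \<bar>u x\<bar> powr p)"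

text \<open>Infima and suprema are taken in \<^typ>\<open>ereal\<close>, so that an infimum over the empty family
  is \<open>\<infinity>\<close> and a supremum of unbounded energies is \<open>\<infinity>\<close>.\<close>

definition lambdaM1 ::
  "(real ^ 'm \<Rightarrow> real ^ 'm option ^ 'm option) \<Rightarrow> (real ^ 'm) set \<Rightarrow> real \<Rightarrow> real \<Rightarrow> ereal" where
  "lambdaM1 A \<omega> p l =
     (INF u \<in> {u \<in> Vspace \<omega> p l. \<not> (AE x in lebesgue_on (cylinder \<omega> l). u x = 0)}.
        ereal (energy A \<omega> p l u / mass \<omega> p l u))"

definition Mset :: "(real ^ 'm) set \<Rightarrow> real \<Rightarrow> real \<Rightarrow> (real ^ 'm option \<Rightarrow> real) set" where
  "Mset \<omega> p l = {u \<in> Vspace \<omega> p l. mass \<omega> p l u = 1}"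

definition Fset ::
  "(real ^ 'm) set \<Rightarrow> real \<Rightarrow> nat \<Rightarrow> real \<Rightarrow> (real ^ 'm option \<Rightarrow> real) set set" where
  "Fset \<omega> p k l = {B. closedin (Vtop \<omega> p l) B \<and> uminus ` B = B \<and> B \<subseteq> Mset \<omega> p l \<and>
                      enat k \<le> genus (Vtop \<omega> p l) B}"

definition beta ::
  "(real ^ 'm \<Rightarrow> real ^ 'm option ^ 'm option) \<Rightarrow> (real ^ 'm) set \<Rightarrow> real \<Rightarrow> nat \<Rightarrow> real \<Rightarrow> ereal"
  where
  "beta A \<omega> p k l = (INF B \<in> Fset \<omega> p k l. SUP u \<in> B. ereal (energy A \<omega> p l u))"

end

theory Submission
  imports Defs
begin

text \<open>
Write \<open>\<lambda>(l)\<close> and \<open>\<beta>(l)\<close> for the first Rayleigh infimum and the second Krasnoselskii value on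
  the cylinder of half-length \<open>l\<close>. A set of genus at least 2 is nonempty, so \<open>\<lambda> \<le> \<beta>\<close> always, and the
  whole matter is to bound \<open>limsup \<beta>\<close> by \<open>liminf \<lambda>\<close>. This holds because nearly optimal functions can
  be pushed to the ends of the cylinder, and there are two ends, which by the symmetry (S) are
  equally good.

  In detail, let \<open>\<lambda>(l) < \<Lambda>\<close> for some large \<open>l\<close>. By density there is a test function \<open>\<phi>\<close> on
  the infinite tube \<open>\<real> \<times> \<omega>\<close> whose Rayleigh quotient on the cylinder is below \<open>\<Lambda>\<close>
  (\<open>exists_test_function_quotient\<close>). Among about \<open>l\<close> disjoint slabs of unit thickness, one carries
  at most a fraction of order \<open>1/l\<close> of the mass and gradient mass of \<open>\<phi>\<close> (\<open>exists_thin_strip\<close>).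
  Splitting \<open>\<phi> = \<phi> \<eta> + \<phi> (1 - \<eta>)\<close> with a smooth step \<open>\<eta>\<close> of the axial variable inside that slab
  changes the sums of the energies and of the masses by a relative error of order \<open>1/l\<close>
  (\<open>axial_step_energy_mass\<close>), so one of the two pieces has quotient below \<open>\<Lambda> + \<epsilon>\<close>. Each piece vanishes
  near one end. Reflecting \<open>x \<mapsto> -x\<close> if necessary, the good piece \<open>\<psi>\<close> vanishes near the right end
  (\<open>exists_end_bump\<close>).

  In any cylinder of half-length \<open>l' \<ge> 2 l\<close>, the translate of \<open>\<psi>\<close> to the left end and its reflection
  at the right end are supported in different halves (\<open>exists_two_bumps\<close>). On a combination
  \<open>a v + b w\<close> of these two functions, normalized to mass 1, energy and mass are both the sums of the
  contributions weighted by \<open>|a|^p\<close> and \<open>|b|^p\<close>; hence the energy stays below \<open>\<Lambda> + \<epsilon>\<close> on the whole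
  topological circle \<open>|a|^p + |b|^p = 1\<close>. An odd real-valued map on such a circle has a zero, so
  the circle has genus at least 2 and \<open>\<beta>(l') \<le> \<Lambda> + \<epsilon>\<close> for all \<open>l' \<ge> 2 l\<close> (\<open>beta_2_le\<close>,
  \<open>eventually_beta_2_le\<close>). Thus \<open>limsup \<beta> \<le> liminf \<lambda> \<le> liminf \<beta>\<close>, and both limits exist and agree.
  They are finite for nonempty \<open>\<omega>\<close>, since one fixed bump function is admissible in all long
  cylinders; for empty \<open>\<omega>\<close> both quantities are \<open>\<infinity>\<close>.

  Energies are expressed through a chosen weak gradient. To compute with test functions one has to
  know that weak gradients are unique up to null sets and extend the classical ones; this is the
  content of the first half of the development.
\<close>

section \<open>Smooth functions and a smooth step\<close>

lemma Ck_SucI: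
  fixes f :: "'a::euclidean_space \<Rightarrow> real"
  assumes "\<And>x. (f has_derivative f' x) (at x)"
    and "\<And>b. b \<in> Basis \<Longrightarrow> Ck k (\<lambda>x. f' x b)"
  shows "Ck (Suc k) f"
proof -
  have "frechet_derivative f (at x) = f' x" for x
    using frechet_derivative_at[OF assms(1)[of x]] by simp
  moreover have "f differentiable_on UNIV"
    using assms(1) by (auto simp: differentiable_on_def differentiable_def)
  ultimately show ?thesis using assms(2) by simp
qed

lemma Ck_SucD:
  fixes f :: "'a::euclidean_space \<Rightarrow> real"
  assumes "Ck (Suc k) f"
  shows "(f has_derivative frechet_derivative f (at x)) (at x)"
    and "b \<in> Basis \<Longrightarrow> Ck k (\<lambda>x. frechet_derivative f (at x) b)"
  using assms by (auto simp: differentiable_on_def frechet_derivative_works)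

lemma Ck_imp_continuous: "Ck k f \<Longrightarrow> continuous_on UNIV f"
  by (cases k) (auto intro: differentiable_imp_continuous_on)

lemma Ck_Suc_imp_Ck: "Ck (Suc k) f \<Longrightarrow> Ck k f"
proof (induction k arbitrary: f)
  case 0
  then show ?case using Ck_imp_continuous by fastforce
next
  case (Suc k)
  show ?case
    using Suc.prems by (intro Ck_SucI[OF Ck_SucD(1)[OF Suc.prems]] Suc.IH Ck_SucD(2)[OF Suc.prems])
qed

lemma Ck_const: "Ck k (\<lambda>x. c)"
proof (induction k arbitrary: c)
  case (Suc k)
  show ?case by (rule Ck_SucI[where f'="\<lambda>_ _. 0"]) (auto intro: Suc)
qed auto

lemma Ck_add:
  assumes "Ck k f" "Ck k g" shows "Ck k (\<lambda>x. f x + g x)"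
  using assms
proof (induction k arbitrary: f g)
  case (Suc k)
  show ?case
    by (rule Ck_SucI[OF has_derivative_add[OF Ck_SucD(1)[OF Suc.prems(1)] Ck_SucD(1)[OF Suc.prems(2)]]])
       (intro Suc.IH Ck_SucD(2)[OF Suc.prems(1)] Ck_SucD(2)[OF Suc.prems(2)])
qed (auto intro: continuous_intros)

lemma Ck_mult:
  assumes "Ck k f" "Ck k g" shows "Ck k (\<lambda>x. f x * g x)"
  using assms
proof (induction k arbitrary: f g)
  case (Suc k)
  show ?case
    by (rule Ck_SucI[OF has_derivative_mult[OF Ck_SucD(1)[OF Suc.prems(1)] Ck_SucD(1)[OF Suc.prems(2)]]])
       (intro Ck_add Suc.IH Ck_SucD(2)[OF Suc.prems(1)] Ck_SucD(2)[OF Suc.prems(2)]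
          Suc.prems[THEN Ck_Suc_imp_Ck])
qed (auto intro: continuous_intros)

lemma Ck_diff:
  assumes "Ck k f" "Ck k g" shows "Ck k (\<lambda>x. f x - g x)"
  using Ck_add[OF assms(1) Ck_mult[OF Ck_const[of k "-1"] assms(2)]] by simp

lemma Ck_prod:
  assumes "finite I" "\<And>i. i \<in> I \<Longrightarrow> Ck k (f i)" shows "Ck k (\<lambda>x. \<Prod>i\<in>I. f i x)"
  using assms by (induction I) (auto intro: Ck_const Ck_mult)

lemma Ck_inverse:
  assumes "Ck k f" "\<And>x. f x \<noteq> 0" shows "Ck k (\<lambda>x. inverse (f x))"
  using assms
proof (induction k arbitrary: f)
  case (Suc k)
  have *: "((\<lambda>x. inverse (f x)) has_derivative
      (\<lambda>h. - (inverse (f x) * frechet_derivative f (at x) h * inverse (f x)))) (at x)" for x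
    by (rule Deriv.has_derivative_inverse[OF Suc.prems(2) Ck_SucD(1)[OF Suc.prems(1)]])
  have "Ck k (\<lambda>x. 0 - inverse (f x) * frechet_derivative f (at x) b * inverse (f x))" if "b \<in> Basis" for b
    by (intro Ck_diff Ck_mult Ck_const Suc.IH Ck_SucD(2)[OF Suc.prems(1)] that
          Suc.prems(1)[THEN Ck_Suc_imp_Ck] Suc.prems(2))
  then show ?case
    by (intro Ck_SucI[OF *]) simp
qed (auto intro: continuous_intros)

lemma Ck_compose_affine:
  fixes f :: "'a::euclidean_space \<Rightarrow> real"
  assumes "Ck k f" shows "Ck k (\<lambda>x. f (s *\<^sub>R x + a))"
  using assms
proof (induction k arbitrary: f)
  case (Suc k)
  have d: "((\<lambda>x. f (s *\<^sub>R x + a)) has_derivative (\<lambda>h. frechet_derivative f (at (s *\<^sub>R x + a)) (s *\<^sub>R h))) (at x)" for x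
    by (rule has_derivative_compose[OF _ Ck_SucD(1)[OF Suc.prems]])
       (auto intro!: derivative_eq_intros)
  have *: "frechet_derivative f (at y) (s *\<^sub>R h) = s * frechet_derivative f (at y) h" for y h
    using has_derivative_linear[OF Ck_SucD(1)[OF Suc.prems]] by (simp add: linear_cmul)
  show ?case
    by (rule Ck_SucI[OF d])
       (auto simp: * intro!: Ck_mult Ck_const Suc.IH[of "\<lambda>y. frechet_derivative f (at y) _"] Ck_SucD(2)[OF Suc.prems])
qed (auto intro!: continuous_intros elim!: continuous_on_compose2)

lemma Ck_compose_inner:
  fixes f :: "real \<Rightarrow> real" and d :: "'a::euclidean_space"
  assumes "Ck k f" shows "Ck k (\<lambda>x. f (x \<bullet> d))"
  using assms
proof (induction k arbitrary: f)
  case (Suc k)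
  have d: "((\<lambda>x. f (x \<bullet> d)) has_derivative (\<lambda>h. frechet_derivative f (at (x \<bullet> d)) (h \<bullet> d))) (at x)" for x
    by (rule has_derivative_compose[OF _ Ck_SucD(1)[OF Suc.prems]])
       (auto intro!: derivative_eq_intros)
  have *: "frechet_derivative f (at y) t = t * frechet_derivative f (at y) 1" for y t
    using linear_cmul[OF has_derivative_linear[OF Ck_SucD(1)[OF Suc.prems]], of y t 1] by simp
  have "Ck k (\<lambda>x. frechet_derivative f (at (x \<bullet> d)) (b \<bullet> d))" for b
    unfolding *[of _ "b \<bullet> d"]
    by (intro Ck_mult Ck_const Suc.IH[of "\<lambda>y. frechet_derivative f (at y) 1"] Ck_SucD(2)[OF Suc.prems]) simp
  then show ?case
    by (intro Ck_SucI[OF d])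
qed (auto intro!: continuous_intros elim!: continuous_on_compose2)

text \<open>On \<open>x > 0\<close> these are the functions \<open>x^{-n} exp (-1/x)\<close>. The derivative of a member of the family is a
  linear combination of two others, so smoothness follows by induction on the order for all \<open>n\<close> at once.\<close>

definition flat_exp :: "nat \<Rightarrow> real \<Rightarrow> real" where
  "flat_exp n x = (if x > 0 then inverse x ^ n * exp (- inverse x) else 0)"

lemma flat_exp_tendsto_0: "((\<lambda>x. flat_exp n x) \<longlongrightarrow> 0) (at 0)"
proof -
  have "((\<lambda>x. (inverse x) ^ n / exp (inverse x)) \<longlongrightarrow> (0::real)) (at_right 0)"
    by (rule filterlim_compose[OF tendsto_power_div_exp_0 filterlim_inverse_at_top_right])
  then have "(flat_exp n \<longlongrightarrow> 0) (at_right 0)"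
    by (rule Lim_transform_eventually)
       (auto simp: flat_exp_def exp_minus field_simps eventually_at_right_less intro!: eventually_at_rightI[of 0 1])
  moreover have "(flat_exp n \<longlongrightarrow> 0) (at_left 0)"
    by (rule tendsto_eventually) (auto simp: flat_exp_def intro!: eventually_at_leftI[of "-1" 0])
  ultimately show ?thesis by (simp add: filterlim_split_at)
qed

lemma flat_exp_derivative:
  "(flat_exp n has_real_derivative flat_exp (n + 2) x - real n * flat_exp (n + 1) x) (at x)"
proof (cases x "0::real" rule: linorder_cases)
  case less
  have "(flat_exp n has_real_derivative 0) (at x)"
    by (rule has_field_derivative_transform_within_open[of "\<lambda>_. 0" _ _ "{..<0}"])
       (use less in \<open>auto simp: flat_exp_def\<close>)
  then show ?thesis using less by (simp add: flat_exp_def)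
next
  case equal
  \<comment> \<open>The difference quotient at 0 is again a member of the family, with index \<open>n + 1\<close>.\<close>
  have "((\<lambda>h. (flat_exp n (0 + h) - flat_exp n 0) / h) \<longlongrightarrow> 0) (at 0)"
    by (rule Lim_transform_eventually[OF flat_exp_tendsto_0[of "Suc n"]])
       (auto simp: flat_exp_def eventually_at_filter field_simps)
  then show ?thesis using equal by (simp add: DERIV_def flat_exp_def)
next
  case greater
  have pw: "real n * inverse x ^ (n - Suc 0) = real n * (x * inverse x ^ n)"
    using greater by (cases n) auto
  have "((\<lambda>x. inverse x ^ n * exp (- inverse x)) has_real_derivative
      (real n * inverse x ^ (n - Suc 0)) * (- (inverse x * inverse x)) * exp (- inverse x)
      + inverse x ^ n * (exp (- inverse x) * (inverse x * inverse x))) (at x)"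
    using greater by (auto intro!: derivative_eq_intros simp: algebra_simps power2_eq_square)
  then have "((\<lambda>x. inverse x ^ n * exp (- inverse x)) has_real_derivative
      flat_exp (n + 2) x - real n * flat_exp (n + 1) x) (at x)"
    unfolding pw by (rule DERIV_cong)
      (use greater in \<open>simp add: flat_exp_def power2_eq_square field_simps\<close>)
  then show ?thesis
    by (rule has_field_derivative_transform_within_open[of _ _ _ "{0<..}"])
       (use greater in \<open>auto simp: flat_exp_def\<close>)
qed

lemma Ck_flat_exp: "Ck k (flat_exp n)"
proof (induction k arbitrary: n)
  case 0
  show ?case
    using DERIV_continuous_on[OF DERIV_subset[OF flat_exp_derivative]] by auto
next
  case (Suc k)
  show ?case
    by (rule Ck_SucI[OF flat_exp_derivative[unfolded has_field_derivative_def]])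
       (auto intro!: Ck_diff Ck_mult Ck_const Suc simp del: add_2_eq_Suc')
qed

text \<open>The classical quotient: the denominator is positive because at least one of \<open>x\<close> and \<open>1 - x\<close> is.\<close>

definition smooth_step :: "real \<Rightarrow> real" where
  "smooth_step x = flat_exp 0 x * inverse (flat_exp 0 x + flat_exp 0 (1 - x))"

lemma Ck_smooth_step: "Ck k smooth_step"
proof -
  have "Ck k (\<lambda>x. flat_exp 0 ((-1) *\<^sub>R x + 1))"
    by (rule Ck_compose_affine[OF Ck_flat_exp])
  then have "Ck k (\<lambda>x. flat_exp 0 x * inverse (flat_exp 0 x + flat_exp 0 (1 - x)))"
    by (intro Ck_mult Ck_inverse Ck_add Ck_flat_exp) (auto simp: flat_exp_def add_pos_pos less_imp_neq[symmetric])
  then show ?thesis by (simp add: smooth_step_def[abs_def])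
qed

lemma smooth_step_eq_0: "x \<le> 0 \<Longrightarrow> smooth_step x = 0"
  and smooth_step_eq_1: "x \<ge> 1 \<Longrightarrow> smooth_step x = 1"
  and smooth_step_nonneg: "smooth_step x \<ge> 0"
  and smooth_step_le_1: "smooth_step x \<le> 1"
  and smooth_step_pos: "x > 0 \<Longrightarrow> smooth_step x > 0"
proof -
  show "x \<le> 0 \<Longrightarrow> smooth_step x = 0" by (simp add: smooth_step_def flat_exp_def)
  show "x \<ge> 1 \<Longrightarrow> smooth_step x = 1" by (simp add: smooth_step_def flat_exp_def)
  show "smooth_step x \<ge> 0" by (simp add: smooth_step_def flat_exp_def)
  have "flat_exp 0 x \<le> flat_exp 0 x + flat_exp 0 (1 - x)" "flat_exp 0 x + flat_exp 0 (1 - x) > 0"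
    by (auto simp: flat_exp_def add_pos_pos)
  then show "smooth_step x \<le> 1" by (simp add: smooth_step_def field_simps)
  show "x > 0 \<Longrightarrow> smooth_step x > 0" by (auto simp: smooth_step_def flat_exp_def add_pos_pos)
qed

section \<open>Box bumps and the fundamental lemma of the calculus of variations\<close>

lemma test_functionsI:
  assumes "\<And>k. Ck k \<phi>" "compact K" "K \<subseteq> \<Omega>" "\<And>x. x \<notin> K \<Longrightarrow> \<phi> x = 0"
  shows "\<phi> \<in> test_functions \<Omega>"
proof -
  have "closure {x. \<phi> x \<noteq> 0} \<subseteq> K"
    by (rule closure_minimal) (use assms compact_imp_closed in auto)
  then show ?thesis
    using assms compact_Int_closed[OF assms(2) closed_closure, of "{x. \<phi> x \<noteq> 0}"]
    by (auto simp: test_functions_def Int_absorb1)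
qed

lemma test_functionsE:
  assumes "\<phi> \<in> test_functions \<Omega>"
  obtains K where "\<And>k. Ck k \<phi>" "compact K" "K \<subseteq> \<Omega>" "\<And>x. x \<notin> K \<Longrightarrow> \<phi> x = 0"
proof (rule that[of "closure {x. \<phi> x \<noteq> 0}"])
  show "\<phi> x = 0" if "x \<notin> closure {x. \<phi> x \<noteq> 0}" for x
    using that closure_subset[of "{x. \<phi> x \<noteq> 0}"] by auto
qed (use assms in \<open>auto simp: test_functions_def\<close>)

text \<open>A bump supported in the closed box with corners \<open>a\<close> and \<open>b\<close>; the steepness \<open>r\<close> is sent to infinity to
  approximate the indicator of the open box.\<close>

definition box_bump :: "real \<Rightarrow> 'a::euclidean_space \<Rightarrow> 'a \<Rightarrow> 'a \<Rightarrow> real" where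
  "box_bump r a b x =
     (\<Prod>i\<in>Basis. smooth_step (r * (x \<bullet> i - a \<bullet> i)) * smooth_step (r * (b \<bullet> i - x \<bullet> i)))"

lemma Ck_box_bump: "Ck k (box_bump r a b)"
proof -
  have "Ck k (\<lambda>x. smooth_step (r * (x \<bullet> i - a \<bullet> i)) * smooth_step (r * (b \<bullet> i - x \<bullet> i)))" for i
  proof (rule Ck_mult)
    show "Ck k (\<lambda>x. smooth_step (r * (x \<bullet> i - a \<bullet> i)))"
      using Ck_compose_inner[OF Ck_compose_affine[OF Ck_smooth_step, of k r "- r * (a \<bullet> i)"], of i]
      by (simp add: algebra_simps)
    show "Ck k (\<lambda>x. smooth_step (r * (b \<bullet> i - x \<bullet> i)))"
      using Ck_compose_inner[OF Ck_compose_affine[OF Ck_smooth_step, of k "-r" "r * (b \<bullet> i)"], of i]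
      by (simp add: algebra_simps)
  qed
  then have "Ck k (\<lambda>x. \<Prod>i\<in>Basis. smooth_step (r * (x \<bullet> i - a \<bullet> i)) * smooth_step (r * (b \<bullet> i - x \<bullet> i)))"
    by (intro Ck_prod) auto
  then show ?thesis by (simp add: box_bump_def[abs_def])
qed

lemma box_bump_eq_0:
  assumes "r \<ge> 0" "x \<notin> box a b" shows "box_bump r a b x = 0"
proof -
  obtain i where i: "i \<in> Basis" "x \<bullet> i \<le> a \<bullet> i \<or> b \<bullet> i \<le> x \<bullet> i"
    using assms(2) by (force simp: box_def not_less)
  have "smooth_step (r * (x \<bullet> i - a \<bullet> i)) * smooth_step (r * (b \<bullet> i - x \<bullet> i)) = 0"
    using i(2) assms(1) by (auto intro!: smooth_step_eq_0 mult_nonneg_nonpos)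
  then show ?thesis
    unfolding box_bump_def using i(1) by (intro prod_zero) auto
qed

lemma box_bump_nonneg: "box_bump r a b x \<ge> 0"
  unfolding box_bump_def by (intro prod_nonneg mult_nonneg_nonneg smooth_step_nonneg)

lemma box_bump_le_1: "box_bump r a b x \<le> 1"
  unfolding box_bump_def
  by (intro prod_le_1 conjI mult_nonneg_nonneg mult_le_one smooth_step_nonneg smooth_step_le_1)

lemma box_bump_pos: "r > 0 \<Longrightarrow> x \<in> box a b \<Longrightarrow> box_bump r a b x > 0"
  unfolding box_bump_def by (intro prod_pos) (auto simp: box_def intro!: mult_pos_pos smooth_step_pos)

lemma box_bump_test_function:
  assumes "r \<ge> 0" "cbox a b \<subseteq> \<Omega>"
  shows "box_bump r a b \<in> test_functions \<Omega>"
  by (rule test_functionsI[of _ "cbox a b"])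
     (use assms in \<open>auto intro: Ck_box_bump box_bump_eq_0 dest: box_subset_cbox[THEN subsetD]\<close>)

lemma box_bump_tendsto_indicator:
  "(\<lambda>n. box_bump (real n) a b x) \<longlonglongrightarrow> indicator (box a b) x"
proof (cases "x \<in> box a b")
  case True
  have "\<forall>\<^sub>F n in sequentially. r * real n \<ge> 1" if "r > 0" for r
    using that by real_asymp
  then have "\<forall>\<^sub>F n in sequentially. \<forall>i\<in>Basis. real n * (x \<bullet> i - a \<bullet> i) \<ge> 1 \<and> real n * (b \<bullet> i - x \<bullet> i) \<ge> 1"
    using True by (intro eventually_ball_finite ballI eventually_conj)
       (auto simp: box_def mult.commute[of "real _"])
  then have "\<forall>\<^sub>F n in sequentially. box_bump (real n) a b x = 1"
    by eventually_elim (auto simp: box_bump_def smooth_step_eq_1 intro!: prod.neutral)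
  then show ?thesis using True by (simp add: tendsto_eventually)
next
  case False
  then show ?thesis by (simp add: box_bump_eq_0)
qed

text \<open>Open boxes form an intersection-stable generator of the Borel sets, so by Dynkin's argument the
  integral vanishes over every Borel set. Passing to a Borel representative first makes this argument
  available for a Lebesgue measurable integrand.\<close>

lemma AE_zero_if_box_integrals_zero:
  fixes f :: "'a::euclidean_space \<Rightarrow> real"
  assumes int: "set_integrable lebesgue (box c d) f"
    and zero: "\<And>a b. box a b \<subseteq> box c d \<Longrightarrow> (LINT x:box a b|lebesgue. f x) = 0"
  shows "AE x in lebesgue. x \<in> box c d \<longrightarrow> f x = 0"
proof -
  define g where "g x = indicator (box c d) x *\<^sub>R f x" for x
  have g: "integrable lebesgue g"
    using int by (simp add: g_def[abs_def] set_integrable_def)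
  obtain h where h[measurable]: "h \<in> borel_measurable lborel" and gh: "AE x in lborel. g x = h x"
    using completion_ex_borel_measurable_real[of g lborel] g by auto
  have gh': "AE x in lebesgue. g x = h x" by (rule AE_completion[OF gh])
  have "integrable lebesgue h"
    using g gh' by (subst integrable_cong_AE[of h lebesgue g]) (auto intro: measurable_completion)
  then have ih: "integrable lborel h" by (simp add: integrable_completion)
  have eq: "(LINT x:S|lborel. h x) = (LINT x:S|lebesgue. g x)" if [measurable]: "S \<in> sets borel" for S
  proof -
    have "(LINT x:S|lborel. h x) = (LINT x:S|lebesgue. h x)"
      unfolding set_lebesgue_integral_def by (subst integral_completion) auto
    also have "\<dots> = (LINT x:S|lebesgue. g x)"
      unfolding set_lebesgue_integral_def
      using gh' g that
      by (intro integral_cong_AE borel_measurable_scaleR measurable_completion[of _ lborel]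
           borel_measurable_integrable[of lebesgue g] borel_measurable_indicator) auto
    finally show ?thesis .
  qed
  have box0: "(LINT x:box a b|lborel. h x) = 0" for a b
  proof -
    obtain a' b' where ab: "box a b \<inter> box c d = box a' b'"
      using box_Int_box by blast
    have "(LINT x:box a b|lborel. h x) = (LINT x:box a b|lebesgue. g x)"
      by (rule eq) simp
    also have "\<dots> = (LINT x:box a' b'|lebesgue. f x)"
      unfolding set_lebesgue_integral_def g_def ab[symmetric]
      by (intro Bochner_Integration.integral_cong) (auto simp: indicator_def)
    also have "\<dots> = 0" using ab by (intro zero) auto
    finally show ?thesis .
  qed
  have all0: "(LINT x:S|lborel. h x) = 0" if "S \<in> sets borel" for S
  proof -
    have "Int_stable (range (\<lambda>(a, b). box a b :: 'a set))"
      by (force simp: Int_stable_def box_Int_box)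
    moreover have "range (\<lambda>(a, b). box a b :: 'a set) \<subseteq> Pow UNIV" by simp
    moreover have "S \<in> sigma_sets UNIV (range (\<lambda>(a, b). box a b :: 'a set))"
      using that by (simp add: borel_eq_box)
    ultimately show ?thesis
    proof (induction rule: sigma_sets_induct_disjoint)
      case (compl S)
      have S: "S \<in> sets borel" using compl(1) by (simp add: borel_eq_box)
      have "(LINT x:UNIV|lebesgue. g x) = (LINT x:box c d|lebesgue. g x)"
        unfolding set_lebesgue_integral_def
        by (intro Bochner_Integration.integral_cong) (auto simp: g_def indicator_def)
      then have "(\<integral>x. h x \<partial>lborel) = 0" using box0[of c d] eq[of UNIV] eq[of "box c d"] by (simp add: set_lebesgue_integral_def)
      moreover have "(LINT x:UNIV - S|lborel. h x) = (\<integral>x. h x - indicator S x *\<^sub>R h x \<partial>lborel)"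
        unfolding set_lebesgue_integral_def
        by (intro Bochner_Integration.integral_cong) (auto simp: indicator_def)
      moreover have "\<dots> = (\<integral>x. h x \<partial>lborel) - (LINT x:S|lborel. h x)"
        unfolding set_lebesgue_integral_def
        using ih S by (intro Bochner_Integration.integral_diff integrable_mult_indicator) auto
      ultimately show ?case using compl by simp
    next
      case (union S)
      have S: "S i \<in> sets lborel" for i using union(2) by (force simp: borel_eq_box)
      have "(LINT x:(\<Union>i. S i)|lborel. h x) = (\<Sum>i. (LINT x:S i|lborel. h x))"
      proof (rule lebesgue_integral_countable_add[OF S])
        show "set_integrable lborel (\<Union>i. S i) h"
          unfolding set_integrable_def using ih S by (intro integrable_mult_indicator) auto
      qed (use union(1) in \<open>auto simp: disjoint_family_on_def\<close>)
      then show ?case using union by simp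
    next
      case (basic S)
      then show ?case using box0 by auto
    qed (simp add: set_lebesgue_integral_def)
  qed
  have "AE x in lborel. h x = 0"
    by (rule sigma_finite_measure.density_zero[OF sigma_finite_lborel ih]) (simp add: all0)
  with gh have "AE x in lborel. x \<in> box c d \<longrightarrow> f x = 0"
    by eventually_elim (auto simp: g_def)
  then show ?thesis by (rule AE_completion)
qed

lemma integral_lebesgue_on_vanishing_outside:
  fixes f :: "'a::euclidean_space \<Rightarrow> real"
  assumes "\<Omega> \<in> sets lebesgue" "\<And>x. x \<notin> \<Omega> \<Longrightarrow> f x = 0"
  shows "integral\<^sup>L (lebesgue_on \<Omega>) f = integral\<^sup>L lebesgue f"
    and "integrable (lebesgue_on \<Omega>) f \<longleftrightarrow> integrable lebesgue f"
proof -
  have *: "(\<lambda>x. indicator \<Omega> x *\<^sub>R f x) = f" using assms(2) by (auto simp: indicator_def fun_eq_iff)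
  show "integral\<^sup>L (lebesgue_on \<Omega>) f = integral\<^sup>L lebesgue f"
    using assms(1) * by (subst integral_restrict_space) auto
  show "integrable (lebesgue_on \<Omega>) f \<longleftrightarrow> integrable lebesgue f"
    using assms(1) * by (subst integrable_restrict_space) auto
qed

text \<open>Testing against box bumps and letting them increase in steepness gives, by dominated convergence, that
  the integral over every box inside the open set vanishes. Countably many boxes exhaust the set.\<close>

lemma fundamental_lemma_of_calculus_of_variations:
  fixes f :: "'a::euclidean_space \<Rightarrow> real"
  assumes op: "open \<Omega>" and f: "locally_integrable \<Omega> f"
    and zero: "\<And>\<phi>. \<phi> \<in> test_functions \<Omega> \<Longrightarrow> integral\<^sup>L (lebesgue_on \<Omega>) (\<lambda>x. f x * \<phi> x) = 0"
  shows "AE x in lebesgue_on \<Omega>. f x = 0"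
proof -
  have box0: "(LINT x:box a b|lebesgue. f x) = 0" if ab: "cbox a b \<subseteq> \<Omega>" for a b
  proof -
    have int: "integrable lebesgue (\<lambda>x. indicator (cbox a b) x *\<^sub>R f x)"
      using f ab by (auto simp: locally_integrable_def set_integrable_def)
    have "(\<lambda>n. integral\<^sup>L lebesgue (\<lambda>x. (indicator (cbox a b) x *\<^sub>R f x) * box_bump (real n) a b x))
        \<longlonglongrightarrow> integral\<^sup>L lebesgue (\<lambda>x. (indicator (cbox a b) x *\<^sub>R f x) * indicator (box a b) x)"
    proof (rule integral_dominated_convergence[where w="\<lambda>x. norm (indicator (cbox a b) x *\<^sub>R f x)"])
      show "(\<lambda>x. indicator (cbox a b) x *\<^sub>R f x * indicator (box a b) x) \<in> borel_measurable lebesgue"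
        using int by (intro borel_measurable_times borel_measurable_indicator) auto
      show "(\<lambda>x. indicator (cbox a b) x *\<^sub>R f x * box_bump (real n) a b x) \<in> borel_measurable lebesgue" for n
      proof (rule borel_measurable_times)
        show "(\<lambda>x. indicator (cbox a b) x *\<^sub>R f x) \<in> borel_measurable lebesgue" using int by auto
        show "box_bump (real n) a b \<in> borel_measurable lebesgue"
          using borel_measurable_continuous_onI[OF Ck_imp_continuous[OF Ck_box_bump[of 0]]]
          by (intro measurable_completion) auto
      qed
      show "integrable lebesgue (\<lambda>x. norm (indicator (cbox a b) x *\<^sub>R f x))"
        using int by (rule integrable_norm)
      show "AE x in lebesgue. (\<lambda>n. indicator (cbox a b) x *\<^sub>R f x * box_bump (real n) a b x)
           \<longlonglongrightarrow> indicator (cbox a b) x *\<^sub>R f x * indicator (box a b) x"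
        by (intro AE_I2 tendsto_mult_left box_bump_tendsto_indicator)
      show "AE x in lebesgue. norm (indicator (cbox a b) x *\<^sub>R f x * box_bump (real n) a b x)
           \<le> norm (indicator (cbox a b) x *\<^sub>R f x)" for n
        using box_bump_nonneg[of n a b] box_bump_le_1[of n a b]
        by (intro AE_I2) (auto simp: abs_mult intro: mult_left_le)
    qed
    moreover have "integral\<^sup>L lebesgue (\<lambda>x. (indicator (cbox a b) x *\<^sub>R f x) * box_bump (real n) a b x) = 0" for n
    proof -
      have "integral\<^sup>L lebesgue (\<lambda>x. (indicator (cbox a b) x *\<^sub>R f x) * box_bump (real n) a b x)
          = integral\<^sup>L lebesgue (\<lambda>x. f x * box_bump (real n) a b x)"
        using box_subset_cbox[of a b] box_bump_eq_0[of "real n" _ a b]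
        by (intro Bochner_Integration.integral_cong) (auto simp: indicator_def)
      also have "\<dots> = integral\<^sup>L (lebesgue_on \<Omega>) (\<lambda>x. f x * box_bump (real n) a b x)"
        using op ab box_subset_cbox[of a b] box_bump_eq_0[of "real n" _ a b]
        by (intro integral_lebesgue_on_vanishing_outside(1)[symmetric]) auto
      also have "\<dots> = 0" by (intro zero box_bump_test_function ab) simp
      finally show ?thesis .
    qed
    ultimately have "integral\<^sup>L lebesgue (\<lambda>x. (indicator (cbox a b) x *\<^sub>R f x) * indicator (box a b) x) = 0"
      by (simp add: LIMSEQ_const_iff)
    moreover have "(\<lambda>x. (indicator (cbox a b) x *\<^sub>R f x) * indicator (box a b) x) = (\<lambda>x. indicator (box a b) x *\<^sub>R f x)"
      using box_subset_cbox[of a b] by (auto simp: indicator_def fun_eq_iff)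
    ultimately show ?thesis by (simp add: set_lebesgue_integral_def)
  qed
  have AEbox: "AE x in lebesgue. x \<in> box c d \<longrightarrow> f x = 0" if cd: "cbox c d \<subseteq> \<Omega>" for c d
  proof (rule AE_zero_if_box_integrals_zero)
    show "set_integrable lebesgue (box c d) f"
      using f cd by (auto intro: set_integrable_subset[OF _ _ box_subset_cbox] simp: locally_integrable_def)
    fix a b assume "box a b \<subseteq> box c d"
    then show "(LINT x:box a b|lebesgue. f x) = 0"
    proof (cases "box a b = {}")
      case False
      have "cbox a b \<subseteq> cbox c d"
        using closure_mono[OF \<open>box a b \<subseteq> box c d\<close>] False \<open>box a b \<subseteq> box c d\<close> closure_box[of a b] closure_box[of c d]
        by (metis subset_empty)
      then show ?thesis using cd by (intro box0) auto
    qed (simp add: set_lebesgue_integral_def)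
  qed
  obtain D where D: "countable D" "D \<subseteq> Pow \<Omega>" "\<And>X. X \<in> D \<Longrightarrow> \<exists>a b. X = cbox a b" "\<Union>D = \<Omega>"
    using open_countable_Union_open_cbox[OF op] by metis
  have "AE x in lebesgue. x \<in> X \<longrightarrow> f x = 0" if "X \<in> D" for X
  proof -
    obtain a b where X: "X = cbox a b" using D(3) \<open>X \<in> D\<close> by blast
    have "negligible (cbox a b - box a b)" by (simp add: negligible_frontier_interval)
    then have "AE x in lebesgue. x \<notin> cbox a b - box a b"
      by (intro AE_not_in) (simp add: negligible_iff_null_sets)
    moreover have "cbox a b \<subseteq> \<Omega>" using D(2) X \<open>X \<in> D\<close> by auto
    note AEbox[OF this]
    ultimately show ?thesis
      by eventually_elim (use X in auto)
  qed
  then have "AE x in lebesgue. \<forall>X\<in>D. x \<in> X \<longrightarrow> f x = 0"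
    using D(1) by (subst AE_ball_countable) auto
  then have "AE x in lebesgue. x \<in> \<Omega> \<longrightarrow> f x = 0"
    by eventually_elim (use D(4) in auto)
  then show ?thesis
    using op by (subst AE_restrict_space_iff) auto
qed

section \<open>Weak gradients: smooth functions and uniqueness\<close>

lemma lebesgue_eq_distr_isometry:
  fixes t :: "'a::euclidean_space"
  assumes "s = 1 \<or> s = -1"
  shows "(\<lambda>x. t + s *\<^sub>R x) \<in> lebesgue \<rightarrow>\<^sub>M lebesgue"
    and "lebesgue = distr lebesgue lebesgue (\<lambda>x. t + s *\<^sub>R x)"
proof -
  have T: "(\<lambda>x. t + (\<Sum>j\<in>Basis. (s * (x \<bullet> j)) *\<^sub>R j)) = (\<lambda>x::'a. t + s *\<^sub>R x)"
    unfolding scaleR_scaleR[symmetric] scaleR_sum_right[symmetric] euclidean_representation ..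
  show "(\<lambda>x. t + s *\<^sub>R x) \<in> lebesgue \<rightarrow>\<^sub>M lebesgue"
    using lebesgue_affine_measurable[of "\<lambda>_. s" t] assms unfolding T by auto
  have "lebesgue = density (distr lebesgue lebesgue (\<lambda>x. t + s *\<^sub>R x)) (\<lambda>_. 1)"
    using lebesgue_affine_euclidean[of "\<lambda>_. s" t] assms unfolding T by auto
  then show "lebesgue = distr lebesgue lebesgue (\<lambda>x. t + s *\<^sub>R x)"
    unfolding density_1 .
qed

lemma integral_lebesgue_isometry:
  fixes f :: "'a::euclidean_space \<Rightarrow> real"
  assumes "s = 1 \<or> s = -1" "f \<in> borel_measurable lebesgue"
  shows "(\<integral>x. f (t + s *\<^sub>R x) \<partial>lebesgue) = (\<integral>x. f x \<partial>lebesgue)"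
proof -
  have "(\<integral>x. f x \<partial>lebesgue) = integral\<^sup>L (distr lebesgue lebesgue (\<lambda>x. t + s *\<^sub>R x)) f"
    using lebesgue_eq_distr_isometry(2)[OF assms(1), of t] by (rule arg_cong)
  also have "\<dots> = (\<integral>x. f (t + s *\<^sub>R x) \<partial>lebesgue)"
    by (rule integral_distr[OF lebesgue_eq_distr_isometry(1)[OF assms(1)] assms(2)])
  finally show ?thesis ..
qed

lemma integrable_lebesgue_isometry:
  fixes f :: "'a::euclidean_space \<Rightarrow> real"
  assumes "s = 1 \<or> s = -1" "integrable lebesgue f"
  shows "integrable lebesgue (\<lambda>x. f (t + s *\<^sub>R x))"
proof (rule integrable_distr[OF lebesgue_eq_distr_isometry(1)[OF assms(1)]])
  show "integrable (distr lebesgue lebesgue (\<lambda>x. t + s *\<^sub>R x)) f"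
    using assms(2) by (rule back_subst[where P="\<lambda>M. integrable M f"])
      (rule lebesgue_eq_distr_isometry(2)[OF assms(1)])
qed

lemma borel_measurable_lebesgue_continuous:
  fixes f :: "'a::euclidean_space \<Rightarrow> 'b::topological_space"
  shows "continuous_on UNIV f \<Longrightarrow> f \<in> borel_measurable lebesgue"
  by (simp add: measurable_completion borel_measurable_continuous_onI)

lemma integrable_continuous_compact_support:
  fixes f :: "'a::euclidean_space \<Rightarrow> 'b::euclidean_space"
  assumes "continuous_on UNIV f" "bounded K" "\<And>x. x \<notin> K \<Longrightarrow> f x = 0"
  shows "integrable lebesgue f"
proof -
  obtain a b where ab: "K \<subseteq> cbox a b" using bounded_subset_cbox_symmetric[OF assms(2)] by metis
  have "f absolutely_integrable_on cbox a b"
    by (rule absolutely_integrable_continuous) (use assms(1) continuous_on_subset in blast)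
  then have "integrable lebesgue (\<lambda>x. indicator (cbox a b) x *\<^sub>R f x)"
    by (simp add: set_integrable_def)
  moreover have "(\<lambda>x. indicator (cbox a b) x *\<^sub>R f x) = f"
    using assms(3) ab by (auto simp: indicator_def fun_eq_iff)
  ultimately show ?thesis by simp
qed

lemma bounded_continuous_compact_support:
  fixes f :: "'a::euclidean_space \<Rightarrow> 'b::real_normed_vector"
  assumes "continuous_on UNIV f" "compact K" "\<And>x. x \<notin> K \<Longrightarrow> f x = 0"
  shows "\<exists>M>0. \<forall>x. norm (f x) \<le> M"
proof -
  have "bounded (f ` K)"
    using assms compact_continuous_image continuous_on_subset compact_imp_bounded by blast
  then obtain M where M: "M > 0" "\<forall>y\<in>f ` K. norm y \<le> M" unfolding bounded_pos by blast
  have "norm (f x) \<le> M" for x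
    using M assms(3)[of x] by (cases "x \<in> K") auto
  with M(1) show ?thesis by blast
qed

lemma frechet_derivative_eq_0_off_support:
  fixes f :: "'a::euclidean_space \<Rightarrow> real"
  assumes "closed K" "\<And>x. x \<notin> K \<Longrightarrow> f x = 0" "x \<notin> K"
  shows "frechet_derivative f (at x) = (\<lambda>_. 0)"
proof -
  have "(f has_derivative (\<lambda>_. 0)) (at x)"
    by (rule has_derivative_transform_within_open[of "\<lambda>_. 0" _ _ _ "- K"])
       (use assms in auto)
  then show ?thesis by (metis frechet_derivative_at)
qed

text \<open>Difference quotients integrate to 0 because Lebesgue measure is translation invariant; by the mean
  value theorem they are bounded uniformly on a common bounded set, and the limit may be taken under
  the integral. All integration by parts rests on this fact.\<close>

lemma integral_directional_derivative_eq_0: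
  fixes f :: "'a::euclidean_space \<Rightarrow> real"
  assumes C1: "Ck (Suc 0) f" and K: "compact K" "\<And>x. x \<notin> K \<Longrightarrow> f x = 0" and b: "b \<in> Basis"
  shows "(\<integral>x. frechet_derivative f (at x) b \<partial>lebesgue) = 0"
proof -
  define g where "g x = frechet_derivative f (at x) b" for x
  have gcont: "continuous_on UNIV g"
    using Ck_SucD(2)[OF C1 b] by (simp add: g_def[abs_def])
  have fcont: "continuous_on UNIV f" by (rule Ck_imp_continuous[OF C1])
  have g0: "g x = 0" if "x \<notin> K" for x
    using frechet_derivative_eq_0_off_support[OF compact_imp_closed[OF K(1)] K(2) that] by (simp add: g_def)
  have "\<exists>M>0. \<forall>x. norm (g x) \<le> M"
    by (rule bounded_continuous_compact_support[OF gcont K(1)]) (rule g0)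
  then obtain M where M: "M > 0" "\<And>x. norm (g x) \<le> M" by blast
  have along: "((\<lambda>t. f (x + t *\<^sub>R b)) has_real_derivative g (x + t *\<^sub>R b)) (at t)" for x t
  proof -
    have "((\<lambda>t. f (x + t *\<^sub>R b)) has_derivative (\<lambda>h. frechet_derivative f (at (x + t *\<^sub>R b)) (h *\<^sub>R b))) (at t)"
      by (rule has_derivative_compose[OF _ Ck_SucD(1)[OF C1]]) (auto intro!: derivative_eq_intros)
    moreover have "frechet_derivative f (at y) (h *\<^sub>R b) = g y * h" for y h
      unfolding g_def using linear_cmul[OF has_derivative_linear[OF Ck_SucD(1)[OF C1]]] by simp
    ultimately show ?thesis by (simp add: has_field_derivative_def)
  qed
  define F where "F n x = (f (x + (1 / real (Suc n)) *\<^sub>R b) - f x) / (1 / real (Suc n))" for n x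
  \<comment> \<open>All difference quotients of step at most 1 vanish outside this set.\<close>
  define K' where "K' = (\<Union>x\<in>K. \<Union>y\<in>cball 0 1. {x - y})"
  have "compact K'" unfolding K'_def by (rule compact_differences'[OF K(1) compact_cball])
  have limF: "(\<lambda>n. F n x) \<longlonglongrightarrow> g x" for x
  proof -
    have "((\<lambda>h. (f (x + h *\<^sub>R b) - f x) / h) \<longlongrightarrow> g x) (at 0)"
      using along[of x 0] by (simp add: DERIV_def)
    moreover have "filterlim (\<lambda>n. 1 / real (Suc n)) (at 0) sequentially"
      by real_asymp
    ultimately show ?thesis unfolding F_def by (rule filterlim_compose)
  qed
  have boundF: "norm (F n x) \<le> M * indicator K' x" for n x
  proof (cases "x \<in> K'")
    case True
    obtain z where "f (x + (1 / real (Suc n)) *\<^sub>R b) - f (x + 0 *\<^sub>R b) = (1 / real (Suc n) - 0) * g (x + z *\<^sub>R b)"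
      using MVT2[of 0 "1 / real (Suc n)" "\<lambda>t. f (x + t *\<^sub>R b)" "\<lambda>t. g (x + t *\<^sub>R b)"] along[of x] by auto
    then have "F n x = g (x + z *\<^sub>R b)" by (simp add: F_def)
    then show ?thesis using M(2) True by simp
  next
    case False
    have "x + h *\<^sub>R b \<notin> K" if "0 \<le> h" "h \<le> 1" for h
    proof
      assume "x + h *\<^sub>R b \<in> K"
      moreover have "h *\<^sub>R b \<in> cball 0 1" using that b by simp
      moreover have "x = (x + h *\<^sub>R b) - h *\<^sub>R b" by simp
      ultimately have "x \<in> K'" unfolding K'_def by blast
      then show False using False by simp
    qed
    from this[of 0] this[of "1 / real (Suc n)"] have "F n x = 0" by (simp add: F_def K(2))
    then show ?thesis using False by simp
  qed
  have Fint: "(\<integral>x. F n x \<partial>lebesgue) = 0" for n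
  proof -
    have i: "integrable lebesgue f"
      by (rule integrable_continuous_compact_support[OF fcont compact_imp_bounded[OF K(1)] K(2)])
    have i': "integrable lebesgue (\<lambda>x. f ((1 / real (Suc n)) *\<^sub>R b + 1 *\<^sub>R x))"
      using i by (intro integrable_lebesgue_isometry) auto
    have "(\<integral>x. f ((1 / real (Suc n)) *\<^sub>R b + 1 *\<^sub>R x) \<partial>lebesgue) = (\<integral>x. f x \<partial>lebesgue)"
      by (rule integral_lebesgue_isometry) (use i in auto)
    then show ?thesis using i i' by (simp add: F_def add.commute)
  qed
  have "(\<lambda>n. \<integral>x. F n x \<partial>lebesgue) \<longlonglongrightarrow> (\<integral>x. g x \<partial>lebesgue)"
  proof (rule integral_dominated_convergence[where w="\<lambda>x. M * indicator K' x"])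
    show "g \<in> borel_measurable lebesgue"
      by (rule borel_measurable_lebesgue_continuous[OF gcont])
    show "F n \<in> borel_measurable lebesgue" for n
      unfolding F_def
      by (intro borel_measurable_lebesgue_continuous continuous_intros continuous_on_compose2[OF fcont]) auto
    show "integrable lebesgue (\<lambda>x. M * indicator K' x)"
      using lmeasurable_compact[OF \<open>compact K'\<close>]
      by (intro integrable_mult_right) (simp add: lmeasurable_iff_integrable)
    show "AE x in lebesgue. (\<lambda>n. F n x) \<longlonglongrightarrow> g x" by (intro AE_I2 limF)
    show "AE x in lebesgue. norm (F n x) \<le> M * indicator K' x" for n by (intro AE_I2 boundF)
  qed
  then show ?thesis unfolding Fint g_def by (simp add: LIMSEQ_const_iff)
qed

definition grad :: "('a::euclidean_space \<Rightarrow> real) \<Rightarrow> 'a \<Rightarrow> 'a" where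
  "grad f x = (\<Sum>b\<in>Basis. frechet_derivative f (at x) b *\<^sub>R b)"

lemma grad_inner_Basis: "b \<in> Basis \<Longrightarrow> grad f x \<bullet> b = frechet_derivative f (at x) b"
  by (simp add: grad_def inner_sum_left_Basis)

lemma grad_eqI:
  assumes "(f has_derivative f') (at x)" "\<And>b. b \<in> Basis \<Longrightarrow> f' b = v \<bullet> b"
  shows "grad f x = v"
proof (rule euclidean_eqI)
  fix b :: 'a assume b: "b \<in> Basis"
  show "grad f x \<bullet> b = v \<bullet> b"
    using frechet_derivative_at[OF assms(1)] assms(2)[OF b] by (metis grad_inner_Basis[OF b])
qed

lemma has_derivative_grad:
  fixes f :: "'a::euclidean_space \<Rightarrow> real"
  assumes "Ck (Suc k) f" shows "(f has_derivative (\<lambda>h. grad f x \<bullet> h)) (at x)"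
proof -
  have "grad f x \<bullet> h = frechet_derivative f (at x) h" for h
  proof -
    have "frechet_derivative f (at x) (\<Sum>b\<in>Basis. (h \<bullet> b) *\<^sub>R b) = (\<Sum>b\<in>Basis. (h \<bullet> b) * frechet_derivative f (at x) b)"
      using has_derivative_linear[OF Ck_SucD(1)[OF assms]] by (simp add: linear_sum linear_cmul)
    then show ?thesis
      unfolding euclidean_representation by (simp add: grad_def inner_sum_left inner_commute[of h] mult.commute)
  qed
  then show ?thesis using Ck_SucD(1)[OF assms, of x] by simp
qed

lemma continuous_on_grad:
  assumes "Ck (Suc k) f" shows "continuous_on UNIV (grad f)"
  unfolding grad_def
  by (intro continuous_intros Ck_imp_continuous[OF Ck_SucD(2)[OF assms]])

lemma grad_eq_0_off_support:
  assumes "closed K" "\<And>x. x \<notin> K \<Longrightarrow> f x = 0" "x \<notin> K"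
  shows "grad f x = 0"
  using frechet_derivative_eq_0_off_support[OF assms] by (simp add: grad_def)

lemma locally_integrable_continuous:
  fixes f :: "'a::euclidean_space \<Rightarrow> 'b::euclidean_space"
  assumes "continuous_on UNIV f" shows "locally_integrable \<Omega> f"
  unfolding locally_integrable_def
proof (intro allI impI)
  fix K :: "'a set" assume K: "compact K \<and> K \<subseteq> \<Omega>"
  then obtain a b where ab: "K \<subseteq> cbox a b"
    using bounded_subset_cbox_symmetric compact_imp_bounded by metis
  have "set_integrable lebesgue (cbox a b) f"
    by (rule absolutely_integrable_continuous) (use assms continuous_on_subset in blast)
  then show "set_integrable lebesgue K f"
    by (rule set_integrable_subset) (use K ab borel_compact[of K] in auto)
qed

lemma integrable_locally_integrable_mult:
  fixes u g :: "'a::euclidean_space \<Rightarrow> real"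
  assumes "\<Omega> \<in> sets lebesgue" "locally_integrable \<Omega> u" "continuous_on UNIV g"
    and K: "compact K" "K \<subseteq> \<Omega>" "\<And>x. x \<notin> K \<Longrightarrow> g x = 0"
  shows "integrable (lebesgue_on \<Omega>) (\<lambda>x. u x * g x)"
proof -
  have "\<exists>M>0. \<forall>x. norm (g x) \<le> M"
    by (rule bounded_continuous_compact_support[OF assms(3) K(1)]) (rule K(3))
  then obtain M where M: "\<And>x. norm (g x) \<le> M" by blast
  have i: "integrable lebesgue (\<lambda>x. indicator K x *\<^sub>R u x)"
    using assms(2) K by (simp add: locally_integrable_def set_integrable_def)
  have g: "g \<in> borel_measurable lebesgue"
    by (rule borel_measurable_lebesgue_continuous[OF assms(3)])
  have "integrable lebesgue (\<lambda>x. (indicator K x *\<^sub>R u x) * g x)"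
  proof (rule Bochner_Integration.integrable_bound[OF integrable_mult_right[OF i, of M]])
    show "(\<lambda>x. (indicator K x *\<^sub>R u x) * g x) \<in> borel_measurable lebesgue"
      by (rule borel_measurable_times[OF borel_measurable_integrable[OF i] g])
    show "AE x in lebesgue. norm (indicator K x *\<^sub>R u x * g x) \<le> norm (M * (indicator K x *\<^sub>R u x))"
    proof (rule AE_I2)
      fix x
      have "\<bar>g x\<bar> \<le> \<bar>M\<bar>" using order_trans[OF M[of x] abs_ge_self[of M]] by simp
      then show "norm (indicator K x *\<^sub>R u x * g x) \<le> norm (M * (indicator K x *\<^sub>R u x))"
        using mult_left_mono[of "\<bar>g x\<bar>" "\<bar>M\<bar>" "\<bar>indicator K x * u x\<bar>"] by (simp add: abs_mult mult.commute)
    qed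
  qed
  moreover have "(\<lambda>x. (indicator K x *\<^sub>R u x) * g x) = (\<lambda>x. u x * g x)"
    using K(3) by (auto simp: indicator_def fun_eq_iff)
  ultimately show ?thesis
    using K by (subst integral_lebesgue_on_vanishing_outside(2)[OF assms(1)]) auto
qed

text \<open>The product of the function with a test function has compact support, so its directional derivatives
  integrate to 0; the product rule turns this into the defining identity.\<close>

lemma has_weak_gradient_smooth:
  assumes op: "open \<Omega>" and u: "Ck (Suc 0) u"
  shows "has_weak_gradient \<Omega> u (grad u)"
  unfolding has_weak_gradient_def
proof (intro conjI ballI)
  show "locally_integrable \<Omega> u" "locally_integrable \<Omega> (grad u)"
    by (intro locally_integrable_continuous Ck_imp_continuous[OF u] continuous_on_grad[OF u])+
next
  fix \<phi> b assume \<phi>: "\<phi> \<in> test_functions \<Omega>" and b: "b \<in> (Basis :: 'a set)"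
  obtain K where K: "\<And>k. Ck k \<phi>" "compact K" "K \<subseteq> \<Omega>" "\<And>x. x \<notin> K \<Longrightarrow> \<phi> x = 0"
    using test_functionsE[OF \<phi>] by metis
  have \<phi>0: "frechet_derivative \<phi> (at x) b = 0" if "x \<notin> K" for x
    using frechet_derivative_eq_0_off_support[OF compact_imp_closed[OF K(2)] K(4)] that by simp
  have i1: "integrable (lebesgue_on \<Omega>) (\<lambda>x. u x * frechet_derivative \<phi> (at x) b)"
    by (rule integrable_locally_integrable_mult[OF _ locally_integrable_continuous[OF Ck_imp_continuous[OF u]]
          Ck_imp_continuous[OF Ck_SucD(2)[OF K(1) b]] K(2,3) \<phi>0]) (use op in auto)
  have i2: "integrable (lebesgue_on \<Omega>) (\<lambda>x. (grad u x \<bullet> b) * \<phi> x)"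
    by (rule integrable_locally_integrable_mult[OF _ locally_integrable_continuous Ck_imp_continuous[OF K(1)] K(2,3,4)])
       (use op in \<open>auto intro!: continuous_intros continuous_on_grad[OF u]\<close>)
  have d: "frechet_derivative (\<lambda>x. u x * \<phi> x) (at x) b = u x * frechet_derivative \<phi> (at x) b + (grad u x \<bullet> b) * \<phi> x" for x
    using fun_cong[OF frechet_derivative_at[OF has_derivative_mult[OF Ck_SucD(1)[OF u, of x]
      Ck_SucD(1)[OF K(1)[of "Suc 0"], of x]]], of b]
    by (simp add: grad_inner_Basis[OF b])
  have "integral\<^sup>L (lebesgue_on \<Omega>) (\<lambda>x. u x * frechet_derivative \<phi> (at x) b)
      + integral\<^sup>L (lebesgue_on \<Omega>) (\<lambda>x. (grad u x \<bullet> b) * \<phi> x)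
      = integral\<^sup>L (lebesgue_on \<Omega>) (\<lambda>x. frechet_derivative (\<lambda>x. u x * \<phi> x) (at x) b)"
    unfolding d using i1 i2 by (rule Bochner_Integration.integral_add[symmetric])
  also have "\<dots> = integral\<^sup>L lebesgue (\<lambda>x. frechet_derivative (\<lambda>x. u x * \<phi> x) (at x) b)"
  proof (rule integral_lebesgue_on_vanishing_outside)
    fix x assume "x \<notin> \<Omega>"
    then have "x \<notin> K" using K(3) by blast
    then show "frechet_derivative (\<lambda>x. u x * \<phi> x) (at x) b = 0" by (simp add: d K(4) \<phi>0)
  qed (use op in auto)
  also have "\<dots> = 0"
    by (rule integral_directional_derivative_eq_0[OF Ck_mult[OF u K(1)] K(2) _ b]) (simp add: K(4))
  finally show "integral\<^sup>L (lebesgue_on \<Omega>) (\<lambda>x. u x * frechet_derivative \<phi> (at x) b)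
      = - integral\<^sup>L (lebesgue_on \<Omega>) (\<lambda>x. (grad u x \<bullet> b) * \<phi> x)" by simp
qed

lemma locally_integrable_linear_combination:
  assumes "locally_integrable \<Omega> u" "locally_integrable \<Omega> v"
  shows "locally_integrable \<Omega> (\<lambda>x. a *\<^sub>R u x + b *\<^sub>R v x)"
proof -
  have "integrable lebesgue (\<lambda>x. a *\<^sub>R (indicator K x *\<^sub>R u x) + b *\<^sub>R (indicator K x *\<^sub>R v x))"
    if "compact K" "K \<subseteq> \<Omega>" for K
    using assms that unfolding locally_integrable_def set_integrable_def
    by (intro Bochner_Integration.integrable_add integrable_scaleR_right) auto
  then show ?thesis by (simp add: locally_integrable_def set_integrable_def algebra_simps)
qed

lemma locally_integrable_inner:
  "locally_integrable \<Omega> G \<Longrightarrow> locally_integrable \<Omega> (\<lambda>x. G x \<bullet> b)"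
  unfolding locally_integrable_def set_integrable_def
  using integrable_inner_left[of b lebesgue "\<lambda>x. indicator _ x *\<^sub>R G x"] by simp

lemma has_weak_gradient_integrable:
  assumes op: "open \<Omega>" and G: "has_weak_gradient \<Omega> u G" and \<phi>: "\<phi> \<in> test_functions \<Omega>" and b: "b \<in> Basis"
  shows "integrable (lebesgue_on \<Omega>) (\<lambda>x. u x * frechet_derivative \<phi> (at x) b)"
    and "integrable (lebesgue_on \<Omega>) (\<lambda>x. (G x \<bullet> b) * \<phi> x)"
proof -
  obtain K where K: "\<And>k. Ck k \<phi>" "compact K" "K \<subseteq> \<Omega>" "\<And>x. x \<notin> K \<Longrightarrow> \<phi> x = 0"
    using test_functionsE[OF \<phi>] by metis
  have \<phi>0: "frechet_derivative \<phi> (at x) b = 0" if "x \<notin> K" for x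
    using frechet_derivative_eq_0_off_support[OF compact_imp_closed[OF K(2)] K(4)] that by simp
  show "integrable (lebesgue_on \<Omega>) (\<lambda>x. u x * frechet_derivative \<phi> (at x) b)"
    using op G by (intro integrable_locally_integrable_mult[OF _ _ Ck_imp_continuous[OF Ck_SucD(2)[OF K(1) b]] K(2,3) \<phi>0])
       (auto simp: has_weak_gradient_def)
  show "integrable (lebesgue_on \<Omega>) (\<lambda>x. (G x \<bullet> b) * \<phi> x)"
    using op G by (intro integrable_locally_integrable_mult[OF _ _ Ck_imp_continuous[OF K(1)] K(2,3,4)] locally_integrable_inner)
       (auto simp: has_weak_gradient_def)
qed

lemma has_weak_gradient_linear_combination:
  assumes op: "open \<Omega>" and G: "has_weak_gradient \<Omega> u G" and H: "has_weak_gradient \<Omega> v H"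
  shows "has_weak_gradient \<Omega> (\<lambda>x. a * u x + c * v x) (\<lambda>x. a *\<^sub>R G x + c *\<^sub>R H x)"
  unfolding has_weak_gradient_def
proof (intro conjI ballI)
  show "locally_integrable \<Omega> (\<lambda>x. a * u x + c * v x)" "locally_integrable \<Omega> (\<lambda>x. a *\<^sub>R G x + c *\<^sub>R H x)"
    using locally_integrable_linear_combination[of \<Omega> u v a c] locally_integrable_linear_combination[of \<Omega> G H a c] G H
    by (auto simp: has_weak_gradient_def)
next
  fix \<phi> b assume \<phi>: "\<phi> \<in> test_functions \<Omega>" and b: "b \<in> (Basis :: 'a set)"
  note i = has_weak_gradient_integrable[OF op G \<phi> b] has_weak_gradient_integrable[OF op H \<phi> b]
  have "integral\<^sup>L (lebesgue_on \<Omega>) (\<lambda>x. (a * u x + c * v x) * frechet_derivative \<phi> (at x) b)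
     = a * integral\<^sup>L (lebesgue_on \<Omega>) (\<lambda>x. u x * frechet_derivative \<phi> (at x) b)
      + c * integral\<^sup>L (lebesgue_on \<Omega>) (\<lambda>x. v x * frechet_derivative \<phi> (at x) b)"
    using i by (simp add: ring_distribs mult.assoc)
  moreover have "integral\<^sup>L (lebesgue_on \<Omega>) (\<lambda>x. ((a *\<^sub>R G x + c *\<^sub>R H x) \<bullet> b) * \<phi> x)
     = a * integral\<^sup>L (lebesgue_on \<Omega>) (\<lambda>x. (G x \<bullet> b) * \<phi> x) + c * integral\<^sup>L (lebesgue_on \<Omega>) (\<lambda>x. (H x \<bullet> b) * \<phi> x)"
    using i by (simp add: ring_distribs inner_add_left mult.assoc)
  ultimately show "integral\<^sup>L (lebesgue_on \<Omega>) (\<lambda>x. (a * u x + c * v x) * frechet_derivative \<phi> (at x) b)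
      = - integral\<^sup>L (lebesgue_on \<Omega>) (\<lambda>x. ((a *\<^sub>R G x + c *\<^sub>R H x) \<bullet> b) * \<phi> x)"
    using G H \<phi> b by (simp add: has_weak_gradient_def)
qed

text \<open>The difference of two weak gradients is a weak gradient of 0, and the fundamental lemma applies to each
  of its components.\<close>

lemma has_weak_gradient_unique:
  assumes op: "open \<Omega>" and G: "has_weak_gradient \<Omega> u G" and H: "has_weak_gradient \<Omega> u H"
  shows "AE x in lebesgue_on \<Omega>. G x = H x"
proof -
  have D: "has_weak_gradient \<Omega> (\<lambda>x. 1 * u x + (-1) * u x) (\<lambda>x. 1 *\<^sub>R G x + (-1) *\<^sub>R H x)"
    by (rule has_weak_gradient_linear_combination[OF op G H])
  have "AE x in lebesgue_on \<Omega>. (1 *\<^sub>R G x + (-1) *\<^sub>R H x) \<bullet> b = 0" if b: "b \<in> Basis" for b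
  proof (rule fundamental_lemma_of_calculus_of_variations[OF op])
    show "locally_integrable \<Omega> (\<lambda>x. (1 *\<^sub>R G x + (-1) *\<^sub>R H x) \<bullet> b)"
      using D by (intro locally_integrable_inner) (simp add: has_weak_gradient_def)
    show "integral\<^sup>L (lebesgue_on \<Omega>) (\<lambda>x. (1 *\<^sub>R G x + (-1) *\<^sub>R H x) \<bullet> b * \<phi> x) = 0"
      if "\<phi> \<in> test_functions \<Omega>" for \<phi>
      using D that b by (simp add: has_weak_gradient_def)
  qed
  then have "AE x in lebesgue_on \<Omega>. \<forall>b\<in>Basis. (G x - H x) \<bullet> b = 0"
    by (intro AE_finite_allI) auto
  then show ?thesis
    by eventually_elim (simp add: euclidean_eq_iff[of "G _"] inner_diff_left)
qed

lemma has_weak_gradient_weak_gradient: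
  "has_weak_gradient \<Omega> u G \<Longrightarrow> has_weak_gradient \<Omega> u (weak_gradient \<Omega> u)"
  unfolding weak_gradient_def by (rule someI_ex[of "has_weak_gradient \<Omega> u"]) blast

lemma weak_gradient_AE:
  "open \<Omega> \<Longrightarrow> has_weak_gradient \<Omega> u G \<Longrightarrow> AE x in lebesgue_on \<Omega>. weak_gradient \<Omega> u x = G x"
  by (rule has_weak_gradient_unique[OF _ has_weak_gradient_weak_gradient])

section \<open>Sobolev functions and the modular\<close>

text \<open>Convexity of the power with weights \<open>1 - t\<close> and \<open>t\<close>. For small \<open>t\<close> the factor of the first summand is
  close to 1 while the second one is merely finite, so that the inequality bounds the effect of a small
  perturbation and does the work of Minkowski's inequality.\<close>

lemma powr_add_le:
  fixes a b p t :: real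
  assumes "p \<ge> 1" "0 < t" "t < 1" "a \<ge> 0" "b \<ge> 0"
  shows "(a + b) powr p \<le> (1 - t) powr (1 - p) * a powr p + t powr (1 - p) * b powr p"
proof -
  have ge1: "s powr (1 - p) \<ge> 1" if "0 < s" "s < 1" for s
    using that assms(1) powr_mono'[of "1 - p" 0 s] by simp
  consider "a = 0" | "b = 0" | "a > 0" "b > 0" using assms by linarith
  then show ?thesis
  proof cases
    case 1
    then show ?thesis using ge1[of t] assms mult_right_mono[of 1 "t powr (1 - p)" "b powr p"] by simp
  next
    case 2
    then show ?thesis using ge1[of "1 - t"] assms mult_right_mono[of 1 "(1 - t) powr (1 - p)" "a powr p"] by simp
  next
    case 3
    have s: "s * (c / s) powr p = s powr (1 - p) * c powr p" if "s > 0" "c > 0" for s c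
      using that by (simp add: powr_divide powr_diff)
    have "((1 - t) *\<^sub>R (a / (1 - t)) + t *\<^sub>R (b / t)) powr p
        \<le> (1 - t) * (a / (1 - t)) powr p + t * (b / t) powr p"
      by (rule convex_onD[OF powr_convex[OF assms(1)]]) (use assms 3 in auto)
    then show ?thesis using assms 3 by (simp add: s)
  qed
qed

lemma powr_add_le_2:
  fixes a b p :: real
  assumes "p \<ge> 1" "a \<ge> 0" "b \<ge> 0"
  shows "(a + b) powr p \<le> 2 powr p * (a powr p + b powr p)"
proof -
  have "(a + b) powr p \<le> (1 - 1/2) powr (1 - p) * a powr p + (1/2) powr (1 - p) * b powr p"
    by (rule powr_add_le) (use assms in auto)
  also have "\<dots> = (1/2) powr (1 - p) * (a powr p + b powr p)" by (simp add: algebra_simps)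
  also have "(1/2::real) powr (1 - p) \<le> 2 powr p"
    by (simp add: powr_divide powr_minus_divide[symmetric] powr_mono)
  finally show ?thesis by (simp add: mult_right_mono)
qed

lemma norm_add_powr_le:
  fixes x y :: "'a::real_normed_vector"
  assumes "p \<ge> 1"
  shows "norm (a *\<^sub>R x + c *\<^sub>R y) powr p \<le> 2 powr p * (\<bar>a\<bar> powr p * norm x powr p + \<bar>c\<bar> powr p * norm y powr p)"
proof -
  have "norm (a *\<^sub>R x + c *\<^sub>R y) powr p \<le> (\<bar>a\<bar> * norm x + \<bar>c\<bar> * norm y) powr p"
    using assms norm_triangle_ineq[of "a *\<^sub>R x" "c *\<^sub>R y"] by (intro powr_mono2) auto
  also have "\<dots> \<le> 2 powr p * ((\<bar>a\<bar> * norm x) powr p + (\<bar>c\<bar> * norm y) powr p)"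
    by (rule powr_add_le_2) (use assms in auto)
  finally show ?thesis by (simp add: powr_mult)
qed

lemma Lp_linear_combination:
  assumes p: "p \<ge> 1" and f: "f \<in> Lp \<Omega> p" and g: "g \<in> Lp \<Omega> p"
  shows "(\<lambda>x. a *\<^sub>R f x + c *\<^sub>R g x) \<in> Lp \<Omega> p"
proof -
  have [measurable]: "f \<in> borel_measurable (lebesgue_on \<Omega>)" "g \<in> borel_measurable (lebesgue_on \<Omega>)"
    using f g by (auto simp: Lp_def)
  have "integrable (lebesgue_on \<Omega>) (\<lambda>x. 2 powr p * (\<bar>a\<bar> powr p * norm (f x) powr p + \<bar>c\<bar> powr p * norm (g x) powr p))"
    using f g by (intro integrable_mult_right Bochner_Integration.integrable_add) (auto simp: Lp_def)
  then have "integrable (lebesgue_on \<Omega>) (\<lambda>x. norm (a *\<^sub>R f x + c *\<^sub>R g x) powr p)"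
    by (rule Bochner_Integration.integrable_bound) (use norm_add_powr_le[OF p] in \<open>auto intro!: AE_I2\<close>)
  then show ?thesis by (simp add: Lp_def)
qed

lemma borel_measurable_lebesgue_on_AE:
  fixes f :: "'a::euclidean_space \<Rightarrow> 'b::euclidean_space"
  assumes S: "S \<in> sets lebesgue" and f: "f \<in> borel_measurable (lebesgue_on S)"
    and ae: "AE x in lebesgue_on S. f x = g x"
  shows "g \<in> borel_measurable (lebesgue_on S)"
proof -
  have "AE x in lebesgue. (if x \<in> S then f x else 0) = (if x \<in> S then g x else 0)"
    using ae S by (subst (asm) AE_restrict_space_iff) (auto elim: eventually_mono)
  from borel_measurable_AE[OF borel_measurable_if_I[OF f S] this]
  show ?thesis by (rule borel_measurable_if_D)
qed

lemma Lp_cong_AE: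
  fixes f :: "'a::euclidean_space \<Rightarrow> 'b::euclidean_space"
  assumes S: "S \<in> sets lebesgue" and f: "f \<in> Lp S p" and ae: "AE x in lebesgue_on S. f x = g x"
  shows "g \<in> Lp S p"
proof -
  have g: "g \<in> borel_measurable (lebesgue_on S)"
    using borel_measurable_lebesgue_on_AE[OF S _ ae] f by (simp add: Lp_def)
  have "integrable (lebesgue_on S) (\<lambda>x. norm (g x) powr p)"
    by (rule integrable_cong_AE_imp[of _ "\<lambda>x. norm (f x) powr p"])
       (use f g ae in \<open>auto simp: Lp_def elim: eventually_mono\<close>)
  with g show ?thesis by (simp add: Lp_def)
qed

lemma W1pD:
  assumes op: "open \<Omega>" and u: "u \<in> W1p \<Omega> p"
  shows "u \<in> Lp \<Omega> p" and "has_weak_gradient \<Omega> u (weak_gradient \<Omega> u)" and "weak_gradient \<Omega> u \<in> Lp \<Omega> p"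
proof -
  obtain G where G: "G \<in> Lp \<Omega> p" "has_weak_gradient \<Omega> u G" using u by (auto simp: W1p_def)
  show "u \<in> Lp \<Omega> p" using u by (simp add: W1p_def)
  show "has_weak_gradient \<Omega> u (weak_gradient \<Omega> u)" by (rule has_weak_gradient_weak_gradient[OF G(2)])
  have "AE x in lebesgue_on \<Omega>. G x = weak_gradient \<Omega> u x"
    using weak_gradient_AE[OF op G(2)] by (auto elim: eventually_mono)
  then show "weak_gradient \<Omega> u \<in> Lp \<Omega> p" using op by (intro Lp_cong_AE[OF _ G(1)]) auto
qed

lemma W1p_linear_combination:
  assumes op: "open \<Omega>" and p: "p \<ge> 1" and u: "u \<in> W1p \<Omega> p" and v: "v \<in> W1p \<Omega> p"
  shows "(\<lambda>x. a * u x + c * v x) \<in> W1p \<Omega> p"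
    and "AE x in lebesgue_on \<Omega>. weak_gradient \<Omega> (\<lambda>x. a * u x + c * v x) x
           = a *\<^sub>R weak_gradient \<Omega> u x + c *\<^sub>R weak_gradient \<Omega> v x"
proof -
  note h = has_weak_gradient_linear_combination[OF op W1pD(2)[OF op u] W1pD(2)[OF op v], of a c]
  have "(\<lambda>x. a *\<^sub>R u x + c *\<^sub>R v x) \<in> Lp \<Omega> p"
    by (rule Lp_linear_combination[OF p W1pD(1)[OF op u] W1pD(1)[OF op v]])
  then show "(\<lambda>x. a * u x + c * v x) \<in> W1p \<Omega> p"
    using h Lp_linear_combination[OF p W1pD(3)[OF op u] W1pD(3)[OF op v], of a c] by (auto simp: W1p_def)
  show "AE x in lebesgue_on \<Omega>. weak_gradient \<Omega> (\<lambda>x. a * u x + c * v x) x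
           = a *\<^sub>R weak_gradient \<Omega> u x + c *\<^sub>R weak_gradient \<Omega> v x"
    by (rule weak_gradient_AE[OF op h])
qed

lemma W1p_diff:
  assumes op: "open \<Omega>" and p: "p \<ge> 1" and u: "u \<in> W1p \<Omega> p" and v: "v \<in> W1p \<Omega> p"
  shows "u - v \<in> W1p \<Omega> p"
    and "AE x in lebesgue_on \<Omega>. weak_gradient \<Omega> (u - v) x = weak_gradient \<Omega> u x - weak_gradient \<Omega> v x"
proof -
  have "(\<lambda>x. 1 * u x + (-1) * v x) = u - v" by (simp add: fun_eq_iff)
  with W1p_linear_combination[OF assms, of 1 "-1"] show "u - v \<in> W1p \<Omega> p"
    and "AE x in lebesgue_on \<Omega>. weak_gradient \<Omega> (u - v) x = weak_gradient \<Omega> u x - weak_gradient \<Omega> v x"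
    by simp_all
qed

lemma integrable_lebesgue_on_continuous:
  fixes f :: "'a::euclidean_space \<Rightarrow> 'b::euclidean_space"
  assumes "open \<Omega>" "bounded \<Omega>" "continuous_on UNIV f"
  shows "integrable (lebesgue_on \<Omega>) f"
proof -
  obtain a b where ab: "\<Omega> \<subseteq> cbox a b" using bounded_subset_cbox_symmetric[OF assms(2)] by metis
  have "set_integrable lebesgue (cbox a b) f"
    by (rule absolutely_integrable_continuous) (use assms(3) continuous_on_subset in blast)
  then have "set_integrable lebesgue \<Omega> f"
    by (rule set_integrable_subset) (use ab assms(1) in auto)
  then show ?thesis using assms(1) by (simp add: integrable_restrict_space set_integrable_def)
qed

lemma W1p_smooth:
  assumes op: "open \<Omega>" and bd: "bounded \<Omega>" and p: "p \<ge> 1" and u: "Ck (Suc 0) u"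
  shows "u \<in> W1p \<Omega> p" and "AE x in lebesgue_on \<Omega>. weak_gradient \<Omega> u x = grad u x"
proof -
  have "f \<in> Lp \<Omega> p" if c: "continuous_on UNIV f" for f :: "'a \<Rightarrow> 'b::euclidean_space"
  proof -
    have "integrable (lebesgue_on \<Omega>) (\<lambda>x. norm (f x) powr p)"
      using p by (intro integrable_lebesgue_on_continuous[OF op bd] continuous_on_powr' continuous_intros c) auto
    then show ?thesis
      using borel_measurable_integrable[OF integrable_lebesgue_on_continuous[OF op bd c]] by (simp add: Lp_def)
  qed
  note Lp = this
  have "u \<in> Lp \<Omega> p" "grad u \<in> Lp \<Omega> p"
    by (rule Lp; intro Ck_imp_continuous[OF u] continuous_on_grad[OF u])+
  then show "u \<in> W1p \<Omega> p" using has_weak_gradient_smooth[OF op u] by (auto simp: W1p_def)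
  show "AE x in lebesgue_on \<Omega>. weak_gradient \<Omega> u x = grad u x"
    by (rule weak_gradient_AE[OF op has_weak_gradient_smooth[OF op u]])
qed

text \<open>The \<open>p\<close>-th power of the Sobolev norm. It obeys a triangle inequality with factor \<open>2 powr p\<close> and describes the
  same topology, so roots need not be taken.\<close>

definition W1p_modular :: "'a::euclidean_space set \<Rightarrow> real \<Rightarrow> ('a \<Rightarrow> real) \<Rightarrow> real" where
  "W1p_modular \<Omega> p u = integral\<^sup>L (lebesgue_on \<Omega>) (\<lambda>x. \<bar>u x\<bar> powr p) +
      integral\<^sup>L (lebesgue_on \<Omega>) (\<lambda>x. norm (weak_gradient \<Omega> u x) powr p)"

lemma W1p_modular_nonneg: "W1p_modular \<Omega> p u \<ge> 0"
  by (simp add: W1p_modular_def)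

lemma W1p_norm_less_iff:
  "p > 0 \<Longrightarrow> e > 0 \<Longrightarrow> W1p_norm \<Omega> p u < e \<longleftrightarrow> W1p_modular \<Omega> p u < e powr p"
proof -
  assume p: "p > 0" and e: "e > 0"
  have *: "W1p_norm \<Omega> p u = W1p_modular \<Omega> p u powr (1 / p)"
    by (simp add: W1p_norm_def W1p_modular_def)
  have "W1p_modular \<Omega> p u powr (1 / p) < e \<longleftrightarrow> (W1p_modular \<Omega> p u powr (1 / p)) powr p < e powr p"
    using p e powr_less_mono2[of p] powr_less_cancel2[of p] by (metis less_eq_real_def powr_ge_zero)
  then show ?thesis using p W1p_modular_nonneg[of \<Omega> p u] by (simp add: * powr_powr)
qed

lemma W1p_modular_linear_combination_le:
  assumes op: "open \<Omega>" and p: "p \<ge> 1" and u: "u \<in> W1p \<Omega> p" and v: "v \<in> W1p \<Omega> p"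
  shows "W1p_modular \<Omega> p (\<lambda>x. a * u x + c * v x)
    \<le> 2 powr p * (\<bar>a\<bar> powr p * W1p_modular \<Omega> p u + \<bar>c\<bar> powr p * W1p_modular \<Omega> p v)"
proof -
  let ?I = "integral\<^sup>L (lebesgue_on \<Omega>)"
  note w = W1p_linear_combination[OF assms, of a c]
  have i: "integrable (lebesgue_on \<Omega>) (\<lambda>x. \<bar>w x\<bar> powr p)"
    "integrable (lebesgue_on \<Omega>) (\<lambda>x. norm (weak_gradient \<Omega> w x) powr p)" if "w \<in> W1p \<Omega> p" for w
    using W1pD[OF op that] by (simp_all add: Lp_def)
  have le: "\<bar>a * s + c * r\<bar> powr p \<le> 2 powr p * (\<bar>a\<bar> powr p * \<bar>s\<bar> powr p + \<bar>c\<bar> powr p * \<bar>r\<bar> powr p)" for s r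
    using norm_add_powr_le[OF p, of a s c r] by simp
  have "?I (\<lambda>x. \<bar>a * u x + c * v x\<bar> powr p) \<le> ?I (\<lambda>x. 2 powr p * (\<bar>a\<bar> powr p * \<bar>u x\<bar> powr p + \<bar>c\<bar> powr p * \<bar>v x\<bar> powr p))"
    by (intro integral_mono integrable_mult_right Bochner_Integration.integrable_add i(1) u v w(1) le)
  also have "\<dots> = 2 powr p * (\<bar>a\<bar> powr p * ?I (\<lambda>x. \<bar>u x\<bar> powr p) + \<bar>c\<bar> powr p * ?I (\<lambda>x. \<bar>v x\<bar> powr p))"
    using i(1)[OF u] i(1)[OF v] by simp
  finally have 1: "?I (\<lambda>x. \<bar>a * u x + c * v x\<bar> powr p)
     \<le> 2 powr p * (\<bar>a\<bar> powr p * ?I (\<lambda>x. \<bar>u x\<bar> powr p) + \<bar>c\<bar> powr p * ?I (\<lambda>x. \<bar>v x\<bar> powr p))" .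
  have "?I (\<lambda>x. norm (weak_gradient \<Omega> (\<lambda>x. a * u x + c * v x) x) powr p)
     \<le> ?I (\<lambda>x. 2 powr p * (\<bar>a\<bar> powr p * norm (weak_gradient \<Omega> u x) powr p + \<bar>c\<bar> powr p * norm (weak_gradient \<Omega> v x) powr p))"
  proof (rule integral_mono_AE[OF i(2)[OF w(1)]])
    show "integrable (lebesgue_on \<Omega>) (\<lambda>x. 2 powr p * (\<bar>a\<bar> powr p * norm (weak_gradient \<Omega> u x) powr p + \<bar>c\<bar> powr p * norm (weak_gradient \<Omega> v x) powr p))"
      using i(2)[OF u] i(2)[OF v] by (intro integrable_mult_right Bochner_Integration.integrable_add)
    show "AE x in lebesgue_on \<Omega>. norm (weak_gradient \<Omega> (\<lambda>x. a * u x + c * v x) x) powr p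
       \<le> 2 powr p * (\<bar>a\<bar> powr p * norm (weak_gradient \<Omega> u x) powr p + \<bar>c\<bar> powr p * norm (weak_gradient \<Omega> v x) powr p)"
      using w(2) by eventually_elim (simp add: norm_add_powr_le[OF p])
  qed
  also have "\<dots> = 2 powr p * (\<bar>a\<bar> powr p * ?I (\<lambda>x. norm (weak_gradient \<Omega> u x) powr p)
      + \<bar>c\<bar> powr p * ?I (\<lambda>x. norm (weak_gradient \<Omega> v x) powr p))"
    using i(2)[OF u] i(2)[OF v] by simp
  finally show ?thesis using 1 by (simp add: W1p_modular_def algebra_simps)
qed

lemma W1p_modular_eq_0D:
  assumes op: "open \<Omega>" and u: "u \<in> W1p \<Omega> p" and 0: "W1p_modular \<Omega> p u = 0"
  shows "AE x in lebesgue_on \<Omega>. u x = 0" and "AE x in lebesgue_on \<Omega>. weak_gradient \<Omega> u x = 0"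
proof -
  have i: "integrable (lebesgue_on \<Omega>) (\<lambda>x. \<bar>u x\<bar> powr p)"
    "integrable (lebesgue_on \<Omega>) (\<lambda>x. norm (weak_gradient \<Omega> u x) powr p)"
    using W1pD[OF op u] by (simp_all add: Lp_def)
  have z: "integral\<^sup>L (lebesgue_on \<Omega>) (\<lambda>x. \<bar>u x\<bar> powr p) = 0"
    "integral\<^sup>L (lebesgue_on \<Omega>) (\<lambda>x. norm (weak_gradient \<Omega> u x) powr p) = 0"
    using 0 by (simp_all add: W1p_modular_def add_nonneg_eq_0_iff)
  show "AE x in lebesgue_on \<Omega>. u x = 0"
    using z(1) integral_nonneg_eq_0_iff_AE[OF i(1)] by (auto elim: eventually_mono)
  show "AE x in lebesgue_on \<Omega>. weak_gradient \<Omega> u x = 0"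
    using z(2) integral_nonneg_eq_0_iff_AE[OF i(2)] by (auto elim: eventually_mono)
qed

lemma W1p_modular_0: "open \<Omega> \<Longrightarrow> bounded \<Omega> \<Longrightarrow> p \<ge> 1 \<Longrightarrow> W1p_modular \<Omega> p (\<lambda>_. 0) = 0"
proof -
  assume op: "open \<Omega>" and bd: "bounded \<Omega>" and p: "p \<ge> 1"
  have "grad (\<lambda>_. 0 :: real) = (\<lambda>x::'a. 0)"
    by (intro ext grad_eqI[of _ "\<lambda>_. 0"]) auto
  then have "AE x in lebesgue_on \<Omega>. weak_gradient \<Omega> (\<lambda>_. 0) x = 0"
    using W1p_smooth(2)[OF op bd p Ck_const[where c=0]] by simp
  then have "integral\<^sup>L (lebesgue_on \<Omega>) (\<lambda>x. norm (weak_gradient \<Omega> (\<lambda>_. 0) x) powr p) = 0"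
    by (intro integral_eq_zero_AE) (auto elim: eventually_mono)
  then show ?thesis by (simp add: W1p_modular_def)
qed

section \<open>The projection onto the cross-section\<close>

lemma prod_Basis_cart:
  fixes f :: "real ^ 'n \<Rightarrow> 'b::comm_monoid_mult"
  shows "(\<Prod>b\<in>Basis. f b) = (\<Prod>i\<in>UNIV. f (axis i 1))"
proof -
  have "Basis = range (\<lambda>i. axis i 1 :: real ^ 'n)" by (auto simp: Basis_vec_def)
  moreover have "inj (\<lambda>i. axis i 1 :: real ^ 'n)" by (auto simp: inj_on_def axis_eq_axis)
  ultimately show ?thesis by (metis (no_types, lifting) prod.reindex_cong)
qed

lemma continuous_X2: "continuous_on S X2"
  unfolding X2_def by (intro continuous_intros)

text \<open>The projection of a slab of unit thickness pushes Lebesgue measure forward to Lebesgue measure: both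
  sides agree on boxes.\<close>

lemma lborel_eq_distr_slab:
  "(lborel :: (real ^ 'm) measure) = distr (restrict_space lborel {x. x $ None \<in> {t<..<t+1}}) borel X2"
proof (rule lborel_eqI)
  have X2[measurable]: "X2 \<in> borel_measurable borel"
    by (rule borel_measurable_continuous_onI[OF continuous_X2])
  have op: "open {x :: real ^ 'm option. x $ None \<in> {t<..<t+1}}"
    by (simp add: open_Collect_conj open_Collect_less continuous_intros)
  fix l u :: "real ^ 'm" assume le: "\<And>b. b \<in> Basis \<Longrightarrow> l \<bullet> b \<le> u \<bullet> b"
  have le': "l $ j \<le> u $ j" for j using le[of "axis j 1"] by (simp add: inner_axis)
  define l' :: "real ^ 'm option" where "l' = (\<chi> i. case i of None \<Rightarrow> t | Some j \<Rightarrow> l $ j)"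
  define u' :: "real ^ 'm option" where "u' = (\<chi> i. case i of None \<Rightarrow> t + 1 | Some j \<Rightarrow> u $ j)"
  have eq: "X2 -` box l u \<inter> {x. x $ None \<in> {t<..<t+1}} = box l' u'"
    by (auto simp: mem_box_cart X2_def l'_def u'_def split: option.splits)
  have le'': "l' \<bullet> b \<le> u' \<bullet> b" if "b \<in> Basis" for b
    using that le' by (auto simp: Basis_vec_def inner_axis l'_def u'_def split: option.splits)
  have "emeasure (distr (restrict_space lborel {x. x $ None \<in> {t<..<t+1}}) borel X2) (box l u)
     = emeasure (restrict_space lborel {x. x $ None \<in> {t<..<t+1}}) (X2 -` box l u \<inter> {x. x $ None \<in> {t<..<t+1}})"
    by (subst emeasure_distr) (auto simp: space_restrict_space intro!: measurable_restrict_space1)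
  also have "\<dots> = emeasure lborel (box l' u')"
    unfolding eq by (rule emeasure_restrict_space) (use borel_open[OF op] eq in auto)
  also have "\<dots> = (\<Prod>b\<in>Basis. (u' - l') \<bullet> b)"
    using le'' by (simp add: emeasure_lborel_box_eq)
  also have "(\<Prod>b\<in>Basis. (u' - l') \<bullet> b) = (\<Prod>b\<in>Basis. (u - l) \<bullet> b)"
    unfolding prod_Basis_cart UNIV_option_conv
    by (subst prod.insert) (auto simp: prod.reindex inner_axis l'_def u'_def)
  finally show "emeasure (distr (restrict_space lborel {x. x $ None \<in> {t<..<t+1}}) borel X2) (box l u)
     = (\<Prod>b\<in>Basis. (u - l) \<bullet> b)" .
qed simp

text \<open>Needed to read the almost-everywhere hypotheses on the coefficients, which live on the cross-section, as
  statements on the cylinder. The preimage of a null set is null in every slab of unit thickness.\<close>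

lemma null_sets_vimage_X2:
  assumes "N \<in> null_sets (lborel :: (real ^ 'm) measure)"
  shows "X2 -` N \<in> null_sets (lborel :: (real ^ 'm option) measure)"
proof -
  have X2[measurable]: "X2 \<in> borel_measurable borel"
    by (rule borel_measurable_continuous_onI[OF continuous_X2])
  \<comment> \<open>The slabs are open, so they are centred at the integer multiples of \<open>1/2\<close> in order that consecutive ones overlap and cover everything.\<close>
  define S where "S k = {x :: real ^ 'm option. x $ None \<in> {real_of_int k / 2 - 1/2<..<real_of_int k / 2 - 1/2 + 1}}" for k :: int
  have op: "open (S k)" for k
    unfolding S_def by (simp add: open_Collect_conj open_Collect_less continuous_intros)
  have N[measurable]: "N \<in> sets borel" using assms by auto
  have "X2 -` N \<inter> S k \<in> null_sets lborel" for k
  proof -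
    have "emeasure (distr (restrict_space lborel (S k)) borel X2) N = emeasure lborel N"
      unfolding S_def by (subst lborel_eq_distr_slab[symmetric]) simp
    then have "emeasure lborel (X2 -` N \<inter> S k) = 0"
      using assms op[of k]
      by (subst (asm) emeasure_distr)
        (auto simp: space_restrict_space emeasure_restrict_space intro!: measurable_restrict_space1)
    moreover have "X2 -` N \<inter> S k \<in> sets lborel"
      using measurable_sets[OF X2 N] op[of k] by auto
    ultimately show ?thesis by auto
  qed
  then have "(\<Union>k. X2 -` N \<inter> S k) \<in> null_sets lborel" by (intro null_sets_UN) auto
  moreover have "\<exists>k. x \<in> S k" for x
  proof
    show "x \<in> S \<lfloor>2 * x $ None\<rfloor>" unfolding S_def by simp linarith
  qed
  then have "(\<Union>k. X2 -` N \<inter> S k) = X2 -` N" by auto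
  ultimately show ?thesis by simp
qed

lemma AE_lebesgue_X2:
  assumes "AE X in (lebesgue :: (real ^ 'm) measure). P X"
  shows "AE x in lebesgue. P (X2 x)"
proof -
  have "AE X in lborel. P X" using assms by (simp add: AE_completion_iff)
  then obtain N where N: "{X. \<not> P X} \<subseteq> N" "N \<in> null_sets (lborel :: (real ^ 'm) measure)"
    by (auto elim!: AE_E simp: null_sets_def)
  have "AE x in lborel. x \<notin> X2 -` N" by (rule AE_not_in[OF null_sets_vimage_X2[OF N(2)]])
  then have "AE x in lborel. P (X2 x)"
    by eventually_elim (use N(1) in auto)
  then show ?thesis by (rule AE_completion)
qed

lemma borel_measurable_lebesgue_X2:
  fixes f :: "real ^ 'm \<Rightarrow> real"
  assumes "f \<in> borel_measurable lebesgue"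
  shows "(\<lambda>x. f (X2 x)) \<in> borel_measurable lebesgue"
proof -
  obtain g where g[measurable]: "g \<in> borel_measurable lborel" and fg: "AE x in lborel. f x = g x"
    using completion_ex_borel_measurable_real[OF assms] by auto
  have X2[measurable]: "X2 \<in> borel_measurable borel"
    by (rule borel_measurable_continuous_onI[OF continuous_X2])
  have "(\<lambda>x. g (X2 x)) \<in> borel_measurable lebesgue"
    by (intro measurable_completion) simp
  moreover have "AE x in lebesgue. g (X2 x) = f (X2 x)"
    by (rule AE_lebesgue_X2) (rule AE_completion, use fg in \<open>auto elim: eventually_mono\<close>)
  ultimately show ?thesis by (rule borel_measurable_AE)
qed

section \<open>Energy densities on the cylinder\<close>

lemma open_cylinder:
  assumes "open \<omega>" shows "open (cylinder \<omega> l)"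
proof -
  have "cylinder \<omega> l = {x. x $ None \<in> {-l<..<l}} \<inter> X2 -` \<omega>" by (auto simp: cylinder_def)
  moreover have "open {x :: real ^ 'a option. x $ None \<in> {-l<..<l}}"
    by (simp add: open_Collect_conj open_Collect_less continuous_intros)
  moreover have "open (X2 -` \<omega>)" by (rule open_vimage[OF assms continuous_X2])
  ultimately show ?thesis by (simp add: open_Int)
qed

lemma bounded_cylinder:
  assumes "bounded \<omega>" shows "bounded (cylinder \<omega> l)"
proof -
  obtain B where B: "\<And>X. X \<in> \<omega> \<Longrightarrow> norm X \<le> B" using assms by (auto simp: bounded_iff)
  have "norm x \<le> (\<Sum>i\<in>(UNIV :: 'a option set). max \<bar>l\<bar> B)" if x: "x \<in> cylinder \<omega> l" for x
  proof (rule order_trans[OF norm_le_l1_cart], rule sum_mono)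
    fix i :: "'a option"
    show "\<bar>x $ i\<bar> \<le> max \<bar>l\<bar> B"
    proof (cases i)
      case None
      then show ?thesis using x by (auto simp: cylinder_def)
    next
      case (Some j)
      have "\<bar>X2 x $ j\<bar> \<le> B" using component_le_norm_cart[of "X2 x" j] B[of "X2 x"] x by (auto simp: cylinder_def)
      then show ?thesis using Some by (simp add: X2_def)
    qed
  qed
  then show ?thesis by (auto simp: bounded_iff)
qed

text \<open>Positivity of the form at \<open>t \<xi> - (1 - t) \<eta>\<close>, divided by \<open>t (1 - t)\<close>, bounds the mixed term.\<close>

lemma quadratic_form_add_le:
  fixes M :: "real ^ 'n ^ 'n"
  assumes sym: "transpose M = M" and psd: "\<And>\<xi>. (M *v \<xi>) \<bullet> \<xi> \<ge> 0" and t: "0 < t" "t < 1"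
  shows "(M *v (\<xi> + \<eta>)) \<bullet> (\<xi> + \<eta>) \<le> ((M *v \<xi>) \<bullet> \<xi>) / (1 - t) + ((M *v \<eta>) \<bullet> \<eta>) / t"
proof -
  define b where "b = (M *v \<xi>) \<bullet> \<eta>"
  have b': "(M *v \<eta>) \<bullet> \<xi> = b"
    using transpose_matrix_vector[of M \<eta>] dot_lmul_matrix[of \<eta> M \<xi>] sym
    by (simp add: b_def inner_commute)
  have "0 \<le> (M *v (t *\<^sub>R \<xi> - (1 - t) *\<^sub>R \<eta>)) \<bullet> (t *\<^sub>R \<xi> - (1 - t) *\<^sub>R \<eta>)" by (rule psd)
  also have "\<dots> = t^2 * ((M *v \<xi>) \<bullet> \<xi>) + (1 - t)^2 * ((M *v \<eta>) \<bullet> \<eta>) - 2 * t * (1 - t) * b"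
    by (simp add: matrix_vector_mult_diff_distrib matrix_vector_mult_scaleR inner_diff_left inner_diff_right
        b' b_def[symmetric] power2_eq_square algebra_simps)
  finally have "2 * t * (1 - t) * b \<le> t^2 * ((M *v \<xi>) \<bullet> \<xi>) + (1 - t)^2 * ((M *v \<eta>) \<bullet> \<eta>)" by simp
  then have "(2 * t * (1 - t) * b) / (t * (1 - t))
     \<le> (t^2 * ((M *v \<xi>) \<bullet> \<xi>) + (1 - t)^2 * ((M *v \<eta>) \<bullet> \<eta>)) / (t * (1 - t))"
    using t by (intro divide_right_mono) auto
  moreover have "(2 * t * (1 - t) * b) / (t * (1 - t)) = 2 * b" using t by (simp add: field_simps)
  moreover have "(t^2 * ((M *v \<xi>) \<bullet> \<xi>) + (1 - t)^2 * ((M *v \<eta>) \<bullet> \<eta>)) / (t * (1 - t))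
     = ((M *v \<xi>) \<bullet> \<xi>) / (1 - t) - ((M *v \<xi>) \<bullet> \<xi>) + ((M *v \<eta>) \<bullet> \<eta>) / t - ((M *v \<eta>) \<bullet> \<eta>)"
    using t by (simp add: field_simps power2_eq_square)
  moreover have "(M *v (\<xi> + \<eta>)) \<bullet> (\<xi> + \<eta>) = ((M *v \<xi>) \<bullet> \<xi>) + ((M *v \<eta>) \<bullet> \<eta>) + 2 * b"
    by (simp add: matrix_vector_right_distrib inner_add_left inner_add_right b' b_def[symmetric])
  ultimately show ?thesis by linarith
qed

text \<open>The analogue of \<open>powr_add_le\<close> for the \<open>p\<close>-th power of the seminorm given by the form. Applying the convexity
  of the power \<open>p / 2\<close> after \<open>quadratic_form_add_le\<close> produces the same constants.\<close>

lemma quadratic_form_powr_add_le: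
  fixes M :: "real ^ 'n ^ 'n"
  assumes sym: "transpose M = M" and psd: "\<And>\<xi>. (M *v \<xi>) \<bullet> \<xi> \<ge> 0" and t: "0 < t" "t < 1" and p: "p \<ge> 2"
  shows "\<bar>(M *v (\<xi> + \<eta>)) \<bullet> (\<xi> + \<eta>)\<bar> powr (p / 2)
    \<le> (1 - t) powr (1 - p) * \<bar>(M *v \<xi>) \<bullet> \<xi>\<bar> powr (p / 2) + t powr (1 - p) * \<bar>(M *v \<eta>) \<bullet> \<eta>\<bar> powr (p / 2)"
proof -
  have s: "s powr (1 - p / 2) * (c / s) powr (p / 2) = s powr (1 - p) * c powr (p / 2)" if "s > 0" "c \<ge> 0" for s c :: real
    using that by (simp add: powr_divide powr_diff powr_add[symmetric])
  have "\<bar>(M *v (\<xi> + \<eta>)) \<bullet> (\<xi> + \<eta>)\<bar> powr (p / 2) \<le> (((M *v \<xi>) \<bullet> \<xi>) / (1 - t) + ((M *v \<eta>) \<bullet> \<eta>) / t) powr (p / 2)"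
    using quadratic_form_add_le[OF sym psd t] psd[of "\<xi> + \<eta>"] p by (intro powr_mono2) auto
  also have "\<dots> \<le> (1 - t) powr (1 - p / 2) * (((M *v \<xi>) \<bullet> \<xi>) / (1 - t)) powr (p / 2)
      + t powr (1 - p / 2) * (((M *v \<eta>) \<bullet> \<eta>) / t) powr (p / 2)"
    by (rule powr_add_le) (use t p psd in auto)
  finally show ?thesis using t psd by (simp add: s)
qed

locale elliptic_cylinder =
  fixes \<omega> :: "(real ^ 'm) set"
    and A :: "real ^ 'm \<Rightarrow> real ^ 'm option ^ 'm option"
    and p C lam :: real
  assumes bounded_\<omega>: "bounded \<omega>" and open_\<omega>: "open \<omega>"
    and A_sym: "\<And>X. X \<in> \<omega> \<Longrightarrow> transpose (A X) = A X"
    and A_meas: "\<And>i j. (\<lambda>X. A X $ i $ j) \<in> borel_measurable (lebesgue_on \<omega>)"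
    and C_pos: "C > 0" and lam_pos: "lam > 0"
    and A_bounded: "AE X in lebesgue_on \<omega>. onorm (\<lambda>\<xi>. A X *v \<xi>) \<le> C"
    and A_elliptic: "AE X in lebesgue_on \<omega>. \<forall>\<xi>. (A X *v \<xi>) \<bullet> \<xi> \<ge> lam * (norm \<xi>)\<^sup>2"
    and p_gt_2: "p > 2"
begin

definition energy_density :: "real ^ 'm option \<Rightarrow> real ^ 'm option \<Rightarrow> real" where
  "energy_density x \<xi> = \<bar>(A (X2 x) *v \<xi>) \<bullet> \<xi>\<bar> powr (p / 2)"

lemma energy_density_nonneg: "energy_density x \<xi> \<ge> 0"
  by (simp add: energy_density_def)

lemma energy_density_zero [simp]: "energy_density x 0 = 0"
  by (simp add: energy_density_def)

lemma energy_density_scaleR: "energy_density x (c *\<^sub>R \<xi>) = \<bar>c\<bar> powr p * energy_density x \<xi>"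
proof -
  have "energy_density x (c *\<^sub>R \<xi>) = (\<bar>c\<bar> powr 2 * \<bar>(A (X2 x) *v \<xi>) \<bullet> \<xi>\<bar>) powr (p / 2)"
    by (simp add: energy_density_def matrix_vector_mult_scaleR abs_mult power2_eq_square mult.assoc[symmetric])
  also have "\<dots> = \<bar>c\<bar> powr p * energy_density x \<xi>"
    by (simp add: powr_mult powr_powr energy_density_def del: powr_numeral)
  finally show ?thesis .
qed

text \<open>The infinite cylinder over the cross-section. Its test functions are those that approximate the
  functions vanishing on the lateral boundary, for all lengths simultaneously.\<close>

definition tube where "tube = {x. X2 x \<in> \<omega>}"

lemma open_tube: "open tube"
  using open_vimage[OF open_\<omega> continuous_X2] by (simp add: tube_def vimage_def)

lemma cylinder_subset_tube: "cylinder \<omega> l \<subseteq> tube"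
  by (auto simp: cylinder_def tube_def)

lemma AE_coefficient:
  "AE x in lebesgue. x \<in> tube \<longrightarrow> transpose (A (X2 x)) = A (X2 x) \<and> (\<forall>\<xi>. (A (X2 x) *v \<xi>) \<bullet> \<xi> \<ge> lam * (norm \<xi>)\<^sup>2)
     \<and> (\<forall>\<xi>. (A (X2 x) *v \<xi>) \<bullet> \<xi> \<le> C * (norm \<xi>)\<^sup>2)"
proof -
  have "AE X in lebesgue_on \<omega>. transpose (A X) = A X \<and> (\<forall>\<xi>. (A X *v \<xi>) \<bullet> \<xi> \<ge> lam * (norm \<xi>)\<^sup>2)
     \<and> (\<forall>\<xi>. (A X *v \<xi>) \<bullet> \<xi> \<le> C * (norm \<xi>)\<^sup>2)"
    using A_bounded A_elliptic AE_space
  proof eventually_elim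
    case (elim X)
    have "(A X *v \<xi>) \<bullet> \<xi> \<le> C * (norm \<xi>)\<^sup>2" for \<xi>
    proof -
      have "(A X *v \<xi>) \<bullet> \<xi> \<le> norm (A X *v \<xi>) * norm \<xi>" by (rule norm_cauchy_schwarz)
      also have "\<dots> \<le> (onorm (\<lambda>\<xi>. A X *v \<xi>) * norm \<xi>) * norm \<xi>"
        by (intro mult_right_mono onorm matrix_vector_mul_bounded_linear) auto
      also have "\<dots> \<le> (C * norm \<xi>) * norm \<xi>"
        by (intro mult_right_mono elim) auto
      finally show ?thesis by (simp add: power2_eq_square)
    qed
    then show ?case using elim A_sym by simp
  qed
  then have "AE X in lebesgue. X \<in> \<omega> \<longrightarrow> transpose (A X) = A X \<and> (\<forall>\<xi>. (A X *v \<xi>) \<bullet> \<xi> \<ge> lam * (norm \<xi>)\<^sup>2)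
     \<and> (\<forall>\<xi>. (A X *v \<xi>) \<bullet> \<xi> \<le> C * (norm \<xi>)\<^sup>2)"
    using open_\<omega> by (subst (asm) AE_restrict_space_iff) auto
  from AE_lebesgue_X2[OF this] show ?thesis by (simp add: tube_def)
qed

lemma form_nonneg: "(\<And>\<xi>. (M *v \<xi>) \<bullet> \<xi> \<ge> lam * (norm \<xi>)\<^sup>2) \<Longrightarrow> (M *v \<xi>) \<bullet> \<xi> \<ge> 0"
  using lam_pos by (meson mult_nonneg_nonneg order_trans less_imp_le zero_le_power2)

lemma AE_density_bounds:
  "AE x in lebesgue. x \<in> tube \<longrightarrow> (\<forall>\<xi>. lam powr (p / 2) * norm \<xi> powr p \<le> energy_density x \<xi>
      \<and> energy_density x \<xi> \<le> C powr (p / 2) * norm \<xi> powr p)"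
  using AE_coefficient
proof eventually_elim
  case (elim x)
  have "(c * (norm \<xi>)\<^sup>2) powr (p / 2) = c powr (p / 2) * norm \<xi> powr p" if "c > 0" for c and \<xi> :: "real ^ 'm option"
  proof -
    have "(norm \<xi>)\<^sup>2 = norm \<xi> powr 2" by simp
    then show ?thesis using that by (simp add: powr_mult powr_powr del: powr_numeral)
  qed
  note pw = this
  show ?case
  proof (intro impI allI conjI)
    fix \<xi> assume x: "x \<in> tube"
    have 0: "(A (X2 x) *v \<xi>) \<bullet> \<xi> \<ge> 0" using elim x by (intro form_nonneg) auto
    show "lam powr (p / 2) * norm \<xi> powr p \<le> energy_density x \<xi>"
      unfolding energy_density_def pw[OF lam_pos, symmetric] using elim x 0 lam_pos p_gt_2
      by (intro powr_mono2) auto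
    show "energy_density x \<xi> \<le> C powr (p / 2) * norm \<xi> powr p"
      unfolding energy_density_def pw[OF C_pos, symmetric] using elim x 0 p_gt_2
      by (intro powr_mono2) auto
  qed
qed

lemma AE_density_add_le:
  assumes "0 < t" "t < 1"
  shows "AE x in lebesgue. x \<in> tube \<longrightarrow> (\<forall>\<xi> \<eta>. energy_density x (\<xi> + \<eta>)
      \<le> (1 - t) powr (1 - p) * energy_density x \<xi> + t powr (1 - p) * energy_density x \<eta>)"
  using AE_coefficient
proof eventually_elim
  case (elim x)
  then show ?case
    unfolding energy_density_def using quadratic_form_powr_add_le[OF _ form_nonneg assms, of "A (X2 x)" p] p_gt_2 by auto
qed

text \<open>The coefficients are only Lebesgue measurable on the cross-section; composing them with the projection
  stays measurable because preimages of null sets under it are null.\<close>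

lemma borel_measurable_density:
  assumes \<Omega>: "\<Omega> \<in> sets lebesgue" "\<Omega> \<subseteq> tube" and G: "G \<in> borel_measurable (lebesgue_on \<Omega>)"
  shows "(\<lambda>x. energy_density x (G x)) \<in> borel_measurable (lebesgue_on \<Omega>)"
proof -
  have a: "(\<lambda>x. A (X2 x) $ i $ j) \<in> borel_measurable (lebesgue_on \<Omega>)" for i j
  proof -
    have "(\<lambda>X. if X \<in> \<omega> then A X $ i $ j else 0) \<in> borel_measurable lebesgue"
      using borel_measurable_if_I[OF A_meas[of i j]] open_\<omega> by auto
    from borel_measurable_lebesgue_X2[OF this]
    have "(\<lambda>x. if X2 x \<in> \<omega> then A (X2 x) $ i $ j else 0) \<in> borel_measurable (lebesgue_on \<Omega>)"
      by (rule measurable_restrict_space1)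
    then show ?thesis
      by (rule measurable_cong[THEN iffD1, rotated])
        (use \<Omega>(2) in \<open>auto simp: tube_def\<close>)
  qed
  have g: "(\<lambda>x. G x $ i) \<in> borel_measurable (lebesgue_on \<Omega>)" for i
    using G by (rule measurable_compose) (intro borel_measurable_continuous_onI continuous_intros)
  have "energy_density x (G x) = \<bar>\<Sum>i\<in>UNIV. (\<Sum>j\<in>UNIV. A (X2 x) $ i $ j * G x $ j) * G x $ i\<bar> powr (p / 2)" for x
    by (simp add: energy_density_def inner_vec_def matrix_vector_mult_def)
  then show ?thesis using a g by simp
qed

lemma integrable_density:
  assumes \<Omega>: "\<Omega> \<in> sets lebesgue" "\<Omega> \<subseteq> tube" and G: "G \<in> Lp \<Omega> p"
  shows "integrable (lebesgue_on \<Omega>) (\<lambda>x. energy_density x (G x))"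
proof (rule Bochner_Integration.integrable_bound)
  show "integrable (lebesgue_on \<Omega>) (\<lambda>x. C powr (p / 2) * norm (G x) powr p)"
    using G by (simp add: Lp_def)
  show "(\<lambda>x. energy_density x (G x)) \<in> borel_measurable (lebesgue_on \<Omega>)"
    using G by (intro borel_measurable_density \<Omega>) (simp add: Lp_def)
  have "AE x in lebesgue. x \<in> \<Omega> \<longrightarrow> norm (energy_density x (G x)) \<le> norm (C powr (p / 2) * norm (G x) powr p)"
    using AE_density_bounds by eventually_elim (use \<Omega>(2) in \<open>auto simp: energy_density_nonneg\<close>)
  then show "AE x in lebesgue_on \<Omega>. norm (energy_density x (G x)) \<le> norm (C powr (p / 2) * norm (G x) powr p)"
    using \<Omega>(1) by (subst AE_restrict_space_iff) auto
qed

lemma energy_eq: "energy A \<omega> p l u = integral\<^sup>L (lebesgue_on (cylinder \<omega> l)) (\<lambda>x. energy_density x (weak_gradient (cylinder \<omega> l) u x))"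
  by (simp add: energy_def energy_density_def)

lemma energy_nonneg: "energy A \<omega> p l u \<ge> 0" and mass_nonneg: "mass \<omega> p l u \<ge> 0"
  by (simp_all add: energy_def mass_def)

lemma cylinder_open_bounded: "open (cylinder \<omega> l)" "bounded (cylinder \<omega> l)" "cylinder \<omega> l \<in> sets lebesgue"
  using open_cylinder[OF open_\<omega>] bounded_cylinder[OF bounded_\<omega>] by auto

lemma p_ge_1: "p \<ge> 1" and p_pos: "p > 0" using p_gt_2 by auto

lemma AE_cylinderI: "AE x in lebesgue. x \<in> tube \<longrightarrow> P x \<Longrightarrow> AE x in lebesgue_on (cylinder \<omega> l). P x"
  using cylinder_subset_tube by (subst AE_restrict_space_iff) (auto simp: cylinder_open_bounded elim: eventually_mono)

text \<open>Energy is continuous along convergence of the modular, in the one-sided form that the density argument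
  uses: \<open>t\<close> is fixed first so that the leading factor is close to 1, then the modular is made small.\<close>

lemma energy_perturb:
  assumes u: "u \<in> W1p (cylinder \<omega> l) p" and v: "v \<in> W1p (cylinder \<omega> l) p" and t: "0 < t" "t < 1"
  shows "energy A \<omega> p l v \<le> (1 - t) powr (1 - p) * energy A \<omega> p l u
      + t powr (1 - p) * (C powr (p / 2) * W1p_modular (cylinder \<omega> l) p (u - v))"
proof -
  let ?M = "lebesgue_on (cylinder \<omega> l)" let ?g = "weak_gradient (cylinder \<omega> l)"
  have d: "u - v \<in> W1p (cylinder \<omega> l) p" "AE x in ?M. ?g (u - v) x = ?g u x - ?g v x"
    using W1p_diff[OF cylinder_open_bounded(1) p_ge_1 u v] by auto
  have i: "integrable ?M (\<lambda>x. energy_density x (?g w x))" "integrable ?M (\<lambda>x. norm (?g w x) powr p)"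
    if "w \<in> W1p (cylinder \<omega> l) p" for w
    using W1pD(3)[OF cylinder_open_bounded(1) that] integrable_density[OF cylinder_open_bounded(3) cylinder_subset_tube] by (auto simp: Lp_def)
  have "energy A \<omega> p l v \<le> integral\<^sup>L ?M (\<lambda>x. (1 - t) powr (1 - p) * energy_density x (?g u x)
      + t powr (1 - p) * (C powr (p / 2) * norm (?g (u - v) x) powr p))"
    unfolding energy_eq
  proof (rule integral_mono_AE[OF i(1)[OF v]])
    show "integrable ?M (\<lambda>x. (1 - t) powr (1 - p) * energy_density x (?g u x) + t powr (1 - p) * (C powr (p / 2) * norm (?g (u - v) x) powr p))"
      using i(1)[OF u] i(2)[OF d(1)] by simp
    show "AE x in ?M. energy_density x (?g v x) \<le> (1 - t) powr (1 - p) * energy_density x (?g u x) + t powr (1 - p) * (C powr (p / 2) * norm (?g (u - v) x) powr p)"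
      using d(2) AE_cylinderI[OF AE_density_add_le[OF t]] AE_cylinderI[OF AE_density_bounds]
    proof eventually_elim
      case (elim x)
      have e: "?g v x = ?g u x + (-1) *\<^sub>R ?g (u - v) x" using elim(1) by simp
      have "energy_density x (?g v x) \<le> (1 - t) powr (1 - p) * energy_density x (?g u x) + t powr (1 - p) * energy_density x ((-1) *\<^sub>R ?g (u - v) x)"
        using elim(2) e by metis
      also have "energy_density x ((-1) *\<^sub>R ?g (u - v) x) \<le> C powr (p / 2) * norm (?g (u - v) x) powr p"
        using elim(3) by (simp only: energy_density_scaleR) simp
      finally show ?case by (simp add: mult_left_mono)
    qed
  qed
  also have "\<dots> = (1 - t) powr (1 - p) * energy A \<omega> p l u
      + t powr (1 - p) * (C powr (p / 2) * integral\<^sup>L ?M (\<lambda>x. norm (?g (u - v) x) powr p))"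
    unfolding energy_eq using i(1)[OF u] i(2)[OF d(1)] by simp
  also have "\<dots> \<le> (1 - t) powr (1 - p) * energy A \<omega> p l u
      + t powr (1 - p) * (C powr (p / 2) * W1p_modular (cylinder \<omega> l) p (u - v))"
    by (intro add_left_mono mult_left_mono) (auto simp: W1p_modular_def)
  finally show ?thesis .
qed

lemma mass_perturb:
  assumes u: "u \<in> W1p (cylinder \<omega> l) p" and v: "v \<in> W1p (cylinder \<omega> l) p" and t: "0 < t" "t < 1"
  shows "mass \<omega> p l u \<le> (1 - t) powr (1 - p) * mass \<omega> p l v + t powr (1 - p) * W1p_modular (cylinder \<omega> l) p (u - v)"
proof -
  let ?M = "lebesgue_on (cylinder \<omega> l)"
  have i: "integrable ?M (\<lambda>x. \<bar>w x\<bar> powr p)" if "w \<in> W1p (cylinder \<omega> l) p" for w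
    using W1pD(1)[OF cylinder_open_bounded(1) that] by (auto simp: Lp_def)
  have d: "u - v \<in> W1p (cylinder \<omega> l) p" using W1p_diff[OF cylinder_open_bounded(1) p_ge_1 u v] by auto
  have "mass \<omega> p l u \<le> integral\<^sup>L ?M (\<lambda>x. (1 - t) powr (1 - p) * \<bar>v x\<bar> powr p + t powr (1 - p) * \<bar>(u - v) x\<bar> powr p)"
    unfolding mass_def
  proof (rule integral_mono[OF i[OF u]])
    show "integrable ?M (\<lambda>x. (1 - t) powr (1 - p) * \<bar>v x\<bar> powr p + t powr (1 - p) * \<bar>(u - v) x\<bar> powr p)"
      using i[OF v] i[OF d] by simp
    fix x
    have "\<bar>u x\<bar> powr p \<le> (\<bar>v x\<bar> + \<bar>(u - v) x\<bar>) powr p" using p_pos by (intro powr_mono2) auto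
    also have "\<dots> \<le> (1 - t) powr (1 - p) * \<bar>v x\<bar> powr p + t powr (1 - p) * \<bar>(u - v) x\<bar> powr p"
      by (rule powr_add_le) (use p_ge_1 t in auto)
    finally show "\<bar>u x\<bar> powr p \<le> (1 - t) powr (1 - p) * \<bar>v x\<bar> powr p + t powr (1 - p) * \<bar>(u - v) x\<bar> powr p" .
  qed
  also have "\<dots> = (1 - t) powr (1 - p) * mass \<omega> p l v + t powr (1 - p) * integral\<^sup>L ?M (\<lambda>x. \<bar>(u - v) x\<bar> powr p)"
    unfolding mass_def using i[OF v] i[OF d] by simp
  also have "\<dots> \<le> (1 - t) powr (1 - p) * mass \<omega> p l v + t powr (1 - p) * W1p_modular (cylinder \<omega> l) p (u - v)"
    by (intro add_left_mono mult_left_mono) (auto simp: W1p_modular_def)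
  finally show ?thesis .
qed

lemma test_function_W1p: "\<phi> \<in> test_functions T \<Longrightarrow> \<phi> \<in> W1p (cylinder \<omega> l) p"
  by (rule W1p_smooth[OF cylinder_open_bounded(1,2) p_ge_1]) (simp add: test_functions_def del: Ck.simps)

text \<open>The strict inequality leaves room first for the factor \<open>(1 - t) powr (1 - p)\<close>, which enters once through the
  energy and once through the mass, and then for the approximation error.\<close>

lemma exists_test_function_quotient:
  assumes u: "u \<in> Vspace \<omega> p l" and less: "energy A \<omega> p l u < \<Lambda> * mass \<omega> p l u"
  shows "\<exists>\<phi>\<in>test_functions tube. energy A \<omega> p l \<phi> < \<Lambda> * mass \<omega> p l \<phi>"
proof -
  let ?E = "energy A \<omega> p l u" and ?m = "mass \<omega> p l u"
  have \<Lambda>: "\<Lambda> > 0" and m: "?m > 0"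
    using less energy_nonneg[of l u] mass_nonneg[of l u] by (auto simp: zero_less_mult_iff dest: le_less_trans)
  have uW: "u \<in> W1p (cylinder \<omega> l) p" using u by (simp add: Vspace_def)
  have "((\<lambda>t. (1 - t) powr (1 - p) * ((1 - t) powr (1 - p) * ?E)) \<longlongrightarrow> (1 - 0) powr (1 - p) * ((1 - 0) powr (1 - p) * ?E)) (at_right 0)"
    by (intro tendsto_intros) auto
  then have "\<forall>\<^sub>F t in at_right 0. (1 - t) powr (1 - p) * ((1 - t) powr (1 - p) * ?E) < \<Lambda> * ?m"
    by (rule order_tendstoD(2)) (use less in simp)
  moreover have "\<forall>\<^sub>F t in at_right (0::real). t < 1 \<and> 0 < t"
    by (intro eventually_conj eventually_at_right_less) (auto intro!: eventually_at_rightI[of 0 1])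
  ultimately obtain t where t: "0 < t" "t < 1" "(1 - t) powr (1 - p) * ((1 - t) powr (1 - p) * ?E) < \<Lambda> * ?m"
    using eventually_happens[OF eventually_conj] trivial_limit_at_right_real by blast
  define k where "k = (1 - t) powr (1 - p)"
  define K where "K = t powr (1 - p)"
  have k: "k > 0" and K: "K > 0" using t by (auto simp: k_def K_def)
  have "((\<lambda>d. k * (k * ?E + K * (C powr (p / 2) * d)) + \<Lambda> * (K * d)) \<longlongrightarrow> k * (k * ?E + K * (C powr (p / 2) * 0)) + \<Lambda> * (K * 0)) (at_right 0)"
    by (intro tendsto_intros)
  then have "\<forall>\<^sub>F d in at_right 0. k * (k * ?E + K * (C powr (p / 2) * d)) + \<Lambda> * (K * d) < \<Lambda> * ?m"
    by (rule order_tendstoD(2)) (use t(3) in \<open>simp add: k_def\<close>)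
  moreover have "\<forall>\<^sub>F d in at_right (0::real). 0 < d" by (rule eventually_at_right_less)
  ultimately obtain d where d: "0 < d" "k * (k * ?E + K * (C powr (p / 2) * d)) + \<Lambda> * (K * d) < \<Lambda> * ?m"
    using eventually_happens[OF eventually_conj] trivial_limit_at_right_real by blast
  obtain \<phi> where \<phi>: "\<phi> \<in> test_functions tube" "W1p_norm (cylinder \<omega> l) p (u - \<phi>) < d powr (1 / p)"
    using u powr_gt_zero[of d "1 / p"] d(1) unfolding Vspace_def tube_def by blast
  have md: "W1p_modular (cylinder \<omega> l) p (u - \<phi>) \<le> d"
    using \<phi>(2) d(1) p_pos by (subst (asm) W1p_norm_less_iff) (auto simp: powr_powr)
  note \<phi>W = test_function_W1p[OF \<phi>(1), of l]
  have E: "energy A \<omega> p l \<phi> \<le> k * ?E + K * (C powr (p / 2) * d)"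
    using energy_perturb[OF uW \<phi>W t(1,2)] md K by (fold k_def K_def) (smt (verit) mult_left_mono powr_ge_zero)
  have M: "?m \<le> k * mass \<omega> p l \<phi> + K * d"
    using mass_perturb[OF uW \<phi>W t(1,2)] md K by (fold k_def K_def) (smt (verit) mult_left_mono)
  have "k * energy A \<omega> p l \<phi> + \<Lambda> * (K * d) < \<Lambda> * ?m"
    using E d(2) k by (smt (verit) mult_left_mono)
  also have "\<dots> \<le> \<Lambda> * (k * mass \<omega> p l \<phi> + K * d)" using M \<Lambda> by simp
  finally have "k * energy A \<omega> p l \<phi> < k * (\<Lambda> * mass \<omega> p l \<phi>)" by (simp add: algebra_simps)
  then show ?thesis using \<phi>(1) k by auto
qed

end

section \<open>Cutting a test function in the axial direction\<close>

lemma grad_mult: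
  assumes "Ck (Suc 0) f" "Ck (Suc 0) g"
  shows "grad (\<lambda>x. f x * g x) x = f x *\<^sub>R grad g x + g x *\<^sub>R grad f x"
  by (rule grad_eqI[OF has_derivative_mult[OF has_derivative_grad[OF assms(1)] has_derivative_grad[OF assms(2)]]])
     (simp add: inner_add_left)

lemma grad_linear_combination:
  assumes "Ck (Suc 0) f" "Ck (Suc 0) g"
  shows "grad (\<lambda>x. a * f x + c * g x) x = a *\<^sub>R grad f x + c *\<^sub>R grad g x"
  by (rule grad_eqI[OF has_derivative_add[OF has_derivative_mult_right[OF has_derivative_grad[OF assms(1)]]
        has_derivative_mult_right[OF has_derivative_grad[OF assms(2)]]]])
     (simp add: inner_add_left)

lemma grad_cong_open:
  assumes "Ck (Suc 0) f" "open U" "x \<in> U" "\<And>y. y \<in> U \<Longrightarrow> f y = g y"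
  shows "grad g x = grad f x"
proof (rule grad_eqI)
  show "(g has_derivative (\<lambda>h. grad f x \<bullet> h)) (at x)"
    by (rule has_derivative_transform_within_open[OF has_derivative_grad[OF assms(1)] assms(2,3)]) (rule assms(4))
qed simp

lemma grad_compose_isometry:
  assumes "Ck (Suc 0) f"
  shows "grad (\<lambda>x. f (s *\<^sub>R x + t)) x = s *\<^sub>R grad f (s *\<^sub>R x + t)"
proof (rule grad_eqI)
  show "((\<lambda>x. f (s *\<^sub>R x + t)) has_derivative (\<lambda>h. grad f (s *\<^sub>R x + t) \<bullet> (s *\<^sub>R h))) (at x)"
    by (rule has_derivative_compose[OF _ has_derivative_grad[OF assms]]) (auto intro!: derivative_eq_intros)
qed simp

lemma test_functions_Ck: "\<phi> \<in> test_functions \<Omega> \<Longrightarrow> Ck k \<phi>"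
  by (simp add: test_functions_def)

lemma test_functions_mult:
  assumes "\<phi> \<in> test_functions \<Omega>" "\<And>k. Ck k \<zeta>"
  shows "(\<lambda>x. \<phi> x * \<zeta> x) \<in> test_functions \<Omega>"
proof -
  obtain K where K: "\<And>k. Ck k \<phi>" "compact K" "K \<subseteq> \<Omega>" "\<And>x. x \<notin> K \<Longrightarrow> \<phi> x = 0"
    using test_functionsE[OF assms(1)] by metis
  show ?thesis by (rule test_functionsI[OF Ck_mult[OF K(1) assms(2)] K(2,3)]) (simp add: K(4))
qed

lemma test_functions_linear_combination:
  assumes "\<phi> \<in> test_functions \<Omega>" "\<psi> \<in> test_functions \<Omega>"
  shows "(\<lambda>x. a * \<phi> x + c * \<psi> x) \<in> test_functions \<Omega>"
proof -
  obtain K where K: "\<And>k. Ck k \<phi>" "compact K" "K \<subseteq> \<Omega>" "\<And>x. x \<notin> K \<Longrightarrow> \<phi> x = 0"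
    using test_functionsE[OF assms(1)] by metis
  obtain L where L: "\<And>k. Ck k \<psi>" "compact L" "L \<subseteq> \<Omega>" "\<And>x. x \<notin> L \<Longrightarrow> \<psi> x = 0"
    using test_functionsE[OF assms(2)] by metis
  show ?thesis
    by (rule test_functionsI[OF Ck_add[OF Ck_mult[OF Ck_const K(1)] Ck_mult[OF Ck_const L(1)]] compact_Un[OF K(2) L(2)]])
       (use K(3,4) L(3,4) in auto)
qed

lemma test_functions_compose_isometry:
  assumes \<phi>: "\<phi> \<in> test_functions \<Omega>" and s: "s = 1 \<or> s = -1" and \<Omega>: "\<And>x. s *\<^sub>R x + t \<in> \<Omega> \<Longrightarrow> x \<in> \<Omega>"
  shows "(\<lambda>x. \<phi> (s *\<^sub>R x + t)) \<in> test_functions \<Omega>"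
proof -
  obtain K where K: "\<And>k. Ck k \<phi>" "compact K" "K \<subseteq> \<Omega>" "\<And>x. x \<notin> K \<Longrightarrow> \<phi> x = 0"
    using test_functionsE[OF \<phi>] by metis
  have ss: "s * s = 1" using s by auto
  show ?thesis
  proof (rule test_functionsI[OF Ck_compose_affine[OF K(1)]])
    show "compact ((\<lambda>y. s *\<^sub>R (y - t)) ` K)"
      by (rule compact_continuous_image[OF _ K(2)]) (intro continuous_intros)
    show "(\<lambda>y. s *\<^sub>R (y - t)) ` K \<subseteq> \<Omega>"
    proof (rule image_subsetI)
      fix y assume "y \<in> K"
      then have "s *\<^sub>R (s *\<^sub>R (y - t)) + t \<in> \<Omega>" using K(3) ss by auto
      then show "s *\<^sub>R (y - t) \<in> \<Omega>" by (rule \<Omega>)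
    qed
    fix x assume x: "x \<notin> (\<lambda>y. s *\<^sub>R (y - t)) ` K"
    have "x = s *\<^sub>R ((s *\<^sub>R x + t) - t)" using ss by simp
    then have "s *\<^sub>R x + t \<notin> K" using x by blast
    then show "\<phi> (s *\<^sub>R x + t) = 0" by (rule K(4))
  qed
qed

text \<open>A step in the axial variable. The scaling confines the transition to \<open>[a + 1/4, a + 3/4]\<close>, so that on the closed
  complement of the slab \<open>a < x\<^sub>1 < a + 1\<close> the step is locally constant and gradients of products with it are
  unaffected there.\<close>

definition axial_step :: "real \<Rightarrow> real ^ ('m::finite) option \<Rightarrow> real" where
  "axial_step a x = smooth_step (2 * (x $ None - a) - 1 / 2)"

lemma axial_step_altdef: "axial_step a = (\<lambda>x. smooth_step (2 *\<^sub>R (x \<bullet> axis None 1) + (- 2 * a - 1 / 2)))"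
  by (simp add: axial_step_def fun_eq_iff inner_axis algebra_simps)

lemma Ck_axial_step: "Ck k (axial_step a)"
  unfolding axial_step_altdef using Ck_compose_inner[OF Ck_compose_affine[OF Ck_smooth_step]] .

lemma axial_step_eq_0: "x $ None \<le> a + 1/4 \<Longrightarrow> axial_step a x = 0"
  and axial_step_eq_1: "x $ None \<ge> a + 3/4 \<Longrightarrow> axial_step a x = 1"
  and axial_step_nonneg: "axial_step a x \<ge> 0" and axial_step_le_1: "axial_step a x \<le> 1"
  by (auto simp: axial_step_def smooth_step_nonneg smooth_step_le_1 intro!: smooth_step_eq_0 smooth_step_eq_1)

text \<open>All steps are translates of one profile, whose derivative is continuous with compact support.\<close>

lemma grad_axial_step_bounded: "\<exists>M>0. \<forall>a. \<forall>x :: real ^ ('m::finite) option. norm (grad (axial_step a) x) \<le> M"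
proof -
  define D where "D y = frechet_derivative smooth_step (at y) 1" for y
  have D: "(smooth_step has_derivative (\<lambda>h. h * D y)) (at y)" for y
  proof -
    have "frechet_derivative smooth_step (at y) h = h * D y" for h
      using linear_cmul[OF has_derivative_linear[OF Ck_SucD(1)[OF Ck_smooth_step]], of y h 1] by (simp add: D_def)
    then show ?thesis using Ck_SucD(1)[OF Ck_smooth_step, of y] by presburger
  qed
  have "continuous_on UNIV D"
    using Ck_imp_continuous[OF Ck_SucD(2)[OF Ck_smooth_step, of 1]] by (simp add: D_def[abs_def])
  moreover have "D y = 0" if y: "y \<notin> {0..1}" for y
  proof -
    have "(smooth_step has_derivative (\<lambda>_. 0)) (at y)"
    proof (cases "y < 0")
      case True
      show ?thesis
        by (rule has_derivative_transform_within_open[of "\<lambda>_. 0" _ _ _ "{..<0}"]) (use True in \<open>auto simp: smooth_step_eq_0\<close>)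
    next
      case False
      show ?thesis
        by (rule has_derivative_transform_within_open[of "\<lambda>_. 1" _ _ _ "{1<..}"]) (use False y in \<open>auto simp: smooth_step_eq_1\<close>)
    qed
    from frechet_derivative_at[OF this] show ?thesis by (simp add: D_def fun_eq_iff)
  qed
  ultimately have "\<exists>M>0. \<forall>y. norm (D y) \<le> M"
    by (intro bounded_continuous_compact_support[of D "{0..1}"]) auto
  then obtain M where M: "M > 0" "\<And>y. \<bar>D y\<bar> \<le> M" by auto
  have "norm (grad (axial_step a) x) \<le> 2 * M" for a and x :: "real ^ ('m::finite) option"
  proof -
    define y where "y = 2 * (x $ None - a) - 1 / 2"
    have "grad (axial_step a) x = (2 * D y) *\<^sub>R axis None 1"
    proof (rule grad_eqI)
      have "((\<lambda>x :: real ^ ('m::finite) option. 2 * (x \<bullet> axis None 1 - a) - 1 / 2) has_derivative (\<lambda>h. 2 * (h \<bullet> axis None 1))) (at x)"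
        by (auto intro!: derivative_eq_intros)
      from has_derivative_compose[OF this D]
      show "(axial_step a has_derivative (\<lambda>h. 2 * (h \<bullet> axis None 1) * D y)) (at x)"
        by (simp add: axial_step_def[abs_def] inner_axis y_def)
    qed (simp add: inner_commute)
    then show ?thesis using M(2)[of y] by (simp add: abs_mult)
  qed
  then show ?thesis using M(1) by (intro exI[of _ "2 * M"]) auto
qed

context elliptic_cylinder
begin

text \<open>Classical energy, mass and gradient mass of the part of a function whose axial coordinate lies in \<open>I\<close>. They
  are written over the whole space, with an indicator of the axial coordinate only: test functions on the
  tube vanish elsewhere, and translation and reflection then act on \<open>I\<close> alone.\<close>

definition energy_on :: "real set \<Rightarrow> (real ^ 'm option \<Rightarrow> real) \<Rightarrow> real" where
  "energy_on I v = (\<integral>x. indicator I (x $ None) * energy_density x (grad v x) \<partial>lebesgue)"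

definition mass_on :: "real set \<Rightarrow> (real ^ 'm option \<Rightarrow> real) \<Rightarrow> real" where
  "mass_on I v = (\<integral>x. indicator I (x $ None) * \<bar>v x\<bar> powr p \<partial>lebesgue)"

definition grad_mass_on :: "real set \<Rightarrow> (real ^ 'm option \<Rightarrow> real) \<Rightarrow> real" where
  "grad_mass_on I v = (\<integral>x. indicator I (x $ None) * norm (grad v x) powr p \<partial>lebesgue)"

lemma test_function_vanishes:
  assumes "v \<in> test_functions tube" "x \<notin> tube" shows "v x = 0" and "grad v x = 0"
proof -
  obtain K where K: "compact K" "K \<subseteq> tube" "\<And>x. x \<notin> K \<Longrightarrow> v x = 0"
    using test_functionsE[OF assms(1)] by metis
  have x: "x \<notin> K" using K(2) assms(2) by blast
  show "v x = 0" using K(3) x by blast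
  show "grad v x = 0" by (rule grad_eq_0_off_support[OF compact_imp_closed[OF K(1)] _ x]) (rule K(3))
qed

lemma integrable_test:
  assumes v: "v \<in> test_functions tube"
  shows "integrable lebesgue (\<lambda>x. energy_density x (grad v x))"
    and "integrable lebesgue (\<lambda>x. \<bar>v x\<bar> powr p)"
    and "integrable lebesgue (\<lambda>x. norm (grad v x) powr p)"
proof -
  obtain K where K: "compact K" "K \<subseteq> tube" "\<And>x. x \<notin> K \<Longrightarrow> v x = 0"
    using test_functionsE[OF v] by metis
  have gK: "grad v x = 0" if "x \<notin> K" for x
    by (rule grad_eq_0_off_support[OF compact_imp_closed[OF K(1)] _ that]) (rule K(3))
  have cv: "continuous_on UNIV v" "continuous_on UNIV (grad v)"
    by (rule Ck_imp_continuous[OF test_functions_Ck[OF v]], rule continuous_on_grad[OF test_functions_Ck[OF v]])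
  have tube: "tube \<in> sets lebesgue" using open_tube by auto
  have cp: "continuous_on UNIV (\<lambda>x. \<bar>v x\<bar> powr p)" "continuous_on UNIV (\<lambda>x. norm (grad v x) powr p)"
    by (intro continuous_on_powr' continuous_on_rabs continuous_on_norm cv continuous_on_const; use p_pos in simp)+
  show "integrable lebesgue (\<lambda>x. \<bar>v x\<bar> powr p)"
    by (rule integrable_continuous_compact_support[OF cp(1) compact_imp_bounded[OF K(1)]]) (simp add: K(3))
  show h: "integrable lebesgue (\<lambda>x. norm (grad v x) powr p)"
    by (rule integrable_continuous_compact_support[OF cp(2) compact_imp_bounded[OF K(1)]]) (simp add: gK)
  have "grad v \<in> Lp tube p"
    unfolding Lp_def
  proof (intro CollectI conjI)
    show "grad v \<in> borel_measurable (lebesgue_on tube)"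
      by (intro measurable_restrict_space1 borel_measurable_lebesgue_continuous cv)
    show "integrable (lebesgue_on tube) (\<lambda>x. norm (grad v x) powr p)"
      by (subst integral_lebesgue_on_vanishing_outside(2)[OF tube _]) (use h test_function_vanishes(2)[OF v] in auto)
  qed
  then have "integrable (lebesgue_on tube) (\<lambda>x. energy_density x (grad v x))" by (intro integrable_density tube) auto
  then show "integrable lebesgue (\<lambda>x. energy_density x (grad v x))"
    by (subst (asm) integral_lebesgue_on_vanishing_outside(2)[OF tube _]) (use test_function_vanishes(2)[OF v] in auto)
qed

lemma integrable_indicator_axial:
  fixes f :: "real ^ 'm option \<Rightarrow> real"
  assumes "integrable lebesgue f"
  shows "integrable lebesgue (\<lambda>x. indicator {a<..<b} (x $ None) * f x)"
proof -
  have "open {x :: real ^ 'm option. x $ None \<in> {a<..<b}}"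
    by (simp add: open_Collect_conj open_Collect_less continuous_intros)
  then have "integrable lebesgue (\<lambda>x. indicator {x. x $ None \<in> {a<..<b}} x *\<^sub>R f x)"
    by (intro integrable_mult_indicator assms) auto
  then show ?thesis by (simp add: indicator_def of_bool_def)
qed

lemmas integrable_test_on = integrable_test[THEN integrable_indicator_axial]

text \<open>On test functions the chosen weak gradient is the classical one, so the energy is a classical integral.\<close>

lemma energy_test:
  assumes v: "v \<in> test_functions tube" shows "energy A \<omega> p l v = energy_on {-l<..<l} v"
proof -
  have "energy A \<omega> p l v = (\<integral>x. energy_density x (grad v x) \<partial>lebesgue_on (cylinder \<omega> l))"
    unfolding energy_eq
  proof (rule integral_cong_AE)
    have ae: "AE x in lebesgue_on (cylinder \<omega> l). weak_gradient (cylinder \<omega> l) v x = grad v x"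
      by (rule W1p_smooth(2)[OF cylinder_open_bounded(1,2) p_ge_1 test_functions_Ck[OF v]])
    then show "AE x in lebesgue_on (cylinder \<omega> l). energy_density x (weak_gradient (cylinder \<omega> l) v x) = energy_density x (grad v x)"
      by eventually_elim simp
    show "(\<lambda>x. energy_density x (weak_gradient (cylinder \<omega> l) v x)) \<in> borel_measurable (lebesgue_on (cylinder \<omega> l))"
      using W1pD(3)[OF cylinder_open_bounded(1) test_function_W1p[OF v]]
      by (intro borel_measurable_density cylinder_open_bounded cylinder_subset_tube) (auto simp: Lp_def)
    show "(\<lambda>x. energy_density x (grad v x)) \<in> borel_measurable (lebesgue_on (cylinder \<omega> l))"
      by (intro measurable_restrict_space1 borel_measurable_integrable integrable_test v)
  qed
  also have "\<dots> = (\<integral>x. indicator (cylinder \<omega> l) x *\<^sub>R energy_density x (grad v x) \<partial>lebesgue)"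
    using cylinder_open_bounded by (intro integral_restrict_space) auto
  also have "\<dots> = energy_on {-l<..<l} v"
    unfolding energy_on_def
    by (intro Bochner_Integration.integral_cong refl)
       (use test_function_vanishes(2)[OF v] in \<open>auto simp: cylinder_def indicator_def tube_def\<close>)
  finally show ?thesis .
qed

lemma mass_test:
  assumes v: "v \<in> test_functions tube" shows "mass \<omega> p l v = mass_on {-l<..<l} v"
proof -
  have "mass \<omega> p l v = (\<integral>x. indicator (cylinder \<omega> l) x *\<^sub>R \<bar>v x\<bar> powr p \<partial>lebesgue)"
    unfolding mass_def using cylinder_open_bounded by (intro integral_restrict_space) auto
  also have "\<dots> = mass_on {-l<..<l} v"
    unfolding mass_on_def
    by (intro Bochner_Integration.integral_cong refl)
       (use test_function_vanishes(1)[OF v] in \<open>auto simp: cylinder_def indicator_def tube_def\<close>)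
  finally show ?thesis .
qed

lemma grad_mass_on_le:
  assumes v: "v \<in> test_functions tube"
  shows "lam powr (p / 2) * grad_mass_on {a<..<b} v \<le> energy_on {a<..<b} v"
proof -
  have "lam powr (p / 2) * grad_mass_on {a<..<b} v
     = (\<integral>x. lam powr (p / 2) * (indicator {a<..<b} (x $ None) * norm (grad v x) powr p) \<partial>lebesgue)"
    unfolding grad_mass_on_def using integrable_test_on(3)[OF v] by simp
  also have "\<dots> \<le> energy_on {a<..<b} v"
    unfolding energy_on_def
  proof (rule integral_mono_AE[OF integrable_mult_right[OF integrable_test_on(3)[OF v]] integrable_test_on(1)[OF v]])
    show "AE x in lebesgue. lam powr (p / 2) * (indicator {a<..<b} (x $ None) * norm (grad v x) powr p)
       \<le> indicator {a<..<b} (x $ None) * energy_density x (grad v x)"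
      using AE_density_bounds
      by eventually_elim (use test_function_vanishes(2)[OF v] p_pos in \<open>auto simp: indicator_def\<close>)
  qed
  finally show ?thesis .
qed

lemma energy_density_grad_mult_le:
  assumes M: "M \<ge> 0"
  shows "\<exists>K>0. \<forall>\<phi>\<in>test_functions tube. \<forall>\<zeta>. Ck (Suc 0) \<zeta> \<longrightarrow> (\<forall>x. \<bar>\<zeta> x\<bar> \<le> 1 \<and> norm (grad \<zeta> x) \<le> M) \<longrightarrow>
    (AE x in lebesgue. energy_density x (grad (\<lambda>x. \<phi> x * \<zeta> x) x) \<le> K * (\<bar>\<phi> x\<bar> powr p + norm (grad \<phi> x) powr p))"
proof -
  define K where "K = C powr (p / 2) * (2 powr p * (M powr p + 1))"
  have K: "K > 0" using C_pos by (simp add: K_def add_nonneg_pos)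
  have "AE x in lebesgue. energy_density x (grad (\<lambda>x. \<phi> x * \<zeta> x) x) \<le> K * (\<bar>\<phi> x\<bar> powr p + norm (grad \<phi> x) powr p)"
    if \<phi>: "\<phi> \<in> test_functions tube" and \<zeta>: "Ck (Suc 0) \<zeta>" "\<And>x. \<bar>\<zeta> x\<bar> \<le> 1" "\<And>x. norm (grad \<zeta> x) \<le> M" for \<phi> \<zeta>
    using AE_density_bounds
  proof eventually_elim
    case (elim x)
    note g = grad_mult[OF test_functions_Ck[OF \<phi>] \<zeta>(1), of x]
    show ?case
    proof (cases "x \<in> tube")
      case True
      have "norm (grad (\<lambda>x. \<phi> x * \<zeta> x) x) powr p
         \<le> 2 powr p * (\<bar>\<phi> x\<bar> powr p * norm (grad \<zeta> x) powr p + \<bar>\<zeta> x\<bar> powr p * norm (grad \<phi> x) powr p)"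
        unfolding g by (rule norm_add_powr_le[OF p_ge_1])
      also have "\<dots> \<le> 2 powr p * (\<bar>\<phi> x\<bar> powr p * M powr p + 1 powr p * norm (grad \<phi> x) powr p)"
        using \<zeta>(2)[of x] \<zeta>(3)[of x] p_pos
        by (intro mult_left_mono add_mono mult_right_mono powr_mono2) auto
      also have "\<dots> \<le> 2 powr p * ((M powr p + 1) * (\<bar>\<phi> x\<bar> powr p + norm (grad \<phi> x) powr p))"
        by (intro mult_left_mono) (auto simp: algebra_simps)
      finally have "C powr (p / 2) * norm (grad (\<lambda>x. \<phi> x * \<zeta> x) x) powr p \<le> K * (\<bar>\<phi> x\<bar> powr p + norm (grad \<phi> x) powr p)"
        unfolding K_def mult.assoc by (intro mult_left_mono) auto
      then show ?thesis using elim True by (meson order_trans)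
    next
      case False
      then show ?thesis using K by (simp add: g test_function_vanishes[OF \<phi> False])
    qed
  qed
  then show ?thesis using K by (intro exI[of _ K] conjI ballI allI impI) auto
qed

text \<open>Pigeonhole over the \<open>N\<close> disjoint unit slabs that start at \<open>-l, -l + 1, \<dots>\<close>; they fit because \<open>N \<le> 2 l\<close>.\<close>

lemma exists_thin_strip:
  assumes v: "v \<in> test_functions tube" and N: "N > 0" "real N \<le> 2 * l"
  shows "\<exists>a. -l \<le> a \<and> a + 1 \<le> l \<and> mass_on {a<..<a+1} v + grad_mass_on {a<..<a+1} v
     \<le> (mass_on {-l<..<l} v + grad_mass_on {-l<..<l} v) / real N"
proof (rule ccontr)
  define F where "F a b = mass_on {a<..<b} v + grad_mass_on {a<..<b} v" for a b
  define f where "f x = \<bar>v x\<bar> powr p + norm (grad v x) powr p" for x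
  have f: "integrable lebesgue f" unfolding f_def using integrable_test[OF v] by simp
  have F: "F a b = (\<integral>x. indicator {a<..<b} (x $ None) * f x \<partial>lebesgue)" for a b
    unfolding F_def mass_on_def grad_mass_on_def f_def using integrable_test_on[OF v]
    by (simp add: distrib_left)
  assume "\<not> ?thesis"
  then have gr: "F (-l + real i) (-l + real i + 1) > F (-l) l / real N" if "i < N" for i
    using that N unfolding F_def by (force simp: not_le dest!: spec[of _ "-l + real i"])
  have "F (-l) l = (\<Sum>i<N. F (-l) l / real N)" using N by simp
  also have "\<dots> < (\<Sum>i<N. F (-l + real i) (-l + real i + 1))"
    using N by (intro sum_strict_mono gr) auto
  also have "\<dots> = (\<integral>x. (\<Sum>i<N. indicator {-l + real i<..<-l + real i + 1} (x $ None) * f x) \<partial>lebesgue)"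
    unfolding F by (intro Bochner_Integration.integral_sum[symmetric] integrable_indicator_axial f)
  also have "\<dots> \<le> F (-l) l"
    unfolding F
  proof (intro integral_mono Bochner_Integration.integrable_sum integrable_indicator_axial f)
    fix x :: "real ^ 'm option"
    let ?J = "\<lambda>i. {-l + real i<..<-l + real i + 1}"
    have "disjoint_family_on ?J {..<N}"
      by (auto simp: disjoint_family_on_def)
    then have "(\<Sum>i<N. indicator (?J i) (x $ None)) = (indicator (\<Union>i<N. ?J i) (x $ None) :: real)"
      by (intro indicator_UN_disjoint[symmetric]) auto
    also have "\<dots> \<le> indicator {-l<..<l} (x $ None)"
      using N(2) by (auto simp: indicator_def)
    finally show "(\<Sum>i<N. indicator (?J i) (x $ None) * f x) \<le> indicator {-l<..<l} (x $ None) * f x"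
      unfolding sum_distrib_right[symmetric] by (intro mult_right_mono) (auto simp: f_def)
  qed
  finally show False by simp
qed

text \<open>Outside the slab one of the two pieces is 0 and the other one is \<open>\<phi>\<close>, so energies and masses simply add
  up. Inside the slab the energy of each piece is controlled by the mass and gradient mass of \<open>\<phi>\<close>.\<close>

lemma axial_step_energy_mass:
  "\<exists>K>0. \<forall>\<phi>\<in>test_functions tube. \<forall>a l.
     energy_on {-l<..<l} (\<lambda>x. \<phi> x * axial_step a x) + energy_on {-l<..<l} (\<lambda>x. \<phi> x * (1 - axial_step a x))
       \<le> energy_on {-l<..<l} \<phi> + K * (mass_on {a<..<a+1} \<phi> + grad_mass_on {a<..<a+1} \<phi>)
     \<and> mass_on {-l<..<l} \<phi> - mass_on {a<..<a+1} \<phi>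
       \<le> mass_on {-l<..<l} (\<lambda>x. \<phi> x * axial_step a x) + mass_on {-l<..<l} (\<lambda>x. \<phi> x * (1 - axial_step a x))"
proof -
  obtain M where M: "M > 0" "\<And>a. \<And>x :: real ^ 'm option. norm (grad (axial_step a) x) \<le> M"
    using grad_axial_step_bounded by blast
  obtain K where K: "K > 0" "\<And>\<phi> \<zeta>. \<phi> \<in> test_functions tube \<Longrightarrow> Ck (Suc 0) \<zeta> \<Longrightarrow> (\<And>x. \<bar>\<zeta> x\<bar> \<le> 1 \<and> norm (grad \<zeta> x) \<le> M) \<Longrightarrow>
    (AE x in lebesgue. energy_density x (grad (\<lambda>x. \<phi> x * \<zeta> x) x) \<le> K * (\<bar>\<phi> x\<bar> powr p + norm (grad \<phi> x) powr p))"
    using energy_density_grad_mult_le[of M] M(1) by (meson less_imp_le)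
  have c1: "Ck k (\<lambda>x. 1 - axial_step a x)" for k a by (intro Ck_diff Ck_const Ck_axial_step)
  have g1: "grad (\<lambda>x. 1 - axial_step a x) x = - grad (axial_step a) x" for a and x :: "real ^ 'm option"
    using grad_linear_combination[OF Ck_const Ck_axial_step, of 1 1 "-1" a x]
      grad_eqI[of "\<lambda>_. 1::real" "\<lambda>_. 0" x 0] by simp
  have "energy_on {-l<..<l} (\<lambda>x. \<phi> x * axial_step a x) + energy_on {-l<..<l} (\<lambda>x. \<phi> x * (1 - axial_step a x))
       \<le> energy_on {-l<..<l} \<phi> + 2 * K * (mass_on {a<..<a+1} \<phi> + grad_mass_on {a<..<a+1} \<phi>)
     \<and> mass_on {-l<..<l} \<phi> - mass_on {a<..<a+1} \<phi>
       \<le> mass_on {-l<..<l} (\<lambda>x. \<phi> x * axial_step a x) + mass_on {-l<..<l} (\<lambda>x. \<phi> x * (1 - axial_step a x))"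
    if \<phi>: "\<phi> \<in> test_functions tube" for \<phi> a l
  proof
    let ?v = "\<lambda>x. \<phi> x * axial_step a x" and ?w = "\<lambda>x. \<phi> x * (1 - axial_step a x)"
    have v: "?v \<in> test_functions tube" and w: "?w \<in> test_functions tube"
      using test_functions_mult[OF \<phi>, of "axial_step a"] test_functions_mult[OF \<phi>, of "\<lambda>x. 1 - axial_step a x"] c1 Ck_axial_step by auto
    have z: "grad (\<lambda>_. 0) x = 0" for x :: "real ^ 'm option" by (rule grad_eqI[of _ "\<lambda>_. 0"]) auto
    have left: "grad ?v x = 0 \<and> grad ?w x = grad \<phi> x" if "x $ None \<le> a" for x
    proof -
      have U: "open {x :: real ^ 'm option. x $ None < a + 1/4}" by (intro open_Collect_less continuous_intros)
      have "grad ?v x = grad (\<lambda>_. 0) x"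
        by (rule grad_cong_open[OF Ck_const U]) (use that in \<open>auto simp: axial_step_eq_0\<close>)
      moreover have "grad ?w x = grad \<phi> x"
        by (rule grad_cong_open[OF test_functions_Ck[OF \<phi>] U]) (use that in \<open>auto simp: axial_step_eq_0\<close>)
      ultimately show ?thesis by (simp add: z)
    qed
    have right: "grad ?v x = grad \<phi> x \<and> grad ?w x = 0" if "x $ None \<ge> a + 1" for x
    proof -
      have U: "open {x :: real ^ 'm option. a + 3/4 < x $ None}" by (intro open_Collect_less continuous_intros)
      have "grad ?w x = grad (\<lambda>_. 0) x"
        by (rule grad_cong_open[OF Ck_const U]) (use that in \<open>auto simp: axial_step_eq_1\<close>)
      moreover have "grad ?v x = grad \<phi> x"
        by (rule grad_cong_open[OF test_functions_Ck[OF \<phi>] U]) (use that in \<open>auto simp: axial_step_eq_1\<close>)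
      ultimately show ?thesis by (simp add: z)
    qed
    let ?f = "\<lambda>x. \<bar>\<phi> x\<bar> powr p + norm (grad \<phi> x) powr p"
    have "energy_on {-l<..<l} ?v + energy_on {-l<..<l} ?w
       = (\<integral>x. indicator {-l<..<l} (x $ None) * energy_density x (grad ?v x) + indicator {-l<..<l} (x $ None) * energy_density x (grad ?w x) \<partial>lebesgue)"
      unfolding energy_on_def using integrable_test_on(1)[OF v] integrable_test_on(1)[OF w] by simp
    also have "\<dots> \<le> (\<integral>x. indicator {-l<..<l} (x $ None) * energy_density x (grad \<phi> x)
         + 2 * K * (indicator {a<..<a+1} (x $ None) * \<bar>\<phi> x\<bar> powr p + indicator {a<..<a+1} (x $ None) * norm (grad \<phi> x) powr p) \<partial>lebesgue)"
    proof (rule integral_mono_AE)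
      have "AE x in lebesgue. energy_density x (grad ?v x) \<le> K * ?f x"
      proof (rule K(2)[OF \<phi> Ck_axial_step])
        show "\<bar>axial_step a x\<bar> \<le> 1 \<and> norm (grad (axial_step a) x) \<le> M" for x :: "real ^ 'm option"
          using M(2)[of a x] axial_step_nonneg[of a x] axial_step_le_1[of a x] by auto
      qed
      moreover have "AE x in lebesgue. energy_density x (grad ?w x) \<le> K * ?f x"
      proof (rule K(2)[OF \<phi> c1])
        show "\<bar>1 - axial_step a x\<bar> \<le> 1 \<and> norm (grad (\<lambda>x. 1 - axial_step a x) x) \<le> M" for x :: "real ^ 'm option"
          using M(2)[of a x] axial_step_nonneg[of a x] axial_step_le_1[of a x] by (auto simp: g1)
      qed
      ultimately show "AE x in lebesgue. indicator {-l<..<l} (x $ None) * energy_density x (grad ?v x) + indicator {-l<..<l} (x $ None) * energy_density x (grad ?w x)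
         \<le> indicator {-l<..<l} (x $ None) * energy_density x (grad \<phi> x)
         + 2 * K * (indicator {a<..<a+1} (x $ None) * \<bar>\<phi> x\<bar> powr p + indicator {a<..<a+1} (x $ None) * norm (grad \<phi> x) powr p)"
      proof eventually_elim
        case (elim x)
        consider "x $ None \<le> a" | "x $ None \<ge> a + 1" | "x $ None \<in> {a<..<a+1}" by fastforce
        then show ?case
        proof cases
          case 3
          have "0 \<le> 2 * K * ?f x" using K(1) by simp
          then show ?thesis
            using elim energy_density_nonneg[of x "grad \<phi> x"] 3 by (auto simp: indicator_def algebra_simps)
        qed (use left right in auto)
      qed
    qed (use integrable_test_on[OF v] integrable_test_on[OF w] integrable_test_on[OF \<phi>] in simp_all)
    also have "\<dots> = energy_on {-l<..<l} \<phi> + 2 * K * (mass_on {a<..<a+1} \<phi> + grad_mass_on {a<..<a+1} \<phi>)"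
      unfolding energy_on_def mass_on_def grad_mass_on_def using integrable_test_on[OF \<phi>] by simp
    finally show "energy_on {-l<..<l} ?v + energy_on {-l<..<l} ?w
       \<le> energy_on {-l<..<l} \<phi> + 2 * K * (mass_on {a<..<a+1} \<phi> + grad_mass_on {a<..<a+1} \<phi>)" .
    have "mass_on {-l<..<l} \<phi> - mass_on {a<..<a+1} \<phi>
       = (\<integral>x. indicator {-l<..<l} (x $ None) * \<bar>\<phi> x\<bar> powr p - indicator {a<..<a+1} (x $ None) * \<bar>\<phi> x\<bar> powr p \<partial>lebesgue)"
      unfolding mass_on_def using integrable_test_on(2)[OF \<phi>] by simp
    also have "\<dots> \<le> (\<integral>x. indicator {-l<..<l} (x $ None) * \<bar>?v x\<bar> powr p + indicator {-l<..<l} (x $ None) * \<bar>?w x\<bar> powr p \<partial>lebesgue)"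
    proof (rule integral_mono)
      fix x :: "real ^ 'm option"
      consider "x $ None \<le> a" | "x $ None \<ge> a + 1" | "x $ None \<in> {a<..<a+1}" by fastforce
      then show "indicator {-l<..<l} (x $ None) * \<bar>\<phi> x\<bar> powr p - indicator {a<..<a+1} (x $ None) * \<bar>\<phi> x\<bar> powr p
         \<le> indicator {-l<..<l} (x $ None) * \<bar>?v x\<bar> powr p + indicator {-l<..<l} (x $ None) * \<bar>?w x\<bar> powr p"
      proof cases
        case 3
        then have "indicator {-l<..<l} (x $ None) * \<bar>\<phi> x\<bar> powr p - indicator {a<..<a+1} (x $ None) * \<bar>\<phi> x\<bar> powr p \<le> 0"
          by (auto simp: indicator_def)
        also have "0 \<le> indicator {-l<..<l} (x $ None) * \<bar>?v x\<bar> powr p + indicator {-l<..<l} (x $ None) * \<bar>?w x\<bar> powr p"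
          by simp
        finally show ?thesis .
      qed (auto simp: axial_step_eq_0 axial_step_eq_1)
    qed (use integrable_test_on[OF v] integrable_test_on[OF w] integrable_test_on[OF \<phi>] in simp_all)
    also have "\<dots> = mass_on {-l<..<l} ?v + mass_on {-l<..<l} ?w"
      unfolding mass_on_def using integrable_test_on(2)[OF v] integrable_test_on(2)[OF w] by simp
    finally show "mass_on {-l<..<l} \<phi> - mass_on {a<..<a+1} \<phi> \<le> mass_on {-l<..<l} ?v + mass_on {-l<..<l} ?w" .
  qed
  then show ?thesis using K(1) by (intro exI[of _ "2 * K"] conjI ballI allI) auto
qed

end

section \<open>Almost minimizers at the two ends\<close>

locale symmetric_elliptic_cylinder = elliptic_cylinder \<omega> A p C lam
  for \<omega> :: "(real ^ 'm) set" and A :: "real ^ 'm \<Rightarrow> real ^ 'm option ^ 'm option" and p C lam :: real +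
  assumes \<omega>_sym: "uminus ` \<omega> = \<omega>" and A_even: "\<And>X. X \<in> \<omega> \<Longrightarrow> A (- X) = A X"
begin

text \<open>Axial translations leave the cross-section alone, and \<open>x \<mapsto> -x\<close> acts on it as \<open>X \<mapsto> -X\<close>, under which the
  domain and the coefficients are invariant.\<close>

lemma energy_mass_isometry:
  fixes v :: "real ^ 'm option \<Rightarrow> real"
  assumes v: "v \<in> test_functions tube" and s: "s = 1 \<or> s = -1" and I: "\<And>y. y \<in> {a<..<b} \<longleftrightarrow> s * y + \<tau> \<in> {c<..<d}"
  defines "v' \<equiv> \<lambda>x. v (s *\<^sub>R x + \<tau> *\<^sub>R axis None 1)"
  shows "v' \<in> test_functions tube" and "energy_on {a<..<b} v' = energy_on {c<..<d} v"
    and "mass_on {a<..<b} v' = mass_on {c<..<d} v"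
proof -
  let ?T = "\<lambda>x :: real ^ 'm option. s *\<^sub>R x + \<tau> *\<^sub>R axis None 1"
  have X2T: "X2 (?T x) = s *\<^sub>R X2 x" for x by (simp add: X2_def vec_eq_iff axis_def)
  have NT: "?T x $ None = s * x $ None + \<tau>" for x by (simp add: axis_def)
  have "- X \<in> \<omega>" if "X \<in> \<omega>" for X using imageI[OF that, of uminus] unfolding \<omega>_sym .
  note neg = this
  have neg_iff: "- X \<in> \<omega> \<longleftrightarrow> X \<in> \<omega>" for X using neg[of X] neg[of "- X"] by (auto simp only: minus_minus)
  have sX: "s *\<^sub>R X \<in> \<omega> \<longleftrightarrow> X \<in> \<omega>" for X
    using s by (rule disjE) (simp_all only: scaleR_one scaleR_minus1_left neg_iff)
  have ST: "?T x \<in> tube \<longleftrightarrow> x \<in> tube" for x by (simp only: tube_def mem_Collect_eq X2T sX)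
  have AT: "energy_density (?T x) \<xi> = energy_density x \<xi>" if "x \<in> tube" for x \<xi>
  proof -
    have "A (s *\<^sub>R X2 x) = A (X2 x)"
      using s
    proof
      assume "s = -1"
      then show ?thesis using A_even[of "X2 x"] that by (simp add: tube_def)
    qed simp
    then show ?thesis by (simp only: energy_density_def X2T)
  qed
  show v': "v' \<in> test_functions tube"
    unfolding v'_def by (rule test_functions_compose_isometry[OF v s]) (use ST in blast)
  have g: "grad v' x = s *\<^sub>R grad v (?T x)" for x
    unfolding v'_def by (rule grad_compose_isometry[OF test_functions_Ck[OF v]])
  have d: "energy_density x (grad v' x) = energy_density (?T x) (grad v (?T x))" for x
  proof (cases "x \<in> tube")
    case True
    have "\<bar>s\<bar> powr p = 1" using s by auto
    then show ?thesis by (simp add: g energy_density_scaleR AT[OF True])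
  next
    case False
    then show ?thesis using ST[of x] test_function_vanishes(2)[OF v, of "?T x"] by (simp add: g)
  qed
  have ind: "indicator {a<..<b} (x $ None) = (indicator {c<..<d} (?T x $ None) :: real)" for x :: "real ^ 'm option"
    unfolding NT using I[of "x $ None"] by (simp add: indicator_def)
  show "energy_on {a<..<b} v' = energy_on {c<..<d} v"
    unfolding energy_on_def d ind
    using integral_lebesgue_isometry[OF s borel_measurable_integrable[OF integrable_test_on(1)[OF v, of c d]],
        of "\<tau> *\<^sub>R axis None 1"] by (simp add: add.commute)
  show "mass_on {a<..<b} v' = mass_on {c<..<d} v"
    unfolding mass_on_def ind v'_def
    using integral_lebesgue_isometry[OF s borel_measurable_integrable[OF integrable_test_on(2)[OF v, of c d]],
        of "\<tau> *\<^sub>R axis None 1"] by (simp add: add.commute)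
qed

lemma grad_eq_0_half_space:
  assumes "v \<in> test_functions tube" "\<And>x. x $ None \<ge> c \<Longrightarrow> v x = 0" "x $ None > c"
  shows "grad v x = 0"
proof -
  have "open {x :: real ^ 'm option. c < x $ None}" by (intro open_Collect_less continuous_intros)
  then have "grad v x = grad (\<lambda>_. 0) x"
    by (rule grad_cong_open[OF Ck_const]) (use assms(2,3) in auto)
  also have "\<dots> = 0" by (rule grad_eqI[of _ "\<lambda>_. 0"]) auto
  finally show ?thesis .
qed

text \<open>After cutting in a slab that carries little of the function, the quotient of the sums of energies and of
  masses is below \<open>\<Lambda> + \<epsilon>\<close>, so one of the two pieces has a quotient below \<open>\<Lambda> + \<epsilon>\<close>. The piece near the right
  end is reflected to the left one.\<close>

lemma exists_end_bump:
  assumes \<Lambda>: "\<Lambda> > 0" and \<epsilon>: "\<epsilon> > 0"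
  shows "\<exists>L. \<forall>l\<ge>L. \<forall>\<phi>\<in>test_functions tube. energy_on {-l<..<l} \<phi> < \<Lambda> * mass_on {-l<..<l} \<phi> \<longrightarrow>
    (\<exists>\<psi>\<in>test_functions tube. (\<exists>c<l. \<forall>x. x $ None \<ge> c \<longrightarrow> \<psi> x = 0) \<and>
       energy_on {-l<..<l} \<psi> < (\<Lambda> + \<epsilon>) * mass_on {-l<..<l} \<psi>)"
proof -
  obtain K where K: "K > 0"
    and cutK: "\<And>\<phi> a l. \<phi> \<in> test_functions tube \<Longrightarrow>
     energy_on {-l<..<l} (\<lambda>x. \<phi> x * axial_step a x) + energy_on {-l<..<l} (\<lambda>x. \<phi> x * (1 - axial_step a x))
       \<le> energy_on {-l<..<l} \<phi> + K * (mass_on {a<..<a+1} \<phi> + grad_mass_on {a<..<a+1} \<phi>)"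
     "\<And>\<phi> a l. \<phi> \<in> test_functions tube \<Longrightarrow> mass_on {-l<..<l} \<phi> - mass_on {a<..<a+1} \<phi>
       \<le> mass_on {-l<..<l} (\<lambda>x. \<phi> x * axial_step a x) + mass_on {-l<..<l} (\<lambda>x. \<phi> x * (1 - axial_step a x))"
    using axial_step_energy_mass by blast
  \<comment> \<open>By ellipticity, mass and gradient mass together are at most \<open>k\<close> times the mass.\<close>
  define k where "k = 1 + \<Lambda> / lam powr (p / 2)"
  have k: "k > 0" using \<Lambda> lam_pos by (simp add: k_def add_pos_pos)
  \<comment> \<open>With \<open>N\<close> slabs the errors are at most \<open>K k / N\<close> in the energy and \<open>k / N\<close> in the mass, relative to the mass; the extra 1 accounts for rounding \<open>l\<close> down to \<open>N\<close>.\<close>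
  define L where "L = (K * k + (\<Lambda> + \<epsilon>) * k) / \<epsilon> + 1"
  have L: "L \<ge> 1" using K k \<Lambda> \<epsilon> by (simp add: L_def)
  show ?thesis
  proof (intro exI[of _ L] allI impI ballI)
    fix l \<phi> assume l: "l \<ge> L" and \<phi>: "\<phi> \<in> test_functions tube"
      and less: "energy_on {-l<..<l} \<phi> < \<Lambda> * mass_on {-l<..<l} \<phi>"
    let ?m = "mass_on {-l<..<l} \<phi>" let ?I = "{-l<..<l}"
    have nonneg: "energy_on J w \<ge> 0" "mass_on J w \<ge> 0" "grad_mass_on J w \<ge> 0" for J w
      by (auto simp: energy_on_def mass_on_def grad_mass_on_def energy_density_nonneg)
    define N where "N = nat \<lfloor>l\<rfloor>"
    have N: "N > 0" "real N \<le> l" "real N \<ge> l - 1" using l L by (auto simp: N_def le_nat_floor)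
    obtain a where a: "-l \<le> a" "a + 1 \<le> l" "mass_on {a<..<a+1} \<phi> + grad_mass_on {a<..<a+1} \<phi> \<le> (?m + grad_mass_on ?I \<phi>) / real N"
      using exists_thin_strip[OF \<phi> N(1), of l] N(2) l L by auto
    have "lam powr (p / 2) * grad_mass_on ?I \<phi> \<le> \<Lambda> * ?m"
      using grad_mass_on_le[OF \<phi>, of "-l" l] less by simp
    then have "grad_mass_on ?I \<phi> \<le> \<Lambda> / lam powr (p / 2) * ?m"
      using lam_pos by (simp add: field_simps)
    then have strip: "mass_on {a<..<a+1} \<phi> + grad_mass_on {a<..<a+1} \<phi> \<le> k * ?m / real N"
      using a(3) N(1) by (intro order_trans[OF a(3)] divide_right_mono) (auto simp: k_def algebra_simps)
    have "(K * k + (\<Lambda> + \<epsilon>) * k) / \<epsilon> \<le> real N" using N(3) l unfolding L_def by linarith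
    then have Nbig: "K * k + (\<Lambda> + \<epsilon>) * k \<le> \<epsilon> * real N"
      using \<epsilon> by (simp only: pos_divide_le_eq mult.commute[of \<epsilon>])
    let ?v = "\<lambda>x. \<phi> x * axial_step a x" and ?w = "\<lambda>x. \<phi> x * (1 - axial_step a x)"
    have E: "energy_on ?I ?v + energy_on ?I ?w < \<Lambda> * ?m + K * (k * ?m / real N)"
      using cutK(1)[OF \<phi>, of l a] less mult_left_mono[OF strip, of K] K by linarith
    have M: "?m - k * ?m / real N \<le> mass_on ?I ?v + mass_on ?I ?w"
      using cutK(2)[OF \<phi>, of l a] strip nonneg(3)[of "{a<..<a+1}" \<phi>] by linarith
    have "(K * k + (\<Lambda> + \<epsilon>) * k) * (?m / real N) \<le> (\<epsilon> * real N) * (?m / real N)"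
      using Nbig nonneg(2)[of ?I \<phi>] by (intro mult_right_mono) auto
    then have "\<Lambda> * ?m + K * (k * ?m / real N) \<le> (\<Lambda> + \<epsilon>) * (?m - k * ?m / real N)"
      using N(1) by (simp add: algebra_simps)
    also have "\<dots> \<le> (\<Lambda> + \<epsilon>) * (mass_on ?I ?v + mass_on ?I ?w)"
      using M \<Lambda> \<epsilon> by (intro mult_left_mono) auto
    finally have "energy_on ?I ?v + energy_on ?I ?w < (\<Lambda> + \<epsilon>) * mass_on ?I ?v + (\<Lambda> + \<epsilon>) * mass_on ?I ?w"
      using E by (simp add: distrib_left)
    then consider "energy_on ?I ?v < (\<Lambda> + \<epsilon>) * mass_on ?I ?v" | "energy_on ?I ?w < (\<Lambda> + \<epsilon>) * mass_on ?I ?w"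
      by linarith
    then show "\<exists>\<psi>\<in>test_functions tube. (\<exists>c<l. \<forall>x. x $ None \<ge> c \<longrightarrow> \<psi> x = 0) \<and>
       energy_on {-l<..<l} \<psi> < (\<Lambda> + \<epsilon>) * mass_on {-l<..<l} \<psi>"
    proof cases
      case 1
      have v: "?v \<in> test_functions tube" by (rule test_functions_mult[OF \<phi> Ck_axial_step])
      note r = energy_mass_isometry[OF v, of "-1" "-l" l 0 "-l" l]
      let ?v' = "\<lambda>x. ?v ((-1) *\<^sub>R x + 0 *\<^sub>R axis None 1)"
      have "?v' x = 0" if "x $ None \<ge> - (a + 1/4)" for x
        using that by (simp add: axial_step_eq_0)
      moreover have "?v' \<in> test_functions tube" by (rule r) auto
      moreover have "energy_on ?I ?v' = energy_on ?I ?v" by (rule r) auto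
      moreover have "mass_on ?I ?v' = mass_on ?I ?v" by (rule r) auto
      ultimately show ?thesis
        using 1 a(1) by (intro bexI[of _ ?v'] conjI exI[of _ "- (a + 1/4)"]) auto
    next
      case 2
      have w: "?w \<in> test_functions tube" by (rule test_functions_mult[OF \<phi>]) (intro Ck_diff Ck_const Ck_axial_step)
      show ?thesis
        using 2 a(2) w by (intro bexI[of _ ?w] conjI exI[of _ "a + 3/4"]) (auto simp: axial_step_eq_1)
    qed
  qed
qed

text \<open>The function is normalized and shifted by \<open>l' - l\<close> to the left, which moves its support into the half
  \<open>x\<^sub>1 < 0\<close> because \<open>l' \<ge> 2 l\<close>; the second function is the reflection of the first.\<close>

lemma exists_two_bumps:
  assumes \<psi>: "\<psi> \<in> test_functions tube" and c: "c < l" "\<And>x. x $ None \<ge> c \<Longrightarrow> \<psi> x = 0"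
    and less: "energy_on {-l<..<l} \<psi> < \<Lambda> * mass_on {-l<..<l} \<psi>" and l': "l' \<ge> 2 * l"
  shows "\<exists>v\<in>test_functions tube. \<exists>w\<in>test_functions tube.
    (\<forall>x. x $ None \<ge> 0 \<longrightarrow> v x = 0 \<and> grad v x = 0) \<and> (\<forall>x. x $ None \<le> 0 \<longrightarrow> w x = 0 \<and> grad w x = 0) \<and>
    mass_on {-l'<..<l'} v = 1 \<and> mass_on {-l'<..<l'} w = 1 \<and>
    energy_on {-l'<..<l'} v < \<Lambda> \<and> energy_on {-l'<..<l'} w < \<Lambda>"
proof -
  define m where "m = mass_on {-l<..<l} \<psi>"
  have E0: "energy_on {-l<..<l} \<psi> \<ge> 0" by (simp add: energy_on_def energy_density_nonneg)
  have "m \<ge> 0" by (simp add: m_def mass_on_def)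
  then have m: "m > 0" using less E0 unfolding m_def by (cases "mass_on {-l<..<l} \<psi> = 0") auto
  define r where "r = (1 / m) powr (1 / p)"
  have r: "r > 0" "r powr p = 1 / m" using m p_pos unfolding r_def powr_powr by auto
  define \<psi>' where "\<psi>' x = r * \<psi> x + 0 * \<psi> x" for x
  have \<psi>': "\<psi>' \<in> test_functions tube"
    unfolding \<psi>'_def by (rule test_functions_linear_combination[OF \<psi> \<psi>])
  have g\<psi>': "grad \<psi>' x = r *\<^sub>R grad \<psi> x" for x
    unfolding \<psi>'_def using grad_linear_combination[OF test_functions_Ck[OF \<psi>] test_functions_Ck[OF \<psi>], of r 0 x] by simp
  have g0: "grad \<psi> x = 0" if "x $ None \<ge> l" for x
    by (rule grad_eq_0_half_space[OF \<psi> c(2)]) (use that c(1) in auto)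
  have big: "energy_on {-l<..<2 * l' - l} \<psi>' = energy_on {-l<..<l} \<psi> / m" "mass_on {-l<..<2 * l' - l} \<psi>' = 1"
  proof -
    have "energy_on {-l<..<2 * l' - l} \<psi>' = (\<integral>x. (1 / m) * (indicator {-l<..<l} (x $ None) * energy_density x (grad \<psi> x)) \<partial>lebesgue)"
      unfolding energy_on_def g\<psi>' energy_density_scaleR
      by (intro Bochner_Integration.integral_cong refl) (use r l' g0 in \<open>auto simp: indicator_def\<close>)
    then show "energy_on {-l<..<2 * l' - l} \<psi>' = energy_on {-l<..<l} \<psi> / m" by (simp add: energy_on_def)
    have "mass_on {-l<..<2 * l' - l} \<psi>' = (\<integral>x. (1 / m) * (indicator {-l<..<l} (x $ None) * \<bar>\<psi> x\<bar> powr p) \<partial>lebesgue)"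
      unfolding mass_on_def
      by (intro Bochner_Integration.integral_cong refl) (use r l' c in \<open>auto simp: indicator_def \<psi>'_def abs_mult powr_mult\<close>)
    also have "\<dots> = mass_on {-l<..<l} \<psi> / m" by (simp add: mass_on_def)
    finally show "mass_on {-l<..<2 * l' - l} \<psi>' = 1" using m by (simp add: m_def)
  qed
  have less': "energy_on {-l<..<l} \<psi> / m < \<Lambda>" using less m by (simp add: m_def field_simps)
  define v where "v = (\<lambda>x. \<psi>' (1 *\<^sub>R x + (l' - l) *\<^sub>R axis None 1))"
  have v: "v \<in> test_functions tube" "energy_on {-l'<..<l'} v = energy_on {-l<..<2 * l' - l} \<psi>'"
    "mass_on {-l'<..<l'} v = mass_on {-l<..<2 * l' - l} \<psi>'"
    unfolding v_def by (rule energy_mass_isometry[OF \<psi>', of 1 "-l'" l' "l' - l" "-l" "2 * l' - l"]; auto)+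
  define w where "w = (\<lambda>x. v ((-1) *\<^sub>R x + 0 *\<^sub>R axis None 1))"
  have w: "w \<in> test_functions tube" "energy_on {-l'<..<l'} w = energy_on {-l'<..<l'} v"
    "mass_on {-l'<..<l'} w = mass_on {-l'<..<l'} v"
    unfolding w_def by (rule energy_mass_isometry[OF v(1), of "-1" "-l'" l' 0 "-l'" l']; auto)+
  have v0: "v x = 0" if "x $ None \<ge> c - (l' - l)" for x
    using that c(2)[of "x + (l' - l) *\<^sub>R axis None 1"] by (simp add: v_def \<psi>'_def axis_def)
  have gv0: "grad v x = 0" if "x $ None \<ge> 0" for x
    by (rule grad_eq_0_half_space[OF v(1) v0]) (use that c(1) l' in auto)
  have gw: "grad w x = - grad v (- x)" for x
    unfolding w_def using grad_compose_isometry[OF test_functions_Ck[OF v(1)], of "-1" 0 x] by simp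
  show ?thesis
  proof (rule bexI[of _ v], rule bexI[of _ w], intro conjI allI impI)
    show "v x = 0" if "x $ None \<ge> 0" for x using that v0[of x] c(1) l' by simp
    show "w x = 0" if "x $ None \<le> 0" for x using that v0[of "-x"] c(1) l' by (simp add: w_def)
    show "grad w x = 0" if "x $ None \<le> 0" for x using that gv0[of "-x"] by (simp add: gw)
  qed (use v w big less' gv0 in auto)
qed

end

context elliptic_cylinder
begin

section \<open>The topology of the Sobolev space\<close>

lemma Vspace_W1p: "u \<in> Vspace \<omega> p l \<Longrightarrow> u \<in> W1p (cylinder \<omega> l) p"
  by (simp add: Vspace_def)

lemma W1p_norm_0: "W1p_modular (cylinder \<omega> l) p u = 0 \<longleftrightarrow> W1p_norm (cylinder \<omega> l) p u = 0"
  using p_pos W1p_modular_nonneg[of "cylinder \<omega> l" p u] by (auto simp: W1p_norm_def W1p_modular_def)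

lemma modular_diff_self: "W1p_modular (cylinder \<omega> l) p (u - u) = 0"
  using W1p_modular_0[OF cylinder_open_bounded(1,2) p_ge_1] by (simp add: fun_diff_def)

lemma test_function_Vspace: "\<phi> \<in> test_functions tube \<Longrightarrow> \<phi> \<in> Vspace \<omega> p l"
proof -
  assume \<phi>: "\<phi> \<in> test_functions tube"
  have "W1p_norm (cylinder \<omega> l) p (\<phi> - \<phi>) = 0"
    using modular_diff_self W1p_norm_0 by blast
  then have "\<forall>e>0. \<exists>\<psi>\<in>test_functions {x. X2 x \<in> \<omega>}. W1p_norm (cylinder \<omega> l) p (\<phi> - \<psi>) < e"
    using \<phi> by (metis tube_def)
  then show ?thesis using test_function_W1p[OF \<phi>] by (simp add: Vspace_def)
qed

lemma modular_triangle:
  assumes "u \<in> W1p (cylinder \<omega> l) p" "v \<in> W1p (cylinder \<omega> l) p" "w \<in> W1p (cylinder \<omega> l) p"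
  shows "W1p_modular (cylinder \<omega> l) p (u - w) \<le> 2 powr p * (W1p_modular (cylinder \<omega> l) p (u - v) + W1p_modular (cylinder \<omega> l) p (v - w))"
proof -
  have "(\<lambda>x. 1 * (u - v) x + 1 * (v - w) x) = u - w" by (simp add: fun_eq_iff)
  then show ?thesis
    using W1p_modular_linear_combination_le[OF cylinder_open_bounded(1) p_ge_1 W1p_diff(1)[OF cylinder_open_bounded(1) p_ge_1 assms(1,2)]
        W1p_diff(1)[OF cylinder_open_bounded(1) p_ge_1 assms(2,3)], of 1 1] by simp
qed

lemma modular_uminus_le:
  assumes "u \<in> W1p (cylinder \<omega> l) p"
  shows "W1p_modular (cylinder \<omega> l) p (- u) \<le> 2 powr p * W1p_modular (cylinder \<omega> l) p u"
proof -
  have "(\<lambda>x. (-1) * u x + 0 * u x) = - u" by (simp add: fun_eq_iff)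
  then show ?thesis
    using W1p_modular_linear_combination_le[OF cylinder_open_bounded(1) p_ge_1 assms assms, of "-1" 0] p_pos by simp
qed

lemma Vspace_uminus:
  assumes u: "u \<in> Vspace \<omega> p l" shows "- u \<in> Vspace \<omega> p l"
proof -
  note uW = Vspace_W1p[OF u]
  have "(\<lambda>x. (-1) * u x + 0 * u x) = - u" by (simp add: fun_eq_iff)
  then have W: "- u \<in> W1p (cylinder \<omega> l) p"
    using W1p_linear_combination(1)[OF cylinder_open_bounded(1) p_ge_1 uW uW, of "-1" 0] by simp
  have "\<exists>\<psi>\<in>test_functions {x. X2 x \<in> \<omega>}. W1p_norm (cylinder \<omega> l) p (- u - \<psi>) < e" if e: "e > 0" for e
  proof -
    obtain \<phi> where \<phi>: "\<phi> \<in> test_functions {x. X2 x \<in> \<omega>}" "W1p_norm (cylinder \<omega> l) p (u - \<phi>) < e / 2"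
      using u half_gt_zero[OF e] unfolding Vspace_def by blast
    have "(\<lambda>x. (-1) * \<phi> x + 0 * \<phi> x) = - \<phi>" by (simp add: fun_eq_iff)
    then have \<phi>': "- \<phi> \<in> test_functions {x. X2 x \<in> \<omega>}"
      using test_functions_linear_combination[OF \<phi>(1) \<phi>(1), of "-1" 0] by simp
    have d: "u - \<phi> \<in> W1p (cylinder \<omega> l) p"
      by (rule W1p_diff(1)[OF cylinder_open_bounded(1) p_ge_1 uW test_function_W1p[OF \<phi>(1)]])
    have eq: "- u - (- \<phi>) = - (u - \<phi>)" by (simp add: fun_eq_iff)
    have "W1p_modular (cylinder \<omega> l) p (- u - (- \<phi>)) \<le> 2 powr p * W1p_modular (cylinder \<omega> l) p (u - \<phi>)"
      unfolding eq by (rule modular_uminus_le[OF d])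
    also have "\<dots> < 2 powr p * (e / 2) powr p"
      using \<phi>(2) e p_pos by (subst (asm) W1p_norm_less_iff) auto
    also have "\<dots> = e powr p" using e by (simp add: powr_divide)
    finally show ?thesis using \<phi>' e p_pos by (intro bexI[of _ "- \<phi>"]) (auto simp: W1p_norm_less_iff)
  qed
  then show ?thesis using W by (simp add: Vspace_def)
qed

text \<open>Functions at distance 0 need not be equal, since elements of the space are represented by functions.\<close>

lemma modular_0_energy_mass:
  assumes u: "u \<in> W1p (cylinder \<omega> l) p" and w: "w \<in> W1p (cylinder \<omega> l) p"
    and 0: "W1p_modular (cylinder \<omega> l) p (u - w) = 0"
  shows "energy A \<omega> p l u = energy A \<omega> p l w" and "mass \<omega> p l u = mass \<omega> p l w"
proof -
  note d = W1p_diff[OF cylinder_open_bounded(1) p_ge_1 u w]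
  note z = W1p_modular_eq_0D[OF cylinder_open_bounded(1) d(1) 0]
  have L: "weak_gradient (cylinder \<omega> l) v \<in> borel_measurable (lebesgue_on (cylinder \<omega> l))"
    "v \<in> borel_measurable (lebesgue_on (cylinder \<omega> l))" if "v \<in> W1p (cylinder \<omega> l) p" for v
    using W1pD[OF cylinder_open_bounded(1) that] by (auto simp: Lp_def)
  show "energy A \<omega> p l u = energy A \<omega> p l w"
    unfolding energy_eq
  proof (rule integral_cong_AE)
    show "AE x in lebesgue_on (cylinder \<omega> l). energy_density x (weak_gradient (cylinder \<omega> l) u x) = energy_density x (weak_gradient (cylinder \<omega> l) w x)"
      using d(2) z(2) by eventually_elim simp
  qed (intro borel_measurable_density cylinder_open_bounded cylinder_subset_tube L u w)+
  show "mass \<omega> p l u = mass \<omega> p l w"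
    unfolding mass_def
  proof (rule integral_cong_AE)
    show "AE x in lebesgue_on (cylinder \<omega> l). \<bar>u x\<bar> powr p = \<bar>w x\<bar> powr p"
      using z(1) by eventually_elim simp
  qed (use L[OF u] L[OF w] in simp_all)
qed

lemma openin_Vtop:
  "openin (Vtop \<omega> p l) U \<longleftrightarrow> U \<subseteq> Vspace \<omega> p l \<and>
     (\<forall>u\<in>U. \<exists>r>0. \<forall>v\<in>Vspace \<omega> p l. W1p_modular (cylinder \<omega> l) p (v - u) < r \<longrightarrow> v \<in> U)"
proof -
  have "(\<exists>r>0. \<forall>v\<in>Vspace \<omega> p l. W1p_norm (cylinder \<omega> l) p (v - u) < r \<longrightarrow> v \<in> U) \<longleftrightarrow>
     (\<exists>r>0. \<forall>v\<in>Vspace \<omega> p l. W1p_modular (cylinder \<omega> l) p (v - u) < r \<longrightarrow> v \<in> U)" for u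
  proof
    assume "\<exists>r>0. \<forall>v\<in>Vspace \<omega> p l. W1p_norm (cylinder \<omega> l) p (v - u) < r \<longrightarrow> v \<in> U"
    then obtain r where r: "r > 0" "\<forall>v\<in>Vspace \<omega> p l. W1p_norm (cylinder \<omega> l) p (v - u) < r \<longrightarrow> v \<in> U" by blast
    then show "\<exists>r>0. \<forall>v\<in>Vspace \<omega> p l. W1p_modular (cylinder \<omega> l) p (v - u) < r \<longrightarrow> v \<in> U"
      using p_pos by (intro exI[of _ "r powr p"]) (auto simp: W1p_norm_less_iff)
  next
    assume "\<exists>r>0. \<forall>v\<in>Vspace \<omega> p l. W1p_modular (cylinder \<omega> l) p (v - u) < r \<longrightarrow> v \<in> U"
    then obtain r where r: "r > 0" "\<forall>v\<in>Vspace \<omega> p l. W1p_modular (cylinder \<omega> l) p (v - u) < r \<longrightarrow> v \<in> U" by blast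
    then show "\<exists>r>0. \<forall>v\<in>Vspace \<omega> p l. W1p_norm (cylinder \<omega> l) p (v - u) < r \<longrightarrow> v \<in> U"
      using p_pos by (intro exI[of _ "r powr (1 / p)"]) (auto simp: W1p_norm_less_iff powr_powr)
  qed
  then show ?thesis by (simp add: Vtop_def openin_seminorm_topology)
qed

lemma topspace_Vtop: "topspace (Vtop \<omega> p l) = Vspace \<omega> p l"
proof
  show "topspace (Vtop \<omega> p l) \<subseteq> Vspace \<omega> p l" using openin_Vtop[of l "topspace (Vtop \<omega> p l)"] by auto
  have "openin (Vtop \<omega> p l) (Vspace \<omega> p l)" by (auto simp: openin_Vtop intro: exI[of _ 1])
  then show "Vspace \<omega> p l \<subseteq> topspace (Vtop \<omega> p l)" by (rule openin_subset)
qed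

end

section \<open>Sets of genus two\<close>

lemma compact_p_circle:
  assumes "p > (0::real)"
  shows "compact {z :: real \<times> real. \<bar>fst z\<bar> powr p + \<bar>snd z\<bar> powr p = 1}" (is "compact ?T")
proof -
  have le1: "\<bar>a\<bar> \<le> 1" if "\<bar>a\<bar> powr p \<le> 1" for a :: real
  proof (rule ccontr)
    assume "\<not> \<bar>a\<bar> \<le> 1"
    then have "1 powr p < \<bar>a\<bar> powr p" using assms by (intro powr_less_mono2) auto
    then show False using that by simp
  qed
  have "?T \<subseteq> cbox (-1, -1) (1, 1)"
  proof
    fix z :: "real \<times> real" assume "z \<in> ?T"
    then have z: "\<bar>fst z\<bar> powr p + \<bar>snd z\<bar> powr p = 1" by simp
    have "\<bar>fst z\<bar> powr p \<le> 1" "\<bar>snd z\<bar> powr p \<le> 1"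
      using z powr_ge_zero[of "\<bar>fst z\<bar>" p] powr_ge_zero[of "\<bar>snd z\<bar>" p] by linarith+
    then have "\<bar>fst z\<bar> \<le> 1" "\<bar>snd z\<bar> \<le> 1" using le1 by auto
    then show "z \<in> cbox (-1, -1) (1, 1)" by (cases z) (auto simp: abs_le_iff)
  qed
  then have "bounded ?T" using bounded_subset[OF bounded_cbox] by blast
  moreover have "continuous_on UNIV (\<lambda>z :: real \<times> real. \<bar>fst z\<bar> powr p + \<bar>snd z\<bar> powr p)"
    using assms by (intro continuous_on_add continuous_on_powr' continuous_on_rabs continuous_on_fst continuous_on_snd
        continuous_on_id continuous_on_const) auto
  then have "closed ?T" by (intro closed_Collect_eq continuous_on_const)
  ultimately show ?thesis by (simp add: compact_eq_bounded_closed)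
qed

text \<open>A path joining two antipodal points excludes odd maps into \<open>\<real>\<^sup>m\<close> without the origin for \<open>m \<le> 1\<close>: there is no
  point to map to if \<open>m = 0\<close>, and the intermediate value theorem yields a zero if \<open>m = 1\<close>.\<close>

lemma genus_ge_2I:
  fixes B :: "'a::uminus set"
  assumes path: "continuous_map (top_of_set {-1..1::real}) (subtopology X B) \<gamma>"
    and B: "\<gamma> ` {-1..1} \<subseteq> B" and odd: "\<gamma> (-1) = - \<gamma> 1"
  shows "enat 2 \<le> genus X B"
  unfolding genus_def
proof (rule Inf_greatest)
  fix e assume "e \<in> {enat m | m. \<exists>h. continuous_map (subtopology X B) (subtopology (Euclidean_space m) (- {\<lambda>i. 0})) h \<and>
     (\<forall>u\<in>B. h (- u) = (\<lambda>i. - h u i))}"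
  then obtain m h where e: "e = enat m"
    and h: "continuous_map (subtopology X B) (subtopology (Euclidean_space m) (- {\<lambda>i. 0})) h"
    and hodd: "\<And>u. u \<in> B \<Longrightarrow> h (- u) = (\<lambda>i. - h u i)" by auto
  have hg: "continuous_map (top_of_set {-1..1::real}) (subtopology (Euclidean_space m) (- {\<lambda>i. 0})) (h \<circ> \<gamma>)"
    by (rule continuous_map_compose[OF path h])
  have sup: "(\<forall>i\<ge>m. h (\<gamma> t) i = 0) \<and> h (\<gamma> t) \<noteq> (\<lambda>i. 0)" if "t \<in> {-1..1}" for t
    using continuous_map_funspace[OF hg] that
    by (auto simp: topspace_subtopology topspace_Euclidean_space Pi_iff)
  have "m \<ge> 2"
  proof (rule ccontr)
    assume "\<not> m \<ge> 2"
    then have m: "m \<le> 1" by simp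
    \<comment> \<open>For \<open>m \<le> 1\<close> all coordinates of the image other than the one with index 0 vanish.\<close>
    define f where "f t = h (\<gamma> t) 0" for t
    have nz: "f t \<noteq> 0" if "t \<in> {-1..1}" for t
    proof
      assume "f t = 0"
      then have "h (\<gamma> t) i = 0" for i using sup[OF that] m by (cases i) (auto simp: f_def)
      then show False using sup[OF that] by auto
    qed
    have "continuous_map (top_of_set {-1..1::real}) (Euclidean_space m) (h \<circ> \<gamma>)"
      using hg by (simp add: continuous_map_in_subtopology)
    then have "continuous_map (top_of_set {-1..1::real}) (powertop_real UNIV) (h \<circ> \<gamma>)"
      by (simp add: Euclidean_space_def continuous_map_in_subtopology)
    then have "continuous_map (top_of_set {-1..1::real}) euclideanreal f"
      by (simp add: continuous_map_componentwise_UNIV f_def[abs_def] o_def)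
    then have cf: "continuous_on {-1..1} f" by simp
    have "f (-1) = - f 1"
    proof -
      have "\<gamma> 1 \<in> B" using B by auto
      then show ?thesis using hodd[of "\<gamma> 1"] odd by (simp add: f_def)
    qed
    then consider "f (-1) \<le> 0" "0 \<le> f 1" | "f 1 \<le> 0" "0 \<le> f (-1)" by linarith
    then obtain t where "t \<in> {-1..1}" "f t = 0"
      by cases (use IVT'[OF _ _ _ cf] IVT2'[OF _ _ _ cf] in fastforce)+
    then show False using nz by blast
  qed
  then show "enat 2 \<le> e" by (simp add: e)
qed

lemma genus_empty: "genus X {} = 0"
proof -
  have "enat 0 \<in> {enat m | m. \<exists>h. continuous_map (subtopology X {}) (subtopology (Euclidean_space m) (- {\<lambda>i. 0})) h \<and>
     (\<forall>u\<in>{}. h (- u) = (\<lambda>i. - h u i))}"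
    by (auto simp: continuous_map_on_empty)
  then have "genus X {} \<le> enat 0" unfolding genus_def by (rule Inf_lower)
  then show ?thesis by (simp add: zero_enat_def[symmetric])
qed

context elliptic_cylinder
begin

text \<open>At every point at most one of the two functions and gradients is nonzero.\<close>

lemma two_bump_combination:
  assumes v: "v \<in> test_functions tube" and w: "w \<in> test_functions tube"
    and v0: "\<And>x. x $ None \<ge> 0 \<Longrightarrow> v x = 0 \<and> grad v x = 0" and w0: "\<And>x. x $ None \<le> 0 \<Longrightarrow> w x = 0 \<and> grad w x = 0"
  shows "energy A \<omega> p l (\<lambda>x. a * v x + b * w x) = \<bar>a\<bar> powr p * energy_on {-l<..<l} v + \<bar>b\<bar> powr p * energy_on {-l<..<l} w"
    and "mass \<omega> p l (\<lambda>x. a * v x + b * w x) = \<bar>a\<bar> powr p * mass_on {-l<..<l} v + \<bar>b\<bar> powr p * mass_on {-l<..<l} w"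
proof -
  note t = test_functions_linear_combination[OF v w, of a b]
  have g: "grad (\<lambda>x. a * v x + b * w x) x = a *\<^sub>R grad v x + b *\<^sub>R grad w x" for x
    by (rule grad_linear_combination[OF test_functions_Ck[OF v] test_functions_Ck[OF w]])
  have "energy_density x (grad (\<lambda>x. a * v x + b * w x) x) = \<bar>a\<bar> powr p * energy_density x (grad v x) + \<bar>b\<bar> powr p * energy_density x (grad w x)" for x
    using v0[of x] w0[of x] by (cases "x $ None \<ge> 0") (auto simp: g energy_density_scaleR)
  then show "energy A \<omega> p l (\<lambda>x. a * v x + b * w x) = \<bar>a\<bar> powr p * energy_on {-l<..<l} v + \<bar>b\<bar> powr p * energy_on {-l<..<l} w"
    unfolding energy_test[OF t] unfolding energy_on_def
    using integrable_test_on(1)[OF v] integrable_test_on(1)[OF w] by (simp add: distrib_left mult.left_commute)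
  have "\<bar>a * v x + b * w x\<bar> powr p = \<bar>a\<bar> powr p * \<bar>v x\<bar> powr p + \<bar>b\<bar> powr p * \<bar>w x\<bar> powr p" for x
    using v0[of x] w0[of x] by (cases "x $ None \<ge> 0") (auto simp: abs_mult powr_mult)
  then show "mass \<omega> p l (\<lambda>x. a * v x + b * w x) = \<bar>a\<bar> powr p * mass_on {-l<..<l} v + \<bar>b\<bar> powr p * mass_on {-l<..<l} w"
    unfolding mass_test[OF t] unfolding mass_on_def
    using integrable_test_on(2)[OF v] integrable_test_on(2)[OF w] by (simp add: distrib_left mult.left_commute)
qed

text \<open>The normalized combinations of the two functions form a topological circle of functions of mass 1, on which the
  energy is at most \<open>\<Lambda>\<close>.\<close>

lemma beta_2_le:
  assumes v: "v \<in> test_functions tube" and w: "w \<in> test_functions tube"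
    and v0: "\<And>x. x $ None \<ge> 0 \<Longrightarrow> v x = 0 \<and> grad v x = 0" and w0: "\<And>x. x $ None \<le> 0 \<Longrightarrow> w x = 0 \<and> grad w x = 0"
    and mv: "mass_on {-l<..<l} v = 1" and mw: "mass_on {-l<..<l} w = 1"
    and ev: "energy_on {-l<..<l} v \<le> \<Lambda>" and ew: "energy_on {-l<..<l} w \<le> \<Lambda>"
  shows "beta A \<omega> p 2 l \<le> ereal \<Lambda>"
proof -
  let ?D = "W1p_modular (cylinder \<omega> l) p"
  let ?V = "Vspace \<omega> p l"
  define W where "W z x = fst z * v x + snd z * w x" for z x
  define T where "T = {z :: real \<times> real. \<bar>fst z\<bar> powr p + \<bar>snd z\<bar> powr p = 1}"
  \<comment> \<open>A closed set contains everything at distance 0 from its elements, so the circle is enlarged accordingly.\<close>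
  define B where "B = {u \<in> ?V. \<exists>z\<in>T. ?D (u - W z) = 0}"
  have Wt: "W z \<in> test_functions tube" for z
    unfolding W_def by (rule test_functions_linear_combination[OF v w])
  have WV: "W z \<in> ?V" and WW: "W z \<in> W1p (cylinder \<omega> l) p" for z
    using test_function_Vspace[OF Wt] test_function_W1p[OF Wt] by auto
  have WB: "W z \<in> B" if "z \<in> T" for z
    using that WV modular_diff_self[of l "W z"] by (auto simp: B_def)
  have Dv: "?D v \<ge> 0" "?D w \<ge> 0" by (rule W1p_modular_nonneg)+
  have Wdiff: "?D (W z - W z') \<le> 2 powr p * (\<bar>fst z - fst z'\<bar> powr p * ?D v + \<bar>snd z - snd z'\<bar> powr p * ?D w)" for z z'
  proof -
    have "W z - W z' = (\<lambda>x. (fst z - fst z') * v x + (snd z - snd z') * w x)"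
      by (simp add: W_def fun_eq_iff algebra_simps)
    then show ?thesis
      using W1p_modular_linear_combination_le[OF cylinder_open_bounded(1) p_ge_1 test_function_W1p[OF v] test_function_W1p[OF w]] by simp
  qed
  have Wneg: "- W z = W (- z)" for z by (simp add: W_def fun_eq_iff)
  have Tneg: "- z \<in> T" if "z \<in> T" for z using that by (simp add: T_def)
  have emB: "energy A \<omega> p l u \<le> \<Lambda>" "mass \<omega> p l u = 1" if "u \<in> B" for u
  proof -
    obtain z where z: "z \<in> T" "?D (u - W z) = 0" and uV: "u \<in> ?V" using \<open>u \<in> B\<close> unfolding B_def by blast
    note eq = modular_0_energy_mass[OF Vspace_W1p[OF uV] WW z(2)]
    have "energy A \<omega> p l (W z) = \<bar>fst z\<bar> powr p * energy_on {-l<..<l} v + \<bar>snd z\<bar> powr p * energy_on {-l<..<l} w"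
      unfolding W_def by (rule two_bump_combination(1)[OF v w v0 w0])
    also have "\<dots> \<le> \<bar>fst z\<bar> powr p * \<Lambda> + \<bar>snd z\<bar> powr p * \<Lambda>"
      by (intro add_mono mult_left_mono ev ew) auto
    also have "\<dots> = \<Lambda>" using z(1) by (simp add: T_def distrib_right[symmetric])
    finally show "energy A \<omega> p l u \<le> \<Lambda>" using eq by simp
    have "mass \<omega> p l (W z) = \<bar>fst z\<bar> powr p * mass_on {-l<..<l} v + \<bar>snd z\<bar> powr p * mass_on {-l<..<l} w"
      unfolding W_def by (rule two_bump_combination(2)[OF v w v0 w0])
    then show "mass \<omega> p l u = 1" using eq z(1) mv mw by (simp add: T_def)
  qed
  have negB: "- u \<in> B" if "u \<in> B" for u
  proof -
    obtain z where z: "z \<in> T" "?D (u - W z) = 0" and uV: "u \<in> ?V" using \<open>u \<in> B\<close> unfolding B_def by blast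
    have "- u - W (- z) = - (u - W z)" unfolding Wneg[symmetric] by (simp add: fun_eq_iff)
    then have "?D (- u - W (- z)) \<le> 0"
      using modular_uminus_le[OF W1p_diff(1)[OF cylinder_open_bounded(1) p_ge_1 Vspace_W1p[OF uV] WW[of z]]] z(2) by simp
    then have "?D (- u - W (- z)) = 0"
      using W1p_modular_nonneg[of "cylinder \<omega> l" p "- u - W (- z)"] by simp
    then show ?thesis using Tneg[OF z(1)] Vspace_uminus[OF uV] unfolding B_def by blast
  qed
  have symB: "uminus ` B = B"
  proof
    show "uminus ` B \<subseteq> B" using negB by auto
    show "B \<subseteq> uminus ` B"
    proof
      fix u assume "u \<in> B"
      then have "u = - (- u)" "- u \<in> B" using negB by auto
      then show "u \<in> uminus ` B" by (rule image_eqI)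
    qed
  qed
  have closedB: "closedin (Vtop \<omega> p l) B"
    unfolding closedin_def topspace_Vtop openin_Vtop
  proof (intro conjI ballI)
    show "B \<subseteq> ?V" by (auto simp: B_def)
    fix u assume u: "u \<in> ?V - B"
    show "\<exists>r>0. \<forall>v\<in>?V. ?D (v - u) < r \<longrightarrow> v \<in> ?V - B"
    proof (rule ccontr)
      assume "\<not> ?thesis"
      moreover have "inverse (real (Suc n)) > 0" for n by simp
      ultimately have "\<not> (\<forall>v\<in>?V. ?D (v - u) < inverse (real (Suc n)) \<longrightarrow> v \<in> ?V - B)" for n by blast
      then have "\<exists>v. v \<in> B \<and> ?D (v - u) < inverse (real (Suc n))" for n by blast
      then obtain f where f: "\<And>n. f n \<in> B" "\<And>n. ?D (f n - u) < inverse (real (Suc n))" by metis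
      \<comment> \<open>Approximating elements of the set come from points of a compact circle, which accumulate at some \<open>z0\<close>.\<close>
      have "\<exists>z. z \<in> T \<and> ?D (f n - W z) = 0" for n using f(1)[of n] unfolding B_def by blast
      then obtain z where z: "\<And>n. z n \<in> T" "\<And>n. ?D (f n - W (z n)) = 0" by metis
      obtain z0 r where z0: "z0 \<in> T" "strict_mono r" "(z \<circ> r) \<longlonglongrightarrow> z0"
        using compact_p_circle[OF p_pos] z(1) unfolding T_def compact_def by blast
      have uW: "u \<in> W1p (cylinder \<omega> l) p" and fW: "f n \<in> W1p (cylinder \<omega> l) p" for n
        using u f(1)[of n] by (auto simp: B_def intro: Vspace_W1p)
      have bound: "?D (u - W z0) \<le> 2 powr p * (2 powr p * (2 powr p * inverse (real (Suc (r n)))) +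
         2 powr p * (2 powr p * (\<bar>fst (z (r n)) - fst z0\<bar> powr p * ?D v + \<bar>snd (z (r n)) - snd z0\<bar> powr p * ?D w)))" for n
      proof -
        let ?n = "r n"
        have "u - f ?n = - (f ?n - u)" by (simp add: fun_eq_iff)
        then have "?D (u - f ?n) \<le> 2 powr p * ?D (f ?n - u)"
          using modular_uminus_le[OF W1p_diff(1)[OF cylinder_open_bounded(1) p_ge_1 fW[of ?n] uW]] by simp
        also have "\<dots> \<le> 2 powr p * inverse (real (Suc ?n))"
          using f(2)[of ?n] by (intro mult_left_mono) auto
        finally have 1: "?D (u - f ?n) \<le> 2 powr p * inverse (real (Suc ?n))" .
        have 2: "?D (f ?n - W z0) \<le> 2 powr p * (?D (f ?n - W (z ?n)) + ?D (W (z ?n) - W z0))"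
          by (rule modular_triangle[OF fW[of ?n] WW[of "z ?n"] WW[of z0]])
        have "?D (u - W z0) \<le> 2 powr p * (?D (u - f ?n) + ?D (f ?n - W z0))"
          by (rule modular_triangle[OF uW fW[of ?n] WW[of z0]])
        also have "\<dots> \<le> 2 powr p * (2 powr p * inverse (real (Suc ?n)) + 2 powr p * (?D (W (z ?n) - W z0)))"
          using 1 2 z(2)[of ?n] by (intro mult_left_mono add_mono) auto
        also have "\<dots> \<le> 2 powr p * (2 powr p * (2 powr p * inverse (real (Suc ?n))) +
         2 powr p * (2 powr p * (\<bar>fst (z ?n) - fst z0\<bar> powr p * ?D v + \<bar>snd (z ?n) - snd z0\<bar> powr p * ?D w)))"
        proof (intro mult_left_mono add_mono Wdiff)
          have "1 \<le> (2::real) powr p" using p_pos by (simp add: ge_one_powr_ge_zero)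
          then show "inverse (real (Suc ?n)) \<le> 2 powr p * inverse (real (Suc ?n))"
            using mult_right_mono[of 1 "2 powr p" "inverse (real (Suc ?n))"] by simp
        qed auto
        finally show ?thesis .
      qed
      have lim1: "(\<lambda>n. inverse (real (Suc (r n)))) \<longlonglongrightarrow> 0"
        using LIMSEQ_subseq_LIMSEQ[OF LIMSEQ_inverse_real_of_nat z0(2)] by (simp add: o_def)
      have lim2: "(\<lambda>n. \<bar>fst (z (r n)) - fst z0\<bar> powr p) \<longlonglongrightarrow> 0 powr p"
        using tendsto_fst[OF z0(3)] p_pos
        by (intro tendsto_powr' tendsto_const) (auto simp: o_def LIM_zero intro!: tendsto_rabs_zero)
      have lim3: "(\<lambda>n. \<bar>snd (z (r n)) - snd z0\<bar> powr p) \<longlonglongrightarrow> 0 powr p"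
        using tendsto_snd[OF z0(3)] p_pos
        by (intro tendsto_powr' tendsto_const) (auto simp: o_def LIM_zero intro!: tendsto_rabs_zero)
      have "(\<lambda>n. 2 powr p * (2 powr p * (2 powr p * inverse (real (Suc (r n)))) +
         2 powr p * (2 powr p * (\<bar>fst (z (r n)) - fst z0\<bar> powr p * ?D v + \<bar>snd (z (r n)) - snd z0\<bar> powr p * ?D w))))
         \<longlonglongrightarrow> 2 powr p * (2 powr p * (2 powr p * 0) + 2 powr p * (2 powr p * (0 powr p * ?D v + 0 powr p * ?D w)))"
        by (intro tendsto_mult tendsto_add tendsto_const lim1 lim2 lim3)
      then have "?D (u - W z0) \<le> 2 powr p * (2 powr p * (2 powr p * 0) + 2 powr p * (2 powr p * (0 powr p * ?D v + 0 powr p * ?D w)))"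
        by (rule LIMSEQ_le_const) (use bound in auto)
      then have "?D (u - W z0) = 0" using W1p_modular_nonneg[of "cylinder \<omega> l" p "u - W z0"] by simp
      then show False using u z0(1) by (auto simp: B_def)
    qed
  qed auto
  \<comment> \<open>The upper half of the circle as a graph over \<open>[-1, 1]\<close>; its end points \<open>(-1, 0)\<close> and \<open>(1, 0)\<close> are antipodal.\<close>
  define b where "b t = (1 - \<bar>t\<bar> powr p) powr (1 / p)" for t :: real
  have t1: "\<bar>t\<bar> powr p \<le> 1" if "t \<in> {-1..1}" for t
    using powr_mono2[of p "\<bar>t\<bar>" 1] that p_pos by (simp add: abs_le_iff)
  have bT: "(t, b t) \<in> T" if "t \<in> {-1..1}" for t
    using t1[OF that] p_pos by (simp add: T_def b_def powr_powr)
  have b_cont: "continuous_on {-1..1} b"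
    unfolding b_def using p_pos t1
    by (intro continuous_on_powr' continuous_on_diff continuous_on_const continuous_on_rabs continuous_on_id) auto
  have path: "continuous_map (top_of_set {-1..1}) (Vtop \<omega> p l) (\<lambda>t. W (t, b t))"
    unfolding continuous_map_def
  proof (intro conjI allI impI)
    show "(\<lambda>t. W (t, b t)) \<in> topspace (top_of_set {-1..1}) \<rightarrow> topspace (Vtop \<omega> p l)"
      using WV by (simp add: topspace_Vtop)
    fix U assume U: "openin (Vtop \<omega> p l) U"
    have "\<exists>e>0. \<forall>t'\<in>{-1..1}. dist t' t < e \<longrightarrow> W (t', b t') \<in> U" if t: "t \<in> {-1..1}" "W (t, b t) \<in> U" for t
    proof -
      obtain r where r: "r > 0" "\<And>v. v \<in> ?V \<Longrightarrow> ?D (v - W (t, b t)) < r \<Longrightarrow> v \<in> U"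
        using U t(2) unfolding openin_Vtop by blast
      let ?q = "\<lambda>t'. 2 powr p * (\<bar>t' - t\<bar> powr p * ?D v + \<bar>b t' - b t\<bar> powr p * ?D w)"
      have "continuous_on {-1..1} ?q"
        using p_pos by (intro continuous_on_mult continuous_on_add continuous_on_powr' continuous_on_diff continuous_on_const
            continuous_on_rabs continuous_on_id b_cont) auto
      then obtain e where e: "e > 0" "\<And>t'. t' \<in> {-1..1} \<Longrightarrow> dist t' t < e \<Longrightarrow> dist (?q t') (?q t) < r"
        using t(1) r(1) unfolding continuous_on_iff by metis
      have "W (t', b t') \<in> U" if "t' \<in> {-1..1}" "dist t' t < e" for t'
      proof (rule r(2)[OF WV])
        have "?q t' < r" using e(2)[OF that] p_pos by (simp add: dist_real_def)
        then show "?D (W (t', b t') - W (t, b t)) < r" using Wdiff[of "(t', b t')" "(t, b t)"] by simp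
      qed
      then show ?thesis using e(1) by blast
    qed
    then show "openin (top_of_set {-1..1}) {t \<in> topspace (top_of_set {-1..1}). W (t, b t) \<in> U}"
      unfolding openin_euclidean_subtopology_iff by auto
  qed
  have "enat 2 \<le> genus (Vtop \<omega> p l) B"
  proof (rule genus_ge_2I)
    show im: "(\<lambda>t. W (t, b t)) ` {-1..1} \<subseteq> B" using WB[OF bT] by auto
    show "continuous_map (top_of_set {-1..1}) (subtopology (Vtop \<omega> p l) B) (\<lambda>t. W (t, b t))"
      using path im by (simp add: continuous_map_in_subtopology image_subset_iff_funcset)
    show "W (- 1, b (- 1)) = - W (1, b 1)" unfolding Wneg by (simp add: b_def)
  qed
  then have "B \<in> Fset \<omega> p 2 l"
    using closedB symB emB(2) by (auto simp: Fset_def Mset_def B_def)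
  then have "beta A \<omega> p 2 l \<le> (SUP u\<in>B. ereal (energy A \<omega> p l u))"
    unfolding beta_def by (rule INF_lower)
  also have "\<dots> \<le> ereal \<Lambda>" using emB(1) by (intro SUP_least) simp
  finally show ?thesis .
qed

lemma lambdaM1_le_beta_2: "lambdaM1 A \<omega> p l \<le> beta A \<omega> p 2 l"
  unfolding beta_def
proof (rule INF_greatest)
  fix B assume B: "B \<in> Fset \<omega> p 2 l"
  have "B \<noteq> {}" using B genus_empty[of "Vtop \<omega> p l"] by (auto simp: Fset_def zero_enat_def)
  then obtain u where u: "u \<in> B" by blast
  then have uV: "u \<in> Vspace \<omega> p l" and m: "mass \<omega> p l u = 1" using B by (auto simp: Fset_def Mset_def)
  have "\<not> (AE x in lebesgue_on (cylinder \<omega> l). u x = 0)"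
  proof
    assume "AE x in lebesgue_on (cylinder \<omega> l). u x = 0"
    then have "mass \<omega> p l u = 0"
      unfolding mass_def by (intro integral_eq_zero_AE) (auto elim: eventually_mono)
    then show False using m by simp
  qed
  then have "lambdaM1 A \<omega> p l \<le> ereal (energy A \<omega> p l u / mass \<omega> p l u)"
    unfolding lambdaM1_def using uV by (intro INF_lower) auto
  also have "\<dots> \<le> (SUP u\<in>B. ereal (energy A \<omega> p l u))"
    using u by (intro SUP_upper2[OF u]) (simp add: m)
  finally show "lambdaM1 A \<omega> p l \<le> (SUP u\<in>B. ereal (energy A \<omega> p l u))" .
qed

lemma lambdaM1_nonneg: "lambdaM1 A \<omega> p l \<ge> 0"
  unfolding lambdaM1_def by (intro INF_greatest) (simp add: energy_nonneg mass_nonneg)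

lemma lambdaM1_lessD:
  assumes "lambdaM1 A \<omega> p l < ereal \<Lambda>"
  shows "\<exists>\<phi>\<in>test_functions tube. energy_on {-l<..<l} \<phi> < \<Lambda> * mass_on {-l<..<l} \<phi>"
proof -
  obtain u where u: "u \<in> Vspace \<omega> p l" "\<not> (AE x in lebesgue_on (cylinder \<omega> l). u x = 0)"
    "energy A \<omega> p l u / mass \<omega> p l u < \<Lambda>"
    using assms by (auto simp: lambdaM1_def INF_less_iff)
  have i: "integrable (lebesgue_on (cylinder \<omega> l)) (\<lambda>x. \<bar>u x\<bar> powr p)"
    using W1pD(1)[OF cylinder_open_bounded(1) Vspace_W1p[OF u(1)]] by (simp add: Lp_def)
  have "mass \<omega> p l u \<noteq> 0"
  proof
    assume "mass \<omega> p l u = 0"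
    then have "AE x in lebesgue_on (cylinder \<omega> l). \<bar>u x\<bar> powr p = 0"
      unfolding mass_def using integral_nonneg_eq_0_iff_AE[OF i] by simp
    then show False using u(2) by simp
  qed
  then have "mass \<omega> p l u > 0" using mass_nonneg[of l u] by simp
  then have "energy A \<omega> p l u < \<Lambda> * mass \<omega> p l u" using u(3) by (simp add: pos_divide_less_eq)
  from exists_test_function_quotient[OF u(1) this] show ?thesis
    using energy_test mass_test by auto
qed

text \<open>A bump supported in the cylinder of half-length 1 is admissible for every larger one, and its energy and mass
  do not depend on the length.\<close>

lemma lambdaM1_bounded:
  assumes "\<omega> \<noteq> {}"
  shows "\<exists>c. \<forall>l\<ge>1. lambdaM1 A \<omega> p l \<le> ereal c"
proof -
  define U where "U = {x :: real ^ 'm option. x $ None \<in> {-1<..<1} \<and> x \<in> tube}"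
  have U: "open U"
    using cylinder_open_bounded(1)[of 1] by (simp add: U_def cylinder_def tube_def)
  obtain X where X: "X \<in> \<omega>" using assms by blast
  define x0 :: "real ^ 'm option" where "x0 = (\<chi> i. case i of None \<Rightarrow> 0 | Some j \<Rightarrow> X $ j)"
  have "X2 x0 = X" by (simp add: X2_def x0_def vec_eq_iff)
  then have "x0 \<in> U" using X by (simp add: U_def tube_def x0_def)
  then obtain a b where ab: "x0 \<in> box a b" "cbox a b \<subseteq> U"
    by (rule open_contains_cbox[OF U])
  define \<phi> where "\<phi> = box_bump 1 a b"
  have \<phi>: "\<phi> \<in> test_functions tube"
    unfolding \<phi>_def by (rule box_bump_test_function) (use ab in \<open>auto simp: U_def\<close>)
  have pos: "mass_on {-1<..<1} \<phi> \<noteq> 0"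
  proof
    assume "mass_on {-1<..<1} \<phi> = 0"
    then have "AE x in lebesgue. indicator {-1<..<1} (x $ None) * \<bar>\<phi> x\<bar> powr p = (0 :: real)"
      unfolding mass_on_def using integral_nonneg_eq_0_iff_AE[OF integrable_test_on(2)[OF \<phi>, of "-1" 1]] by simp
    then have "AE x in lebesgue. x \<notin> box a b"
    proof eventually_elim
      case (elim x)
      show ?case
      proof
        assume x: "x \<in> box a b"
        then have "x \<in> U" using ab(2) box_subset_cbox[of a b] by blast
        then show False using elim box_bump_pos[of 1 x a b] x by (simp add: U_def \<phi>_def)
      qed
    qed
    then have "box a b \<in> null_sets lebesgue" by (simp add: AE_iff_null_sets)
    then have "negligible (box a b)" by (simp add: negligible_iff_null_sets)
    then show False using ab(1) open_not_negligible[of "box a b"] by blast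
  qed
  moreover have "mass_on {-1<..<1} \<phi> \<ge> 0" by (simp add: mass_on_def)
  ultimately have m1: "mass_on {-1<..<1} \<phi> > 0" by simp
  define E where "E = (\<integral>x. energy_density x (grad \<phi> x) \<partial>lebesgue)"
  have "lambdaM1 A \<omega> p l \<le> ereal (E / mass_on {-1<..<1} \<phi>)" if l: "l \<ge> 1" for l
  proof -
    have m: "mass_on {-1<..<1} \<phi> \<le> mass \<omega> p l \<phi>"
      unfolding mass_test[OF \<phi>] unfolding mass_on_def
      by (intro integral_mono integrable_test_on \<phi>) (use l in \<open>auto simp: indicator_def\<close>)
    have e: "energy A \<omega> p l \<phi> \<le> E"
      unfolding energy_test[OF \<phi>] energy_on_def E_def
      by (intro integral_mono integrable_test_on integrable_test \<phi>) (auto simp: indicator_def energy_density_nonneg)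
    have "\<not> (AE x in lebesgue_on (cylinder \<omega> l). \<phi> x = 0)"
    proof
      assume "AE x in lebesgue_on (cylinder \<omega> l). \<phi> x = 0"
      then have "mass \<omega> p l \<phi> = 0"
        unfolding mass_def by (intro integral_eq_zero_AE) (auto elim: eventually_mono)
      then show False using m m1 by simp
    qed
    then have "lambdaM1 A \<omega> p l \<le> ereal (energy A \<omega> p l \<phi> / mass \<omega> p l \<phi>)"
      unfolding lambdaM1_def using test_function_Vspace[OF \<phi>] by (intro INF_lower) auto
    also have "\<dots> \<le> ereal (E / mass_on {-1<..<1} \<phi>)"
      using m m1 e energy_nonneg[of l \<phi>] by (simp add: frac_le)
    finally show ?thesis .
  qed
  then show ?thesis by blast
qed

end

context symmetric_elliptic_cylinder
begin

text \<open>A single long cylinder in which the first value is below \<open>\<Lambda>\<close> bounds the second value by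
  \<open>\<Lambda> + \<epsilon>\<close> in all cylinders of at least twice its length.\<close>

lemma eventually_beta_2_le:
  assumes freq: "\<exists>\<^sub>F l in at_top. lambdaM1 A \<omega> p l < ereal \<Lambda>" and \<epsilon>: "\<epsilon> > 0"
  shows "\<forall>\<^sub>F l in at_top. beta A \<omega> p 2 l \<le> ereal (\<Lambda> + \<epsilon>)"
proof -
  have "\<Lambda> > 0"
  proof -
    obtain l where "lambdaM1 A \<omega> p l < ereal \<Lambda>" using frequently_ex[OF freq] by blast
    then show ?thesis using lambdaM1_nonneg[of l] by (metis ereal_less(2) le_less_trans)
  qed
  from exists_end_bump[OF this \<epsilon>] obtain L where
    L: "\<And>l \<phi>. l \<ge> L \<Longrightarrow> \<phi> \<in> test_functions tube \<Longrightarrow> energy_on {-l<..<l} \<phi> < \<Lambda> * mass_on {-l<..<l} \<phi> \<Longrightarrow>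
    (\<exists>\<psi>\<in>test_functions tube. (\<exists>c<l. \<forall>x. x $ None \<ge> c \<longrightarrow> \<psi> x = 0) \<and>
       energy_on {-l<..<l} \<psi> < (\<Lambda> + \<epsilon>) * mass_on {-l<..<l} \<psi>)" by blast
  obtain l where l: "l \<ge> L" "lambdaM1 A \<omega> p l < ereal \<Lambda>"
    using frequently_ex[OF frequently_eventually_frequently[OF freq eventually_ge_at_top[of L]]] by blast
  obtain \<phi> where \<phi>: "\<phi> \<in> test_functions tube" "energy_on {-l<..<l} \<phi> < \<Lambda> * mass_on {-l<..<l} \<phi>"
    using lambdaM1_lessD[OF l(2)] by blast
  obtain \<psi> c where \<psi>: "\<psi> \<in> test_functions tube" "c < l" "\<And>x. x $ None \<ge> c \<Longrightarrow> \<psi> x = 0"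
    "energy_on {-l<..<l} \<psi> < (\<Lambda> + \<epsilon>) * mass_on {-l<..<l} \<psi>"
    using L[OF l(1) \<phi>] by blast
  have "beta A \<omega> p 2 l' \<le> ereal (\<Lambda> + \<epsilon>)" if l': "l' \<ge> 2 * l" for l'
  proof -
    obtain v w where vw: "v \<in> test_functions tube" "w \<in> test_functions tube"
      "\<And>x. x $ None \<ge> 0 \<Longrightarrow> v x = 0 \<and> grad v x = 0" "\<And>x. x $ None \<le> 0 \<Longrightarrow> w x = 0 \<and> grad w x = 0"
      "mass_on {-l'<..<l'} v = 1" "mass_on {-l'<..<l'} w = 1"
      "energy_on {-l'<..<l'} v < \<Lambda> + \<epsilon>" "energy_on {-l'<..<l'} w < \<Lambda> + \<epsilon>"
      using exists_two_bumps[OF \<psi> l'] by blast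
    show ?thesis
      by (rule beta_2_le[OF vw(1-6)]) (use vw(7,8) in auto)
  qed
  then show ?thesis unfolding eventually_at_top_linorder by blast
qed

text \<open>From \<open>\<lambda> \<le> \<beta>\<close> and \<open>limsup \<beta> \<le> liminf \<lambda>\<close>, all four lower and upper limits coincide.\<close>

lemma beta_2_lambdaM1_limit:
  "\<exists>L. ((\<lambda>l. beta A \<omega> p 2 l) \<longlongrightarrow> L) at_top \<and> ((\<lambda>l. lambdaM1 A \<omega> p l) \<longlongrightarrow> L) at_top \<and>
       (\<omega> \<noteq> {} \<longrightarrow> \<bar>L\<bar> \<noteq> \<infinity>)"
proof -
  let ?b = "\<lambda>l. beta A \<omega> p 2 l" and ?m = "\<lambda>l. lambdaM1 A \<omega> p l"
  define L where "L = Liminf at_top ?m"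
  have top: "(at_top :: real filter) \<noteq> bot" by (rule trivial_limit_at_top_linorder)
  have "Limsup at_top ?b \<le> L"
  proof (rule ccontr)
    assume "\<not> Limsup at_top ?b \<le> L"
    then have "L < Limsup at_top ?b" by simp
    then obtain d where d: "L < ereal d" "ereal d < Limsup at_top ?b" using ereal_dense2 by blast
    then obtain c where c: "L < ereal c" "ereal c < ereal d" using ereal_dense2 by blast
    have "\<exists>\<^sub>F l in at_top. ?m l < ereal c"
    proof (rule ccontr)
      assume "\<not> (\<exists>\<^sub>F l in at_top. ?m l < ereal c)"
      then have "\<forall>\<^sub>F l in at_top. ereal c \<le> ?m l" by (simp add: not_frequently not_less)
      then have "ereal c \<le> L" unfolding L_def by (rule Liminf_bounded)
      then show False using c(1) by simp
    qed
    then have "\<forall>\<^sub>F l in at_top. ?b l \<le> ereal (c + (d - c))"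
      by (rule eventually_beta_2_le) (use c(2) in simp)
    then have "Limsup at_top ?b \<le> ereal d" by (intro Limsup_bounded) simp
    then show False using d(2) by simp
  qed
  moreover have "L \<le> Limsup at_top ?m" "Liminf at_top ?b \<le> Limsup at_top ?b"
    unfolding L_def by (rule Liminf_le_Limsup[OF top])+
  moreover have "L \<le> Liminf at_top ?b" "Limsup at_top ?m \<le> Limsup at_top ?b"
    unfolding L_def by (intro Liminf_mono Limsup_mono always_eventually allI lambdaM1_le_beta_2)+
  ultimately have eq: "Liminf at_top ?b = L" "Limsup at_top ?b = L" "Limsup at_top ?m = L" by auto
  have lim: "(?b \<longlongrightarrow> L) at_top" "(?m \<longlongrightarrow> L) at_top"
    using eq L_def by (auto simp: tendsto_iff_Liminf_eq_Limsup[OF top])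
  have "\<bar>L\<bar> \<noteq> \<infinity>" if "\<omega> \<noteq> {}"
  proof -
    obtain c where c: "\<And>l. l \<ge> 1 \<Longrightarrow> ?m l \<le> ereal c" using lambdaM1_bounded[OF \<open>\<omega> \<noteq> {}\<close>] by blast
    have "L \<le> ereal c"
      by (rule tendsto_upperbound[OF lim(2) _ top]) (use c in \<open>auto simp: eventually_at_top_linorder\<close>)
    moreover have "0 \<le> L"
      by (rule tendsto_lowerbound[OF lim(2) _ top]) (simp add: lambdaM1_nonneg)
    ultimately show ?thesis by auto
  qed
  then show ?thesis by (intro exI[of _ L] conjI impI lim)
qed

end

theorem theorem1p5:
  fixes \<omega> :: "(real ^ 'm) set"
    and A :: "real ^ 'm \<Rightarrow> real ^ 'm option ^ 'm option"
    and p C lam :: real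
  assumes "bounded \<omega>" and "open \<omega>"
    and "\<And>X. X \<in> \<omega> \<Longrightarrow> transpose (A X) = A X"
    and "\<And>i j. (\<lambda>X. A X $ i $ j) \<in> borel_measurable (lebesgue_on \<omega>)"
    and "C > 0" and "lam > 0"
    and "AE X in lebesgue_on \<omega>. onorm (\<lambda>\<xi>. A X *v \<xi>) \<le> C"
    and "AE X in lebesgue_on \<omega>. \<forall>\<xi>. (A X *v \<xi>) \<bullet> \<xi> \<ge> lam * (norm \<xi>)\<^sup>2"
    and "uminus ` \<omega> = \<omega>"
    and "\<And>X. X \<in> \<omega> \<Longrightarrow> A (- X) = A X"
    and "p > 2"
  shows "\<exists>L. ((\<lambda>l. beta A \<omega> p 2 l) \<longlongrightarrow> L) at_top \<and>
             ((\<lambda>l. lambdaM1 A \<omega> p l) \<longlongrightarrow> L) at_top \<and>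
             (\<omega> \<noteq> {} \<longrightarrow> \<bar>L\<bar> \<noteq> \<infinity>)"
proof -
  interpret symmetric_elliptic_cylinder \<omega> A p C lam
  proof (unfold_locales)
    show "transpose (A X) = A X" if "X \<in> \<omega>" for X by (rule assms(3)[OF that])
    show "A (- X) = A X" if "X \<in> \<omega>" for X by (rule assms(10)[OF that])
  qed (rule assms)+
  show ?thesis by (rule beta_2_lambdaM1_limit)
qed

end
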